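(* Let $P$ be a set of qubits and consider a Clifford monitored circuit on $P$ with fixed two-qubit Clifford gates and fixed locations of single-qubit Pauli-$Z$ measurements. For each measurement-outcome record $\mathbf{m}\in\{0,1\}^{|M|}$ let $C_{\mathbf{m}}$ be the corresponding product of the Clifford unitaries and outcome projectors $\frac{1\pm Z_i}{2}$, and let $p_{\mathbf{m}}=2^{-|P|}\operatorname{tr}(C_{\mathbf{m}}C_{\mathbf{m}}^\dagger)$. Let $M$ be a register of $|M|$ qubits recording the outcomes and define the quantum channel from $P$ to $P\cup M$ $$\mathcal{E}_C(\rho)=\sum_{\mathbf{m}\in\{0,1\}^{|M|}}|\mathbf{m}\rangle\langle\mathbf{m}|_M\otimes C_{\mathbf{m}}\rho C_{\mathbf{m}}^\dagger .$$ Let $R$ be a reference copy of $P$ and, for each $\mathbf m$ with $p_{\mathbf m}\neq 0$, let $|\phi_{\mathbf{m}}\rangle\propto\sum_{\mathbf{s}}(C_{\mathbf{m}}|\mathbf{s}\rangle)_P\otimes|\mathbf{s}\rangle_R$ (normalized). For $A,B\subseteq P$, let $A_R\subseteq R$ be the copy of $A$. Then for every $\mathbf m$ with $p_{\mathbf m}\neq0$, $$I_{A_R:B_P}(|\phi_{\mathbf{m}}\rangle)=\log_2 H_{A\rightarrow B\cup M}(\mathcal{E}_C)-\log_2 H_{A\rightarrow M}(\mathcal{E}_C).$$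
   Context: Mutual information is $I_{X:Y}=S_X+S_Y-S_{XY}$ with von Neumann entropies in base 2. For a channel $\mathcal{E}$ from $P$ to $Q$ and subsets $A\subseteq P$, $S\subseteq Q$, define $$H_{A\rightarrow S}(\mathcal{E})=\big|\{O\in\mathcal{P}_A:\exists\,\tilde{O}_S\in\mathcal{P}_S\text{ with }O=\mathcal{E}^\dagger(\tilde{O}_S)\}\big|,$$ where $\mathcal{E}^\dagger$ is the adjoint (Heisenberg-picture) map, $\mathcal{P}_A$ denotes the Pauli strings supported on $A$ (tensor products of $I,X,Y,Z$ on $A$, identity elsewhere, with coefficient $+1$) and $\mathcal{P}_S$ denotes the Pauli operators supported on $S$ (such tensor products with a sign $\pm1$). *)

theory Defs
  imports "HOL-Analysis.Analysis" "Jordan_Normal_Form.Char_Poly"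
begin

text \<open>
 A system of N qubits labelled 0..N-1 is described by 2^N x 2^N complex matrices;
 the computational basis state with index a (a < 2^N) assigns value (bit a k) to qubit k.
\<close>

definition dagger :: "complex mat \<Rightarrow> complex mat" where
  "dagger A = mat (dim_col A) (dim_row A) (\<lambda>(i,j). cnj (A $$ (j,i)))"

definition mtrace :: "complex mat \<Rightarrow> complex" where
  "mtrace A = (\<Sum>i<dim_row A. A $$ (i,i))"

definition is_unitary :: "complex mat \<Rightarrow> bool" where
  "is_unitary U \<longleftrightarrow> (\<exists>d. U \<in> carrier_mat d d \<and> U * dagger U = 1\<^sub>m d \<and> dagger U * U = 1\<^sub>m d)"

definition pauli1 :: "nat \<Rightarrow> complex mat" where
  "pauli1 k = (if k = 1 then mat 2 2 (\<lambda>(i,j). if i \<noteq> j then 1 else 0)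
     else if k = 2 then mat 2 2 (\<lambda>(i,j). if i = 1 \<and> j = 0 then \<i> else if i = 0 \<and> j = 1 then -\<i> else 0)
     else if k = 3 then mat 2 2 (\<lambda>(i,j). if i = j then (if i = 0 then 1 else -1) else 0)
     else 1\<^sub>m 2)"

definition pauli_string :: "nat \<Rightarrow> (nat \<Rightarrow> nat) \<Rightarrow> complex mat" where
  "pauli_string N s = mat (2^N) (2^N)
     (\<lambda>(a,b). \<Prod>k<N. pauli1 (s k) $$ (if bit a k then 1 else 0, if bit b k then 1 else 0))"

definition paulis_on :: "nat \<Rightarrow> nat set \<Rightarrow> complex mat set" where
  "paulis_on N A = {pauli_string N s | s. (\<forall>k. s k < 4) \<and> (\<forall>k. k \<notin> A \<longrightarrow> s k = 0)}"

definition signed_paulis_on :: "nat \<Rightarrow> nat set \<Rightarrow> complex mat set" where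
  "signed_paulis_on N S = {c \<cdot>\<^sub>m pauli_string N s | c s. (c = 1 \<or> c = -1) \<and>
      (\<forall>k. s k < 4) \<and> (\<forall>k. k \<notin> S \<longrightarrow> s k = 0)}"

definition heis_adjoint :: "nat \<Rightarrow> nat \<Rightarrow> (complex mat \<Rightarrow> complex mat) \<Rightarrow> complex mat \<Rightarrow> complex mat" where
  "heis_adjoint n_in n_out E X = (THE Y. Y \<in> carrier_mat (2^n_in) (2^n_in) \<and>
      (\<forall>\<rho> \<in> carrier_mat (2^n_in) (2^n_in). mtrace (Y * \<rho>) = mtrace (X * E \<rho>)))"

definition H_count :: "nat \<Rightarrow> nat \<Rightarrow> (complex mat \<Rightarrow> complex mat) \<Rightarrow> nat set \<Rightarrow> nat set \<Rightarrow> nat" where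
  "H_count n_in n_out E A S = card {Op \<in> paulis_on n_in A.
      \<exists>Ot \<in> signed_paulis_on n_out S. Op = heis_adjoint n_in n_out E Ot}"

definition clifford2 :: "complex mat \<Rightarrow> bool" where
  "clifford2 U \<longleftrightarrow> U \<in> carrier_mat 4 4 \<and> is_unitary U \<and>
     (\<forall>s. (\<forall>k. s k < 4) \<longrightarrow> (\<exists>T \<in> signed_paulis_on 2 {0,1}.
         U * pauli_string 2 s * dagger U = T))"

datatype circ_op = Gate nat nat "complex mat" | Meas nat

definition wf_op :: "nat \<Rightarrow> circ_op \<Rightarrow> bool" where
  "wf_op n g = (case g of Gate i j U \<Rightarrow> i < n \<and> j < n \<and> i \<noteq> j \<and> clifford2 U
                | Meas i \<Rightarrow> i < n)"

definition is_meas :: "circ_op \<Rightarrow> bool" where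
  "is_meas g = (case g of Meas _ \<Rightarrow> True | _ \<Rightarrow> False)"

definition num_meas :: "circ_op list \<Rightarrow> nat" where
  "num_meas c = length (filter is_meas c)"

definition bitv :: "nat \<Rightarrow> nat \<Rightarrow> nat" where
  "bitv a k = (if bit a k then 1 else 0)"

text \<open>Two-qubit gate U acting on qubits i (first tensor factor) and j of an n-qubit system.\<close>
definition embed_gate :: "nat \<Rightarrow> nat \<Rightarrow> nat \<Rightarrow> complex mat \<Rightarrow> complex mat" where
  "embed_gate n i j U = mat (2^n) (2^n) (\<lambda>(a,b).
     if (\<forall>k. k \<noteq> i \<and> k \<noteq> j \<longrightarrow> bit a k = bit b k)
     then U $$ (2 * bitv a i + bitv a j, 2 * bitv b i + bitv b j) else 0)"

text \<open>Outcome projector (1 + Z_i)/2 for outcome False (bit 0) and (1 - Z_i)/2 for outcome True.\<close>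
definition proj_Z :: "nat \<Rightarrow> nat \<Rightarrow> bool \<Rightarrow> complex mat" where
  "proj_Z n i outc = mat (2^n) (2^n) (\<lambda>(a,b). if a = b \<and> bit a i = outc then 1 else 0)"

text \<open>C_m for the circuit (list of operations in time order) and an outcome list
  (outcomes of the measurements in time order); later operations multiply on the left.\<close>
fun circ_op_mat :: "nat \<Rightarrow> circ_op list \<Rightarrow> bool list \<Rightarrow> complex mat" where
  "circ_op_mat n [] ms = 1\<^sub>m (2^n)"
| "circ_op_mat n (Gate i j U # c) ms = circ_op_mat n c ms * embed_gate n i j U"
| "circ_op_mat n (Meas i # c) ms = circ_op_mat n c (tl ms) * proj_Z n i (hd ms)"

definition outcomes :: "nat \<Rightarrow> nat \<Rightarrow> bool list" where
  "outcomes K m = map (bit m) [0..<K]"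

definition C_m :: "nat \<Rightarrow> circ_op list \<Rightarrow> nat \<Rightarrow> complex mat" where
  "C_m n c m = circ_op_mat n c (outcomes (num_meas c) m)"

definition p_m :: "nat \<Rightarrow> circ_op list \<Rightarrow> nat \<Rightarrow> real" where
  "p_m n c m = Re (mtrace (C_m n c m * dagger (C_m n c m))) / 2^n"

text \<open>The channel E_C from P (qubits 0..n-1) to P \<union> M, where P is qubits 0..n-1 and
  the record register M is qubits n..n+K-1 (qubit n+k stores the k-th outcome):
  E_C(rho) = sum_m |m><m|_M \<otimes> C_m rho C_m^dagger.\<close>
definition channel_C :: "nat \<Rightarrow> circ_op list \<Rightarrow> complex mat \<Rightarrow> complex mat" where
  "channel_C n c \<rho> = (let K = num_meas c in
     mat (2^(n+K)) (2^(n+K)) (\<lambda>(a,b).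
       if a div 2^n = b div 2^n
       then (C_m n c (a div 2^n) * \<rho> * dagger (C_m n c (a div 2^n))) $$ (a mod 2^n, b mod 2^n)
       else 0))"

text \<open>Index of the basis state on N qubits obtained by placing the bits of j (a basis index of
  the qubits in X, listed in increasing order) on the qubits of X and 0 elsewhere.\<close>
definition embed_idx :: "nat set \<Rightarrow> nat \<Rightarrow> nat" where
  "embed_idx X j = (\<Sum>t<card X. if bit j t then 2 ^ (sorted_list_of_set X ! t) else 0)"

definition reduced :: "nat \<Rightarrow> nat set \<Rightarrow> complex mat \<Rightarrow> complex mat" where
  "reduced N X \<rho> = mat (2 ^ card X) (2 ^ card X) (\<lambda>(i,j).
     \<Sum>c \<in> {c. c < 2^N \<and> (\<forall>k \<in> X. \<not> bit c k)}. \<rho> $$ (embed_idx X i + c, embed_idx X j + c))"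

definition vn_entropy :: "complex mat \<Rightarrow> real" where
  "vn_entropy \<rho> = - (\<Sum>l \<in> {l. eigenvalue \<rho> l}.
      real (order l (char_poly \<rho>)) * (if Re l = 0 then 0 else Re l * log 2 (Re l)))"

definition mutual_info :: "nat \<Rightarrow> complex mat \<Rightarrow> nat set \<Rightarrow> nat set \<Rightarrow> real" where
  "mutual_info N \<rho> X Y = vn_entropy (reduced N X \<rho>) + vn_entropy (reduced N Y \<rho>)
      - vn_entropy (reduced N (X \<union> Y) \<rho>)"

text \<open>|phi_m> on P \<union> R (P = qubits 0..n-1, R = qubits n..2n-1, qubit n+k is the copy of qubit k):
  normalized sum_s (C_m|s>)_P \<otimes> |s>_R, as a density matrix.\<close>
definition phi_vec :: "nat \<Rightarrow> circ_op list \<Rightarrow> nat \<Rightarrow> complex vec" where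
  "phi_vec n c m = (let C = C_m n c m;
       nrm = sqrt (\<Sum>p<2^n. \<Sum>r<2^n. (cmod (C $$ (p,r)))^2) in
     vec (2^(2*n)) (\<lambda>x. C $$ (x mod 2^n, x div 2^n) / complex_of_real nrm))"

definition phi_state :: "nat \<Rightarrow> circ_op list \<Rightarrow> nat \<Rightarrow> complex mat" where
  "phi_state n c m = (let v = phi_vec n c m in
     mat (2^(2*n)) (2^(2*n)) (\<lambda>(x,y). v $ x * cnj (v $ y)))"

end

theory Submission
  imports Defs "Jordan_Normal_Form.Schur_Decomposition" "HOL-Library.Nat_Bijection"
begin

text \<open>
  Let \<open>G\<close> be the group of pairs \<open>(s, t)\<close> of Pauli strings for which
  \<open>C\<^sub>m P\<^sub>t = \<plusminus>(-1)\<^bsup>z\<cdot>m\<^esup> P\<^sub>s C\<^sub>m\<close> holds for all records \<open>m\<close> at once, with some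
  \<open>z\<close> independent of \<open>m\<close>. By induction on the circuit \<open>G\<close> has at least \<open>4\<^sup>n\<close> elements: gates act
  on \<open>G\<close> bijectively, and before a measurement of \<open>Z\<^sub>i\<close> every element \<open>g\<close> that anticommutes with
  \<open>Z\<^sub>i\<close> is replaced by \<open>g h Z\<^sub>i\<close>, where \<open>h\<close> is one fixed such element. Every element of \<open>G\<close> stabilizes every
  \<open>\<phi>\<^sub>m\<close> up to sign. By Parseval there is no room for further stabilizers, and all other Pauli
  expectation values vanish. Hence the reduced state on \<open>X\<close> is flat with entropy \<open>|X| - log\<^sub>2 |G\<^sub>X|\<close>, and
  the mutual information is \<open>log\<^sub>2 |G\<^sub>A\<^sub>B| - log\<^sub>2 |G\<^sub>A| - log\<^sub>2 |G\<^sub>B|\<close>, where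
  \<open>|G\<^sub>A\<^sub>B| / |G\<^sub>B|\<close> is the number of strings on \<open>A\<close> that occur in \<open>G\<^sub>A\<^sub>B\<close>.

  On the channel side, write \<open>V = \<Sum>\<^sub>m |m\<rangle> \<otimes> C\<^sub>m\<close>, an isometry. If a Pauli operator \<open>X\<close> satisfies
  \<open>V\<^sup>\<dagger> X V = P\<^sub>t\<close>, then \<open>X V = V P\<^sub>t\<close> because \<open>P\<^sub>t\<close> is unitary. So the
  strings counted by \<open>H\<close> are exactly the \<open>t\<close> on \<open>A\<close> that have a partner \<open>s\<close> on \<open>B\<close> with \<open>(s, t) \<in> G\<close>.
\<close>

unbundle bit_operations_syntax

section \<open>Pauli strings\<close>

lemma bitv_less_2: "bitv a k < 2"
  by (simp add: bitv_def)

lemma bitv_eq_iff: "bitv a k = bitv b k \<longleftrightarrow> bit a k = bit b k"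
  by (simp add: bitv_def)

lemma bit_ge_exp:
  fixes a :: nat
  assumes "a < 2 ^ N" "N \<le> k"
  shows "\<not> bit a k"
proof -
  have "a < 2 ^ k" using assms by (meson less_le_trans one_le_numeral power_increasing)
  then show ?thesis by (simp add: bit_iff_odd)
qed

lemma less_exp_eqI:
  fixes a b :: nat
  assumes "a < 2 ^ N" "b < 2 ^ N" "\<And>k. k < N \<Longrightarrow> bit a k = bit b k"
  shows "a = b"
  using assms bit_ge_exp by (intro bit_eqI) (metis not_le)

lemma less_exp_bitI:
  fixes a :: nat
  assumes "\<And>k. bit a k \<Longrightarrow> k < N"
  shows "a < 2 ^ N"
proof -
  have "take_bit N a = a"
    using assms by (intro bit_eqI) (auto simp: bit_take_bit_iff)
  then show ?thesis
    by (metis take_bit_nat_less_exp)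
qed

lemma bit_add_disjoint:
  fixes a b :: nat
  assumes "\<And>k. \<not> bit a k \<or> \<not> bit b k"
  shows "bit (a + b) k \<longleftrightarrow> bit a k \<or> bit b k"
proof -
  have "a + b = a OR b" using assms by (intro disjunctive_add) auto
  then show ?thesis by (simp add: bit_or_iff)
qed

lemma sum_lessThan_add:
  fixes f :: "nat \<Rightarrow> 'a::comm_monoid_add"
  shows "(\<Sum>x<a+b. f x) = (\<Sum>x<a. f x) + (\<Sum>x<b. f (a + x))"
  by (induction b) (auto simp: algebra_simps)

lemma prod_lessThan_add:
  fixes f :: "nat \<Rightarrow> 'a::comm_monoid_mult"
  shows "(\<Prod>x<a+b. f x) = (\<Prod>x<a. f x) * (\<Prod>x<b. f (a + x))"
  by (induction b) (auto simp: algebra_simps)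

text \<open>Distributivity, one bit at a time: the indices below \<open>2^Suc N\<close> fall into
  two halves that differ only in bit \<open>N\<close>. Products and traces of Pauli strings reduce
  to single qubits through this identity.\<close>

lemma sum_prod_bits:
  fixes g :: "nat \<Rightarrow> nat \<Rightarrow> 'a::comm_semiring_1"
  shows "(\<Sum>x<2^N. \<Prod>k<N. g k (bitv x k)) = (\<Prod>k<N. g k 0 + g k 1)"
proof (induction N)
  case (Suc N)
  have b: "bitv (2^N + x) k = (if k = N then 1 else bitv x k)" if "x < 2^N" for x k
  proof -
    have "bit (2^N + x) k \<longleftrightarrow> bit (2^N :: nat) k \<or> bit x k"
      using bit_ge_exp[OF that] by (intro bit_add_disjoint) (auto simp: bit_exp_iff)
    then show ?thesis by (auto simp: bitv_def bit_exp_iff)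
  qed
  have z: "bitv x N = 0" if "x < 2^N" for x
    using bit_ge_exp[OF that] by (simp add: bitv_def)
  have "(\<Sum>x<2^Suc N. \<Prod>k<Suc N. g k (bitv x k)) =
      (\<Sum>x<2^N. \<Prod>k<Suc N. g k (bitv x k)) + (\<Sum>x<2^N. \<Prod>k<Suc N. g k (bitv (2^N+x) k))"
    using sum_lessThan_add[of _ "2^N" "2^N"] by (simp add: mult_2)
  also have "\<dots> = (\<Sum>x<2^N. (\<Prod>k<N. g k (bitv x k)) * g N 0)
      + (\<Sum>x<2^N. (\<Prod>k<N. g k (bitv x k)) * g N 1)"
    by (auto intro!: arg_cong2[of _ _ _ _ "(+)"] sum.cong prod.cong simp: b z)
  finally show ?case
    by (simp add: Suc.IH flip: sum_distrib_right distrib_left)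
qed simp

section \<open>Algebra of the single-qubit Pauli matrices\<close>

definition pauli_phase :: "nat \<Rightarrow> nat \<Rightarrow> complex" where
  "pauli_phase k l = (if k = 0 \<or> l = 0 \<or> k = l then 1
     else if (k, l) \<in> {(1,2),(2,3),(3,1)} then \<i> else - \<i>)"

lemma less_4_cases: "(k::nat) < 4 \<Longrightarrow> k = 0 \<or> k = 1 \<or> k = 2 \<or> k = 3"
  by auto

lemma less_2_cases_nat: "(k::nat) < 2 \<Longrightarrow> k = 0 \<or> k = 1"
  by auto

text \<open>The codes 0, 1, 2, 3 of I, X, Y, Z turn multiplication up to phase into bitwise XOR: XY
  = iZ corresponds to 1 XOR 2 = 3. The two-term sum is the matrix product written out in the form
  that \<open>sum_prod_bits\<close> produces.\<close>

lemma pauli1_mult: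
  assumes "k < 4" "l < 4" "i < 2" "j < 2"
  shows "pauli1 k $$ (i,0) * pauli1 l $$ (0,j) + pauli1 k $$ (i,1) * pauli1 l $$ (1,j)
     = pauli_phase k l * pauli1 (k XOR l) $$ (i,j)"
  using less_4_cases[OF assms(1)] less_4_cases[OF assms(2)]
    less_2_cases_nat[OF assms(3)] less_2_cases_nat[OF assms(4)]
  by (elim disjE) (simp_all add: pauli1_def pauli_phase_def)

lemma pauli1_cnj: "k < 4 \<Longrightarrow> i < 2 \<Longrightarrow> j < 2 \<Longrightarrow> cnj (pauli1 k $$ (i,j)) = pauli1 k $$ (j,i)"
  by (drule less_4_cases, drule less_2_cases_nat, drule less_2_cases_nat, elim disjE)
     (simp_all add: pauli1_def)

lemma pauli1_transpose:
  "k < 4 \<Longrightarrow> i < 2 \<Longrightarrow> j < 2 \<Longrightarrow> pauli1 k $$ (j,i) = (if k = 2 then -1 else 1) * pauli1 k $$ (i,j)"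
  by (drule less_4_cases, drule less_2_cases_nat, drule less_2_cases_nat, elim disjE)
     (simp_all add: pauli1_def)

lemma pauli1_trace: "k < 4 \<Longrightarrow> pauli1 k $$ (0,0) + pauli1 k $$ (1,1) = (if k = 0 then 2 else 0)"
  by (drule less_4_cases, elim disjE) (simp_all add: pauli1_def)

text \<open>The Pauli matrices form an orthogonal basis of the 2 by 2 matrices; equivalently, the
  sum of P tensor P over the four of them is twice the swap operator, whose entries stand on the
  right.\<close>

lemma pauli1_complete:
  assumes "i < 2" "j < 2" "i' < 2" "j' < 2"
  shows "(\<Sum>k<4. pauli1 k $$ (i,j) * pauli1 k $$ (i',j')) = (if i = j' \<and> j = i' then 2 else 0)"
  using less_2_cases_nat[OF assms(1)] less_2_cases_nat[OF assms(2)]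
    less_2_cases_nat[OF assms(3)] less_2_cases_nat[OF assms(4)]
  by (elim disjE) (simp_all add: pauli1_def numeral_eq_Suc lessThan_Suc)

text \<open>Defined on all naturals rather than as a matrix, so that entries can be rewritten and
  summed without index bounds.\<close>

definition pauli_entry :: "nat \<Rightarrow> (nat \<Rightarrow> nat) \<Rightarrow> nat \<Rightarrow> nat \<Rightarrow> complex" where
  "pauli_entry N s a b = (\<Prod>k<N. pauli1 (s k) $$ (bitv a k, bitv b k))"

lemma pauli_string_eq: "pauli_string N s = mat (2^N) (2^N) (\<lambda>(a,b). pauli_entry N s a b)"
  by (simp add: pauli_string_def pauli_entry_def bitv_def)

lemma pauli_string_carrier [simp]: "pauli_string N s \<in> carrier_mat (2^N) (2^N)"
  by (simp add: pauli_string_eq)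

lemma pauli_string_dim [simp]: "dim_row (pauli_string N s) = 2^N" "dim_col (pauli_string N s) = 2^N"
  by (simp_all add: pauli_string_eq)

lemma pauli_string_index [simp]:
  "a < 2^N \<Longrightarrow> b < 2^N \<Longrightarrow> pauli_string N s $$ (a,b) = pauli_entry N s a b"
  by (simp add: pauli_string_eq)

text \<open>Codes vanish off the support, so a Pauli string on N qubits has exactly one code in
  \<open>strings {..<N}\<close> and counting operators becomes counting functions.\<close>

definition strings :: "nat set \<Rightarrow> (nat \<Rightarrow> nat) set" where
  "strings A = {s. (\<forall>k. s k < 4) \<and> (\<forall>k. k \<notin> A \<longrightarrow> s k = 0)}"

definition sxor :: "(nat \<Rightarrow> nat) \<Rightarrow> (nat \<Rightarrow> nat) \<Rightarrow> nat \<Rightarrow> nat" where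
  "sxor s t = (\<lambda>k. s k XOR t k)"

lemma stringsD: "s \<in> strings A \<Longrightarrow> s k < 4" "s \<in> strings A \<Longrightarrow> k \<notin> A \<Longrightarrow> s k = 0"
  by (auto simp: strings_def)

lemma strings_mono: "A \<subseteq> B \<Longrightarrow> strings A \<subseteq> strings B"
  by (auto simp: strings_def)

lemma zero_strings [simp]: "(\<lambda>_. 0) \<in> strings A"
  by (simp add: strings_def)

lemma xor_less_4: "(a::nat) < 4 \<Longrightarrow> b < 4 \<Longrightarrow> a XOR b < 4"
  by (drule less_4_cases, drule less_4_cases, elim disjE) simp_all

lemma sxor_strings: "s \<in> strings A \<Longrightarrow> t \<in> strings A \<Longrightarrow> sxor s t \<in> strings A"
  by (auto simp: strings_def sxor_def xor_less_4)

lemma sxor_self [simp]: "sxor s s = (\<lambda>_. 0)"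
  by (simp add: sxor_def)

lemma sxor_zero [simp]: "sxor s (\<lambda>_. 0) = s" "sxor (\<lambda>_. 0) s = s"
  by (simp_all add: sxor_def)

lemma sxor_assoc: "sxor (sxor s t) u = sxor s (sxor t u)"
  by (simp add: sxor_def xor.assoc)

lemma sxor_commute: "sxor s t = sxor t s"
  by (simp add: sxor_def xor.commute)

lemma sxor_cancel [simp]: "sxor (sxor s t) t = s"
  by (simp add: sxor_assoc)

lemma sxor_cancel_left [simp]: "sxor t (sxor t s) = s"
  by (simp flip: sxor_assoc)

lemma sxor_eq_zero_iff: "sxor s t = (\<lambda>_. 0) \<longleftrightarrow> s = t"
  by (metis sxor_cancel sxor_self sxor_zero(2))

lemma pauli_string_mult:
  assumes "s \<in> strings A" "t \<in> strings A"
  shows "pauli_string N s * pauli_string N t = (\<Prod>k<N. pauli_phase (s k) (t k)) \<cdot>\<^sub>m pauli_string N (sxor s t)"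
    (is "?L = ?R")
proof (rule eq_matI)
  fix a b assume "a < dim_row ?R" "b < dim_col ?R"
  then have ab: "a < 2^N" "b < 2^N" by auto
  have "?L $$ (a,b) = (\<Sum>x<2^N. pauli_entry N s a x * pauli_entry N t x b)"
    using ab by (simp add: scalar_prod_def lessThan_atLeast0)
  also have "\<dots> = (\<Sum>x<2^N. \<Prod>k<N. pauli1 (s k) $$ (bitv a k, bitv x k) * pauli1 (t k) $$ (bitv x k, bitv b k))"
    by (simp add: pauli_entry_def prod.distrib)
  also have "\<dots> = (\<Prod>k<N. pauli1 (s k) $$ (bitv a k, 0) * pauli1 (t k) $$ (0, bitv b k)
        + pauli1 (s k) $$ (bitv a k, 1) * pauli1 (t k) $$ (1, bitv b k))"
    by (rule sum_prod_bits)
  also have "\<dots> = (\<Prod>k<N. pauli_phase (s k) (t k) * pauli1 (sxor s t k) $$ (bitv a k, bitv b k))"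
    unfolding sxor_def using assms
    by (intro prod.cong refl pauli1_mult) (simp_all add: stringsD bitv_less_2)
  finally show "?L $$ (a,b) = ?R $$ (a,b)"
    using ab by (simp add: pauli_entry_def prod.distrib)
qed auto

lemma pauli_entry_zero:
  assumes "a < 2^N" "b < 2^N"
  shows "pauli_entry N (\<lambda>_. 0) a b = (if a = b then 1 else 0)"
proof (cases "a = b")
  case True
  then show ?thesis
    by (simp add: pauli_entry_def pauli1_def bitv_less_2)
next
  case False
  then obtain k where "k < N" "bit a k \<noteq> bit b k" using less_exp_eqI[OF assms] by blast
  then have "\<exists>k<N. pauli1 0 $$ (bitv a k, bitv b k) = 0"
    by (intro exI[of _ k]) (simp add: pauli1_def bitv_def)
  then show ?thesis using False by (auto simp: pauli_entry_def)
qed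

lemma pauli_string_zero: "pauli_string N (\<lambda>_. 0) = 1\<^sub>m (2^N)"
  by (rule eq_matI) (simp_all add: pauli_entry_zero)

lemma pauli_phase_self [simp]: "pauli_phase k k = 1"
  by (simp add: pauli_phase_def)

lemma pauli_phase_nonzero: "(\<Prod>k<(N::nat). pauli_phase (s k) (t k)) \<noteq> 0"
proof -
  have "pauli_phase k l \<noteq> 0" for k l by (simp add: pauli_phase_def)
  then show ?thesis by simp
qed

lemma pauli_string_square:
  "s \<in> strings A \<Longrightarrow> pauli_string N s * pauli_string N s = 1\<^sub>m (2^N)"
  by (subst pauli_string_mult) (auto simp: pauli_string_zero)

lemma pauli_trace:
  assumes "s \<in> strings {..<N}"
  shows "(\<Sum>a<2^N. pauli_entry N s a a) = (if s = (\<lambda>_. 0) then 2^N else 0)"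
proof -
  have "(\<Sum>a<2^N. pauli_entry N s a a) = (\<Prod>k<N. pauli1 (s k) $$ (0,0) + pauli1 (s k) $$ (1,1))"
    unfolding pauli_entry_def by (rule sum_prod_bits[of "\<lambda>k b. pauli1 (s k) $$ (b,b)"])
  also have "\<dots> = (\<Prod>k<N. if s k = 0 then 2 else 0)"
    using assms by (intro prod.cong refl pauli1_trace) (auto dest: stringsD)
  also have "\<dots> = (if \<forall>k<N. s k = 0 then 2^N else 0)"
    by auto
  finally have sum: "(\<Sum>a<2^N. pauli_entry N s a a) = \<dots>" .
  have "(\<forall>k<N. s k = 0) \<longleftrightarrow> s = (\<lambda>_. 0)"
    using stringsD(2)[OF assms] by (metis lessThan_iff)
  with sum show ?thesis by simp
qed

text \<open>If distinct strings were proportional, their product would be a multiple both of the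
  identity and of a nontrivial, hence traceless, string. The factor c would then be 0, which is
  impossible for an invertible matrix.\<close>

lemma pauli_string_eq_smult_imp_eq:
  assumes st: "s \<in> strings {..<N}" "t \<in> strings {..<N}"
    and eq: "pauli_string N s = c \<cdot>\<^sub>m pauli_string N t"
  shows "s = t"
proof (rule ccontr)
  assume "s \<noteq> t"
  define \<alpha> where "\<alpha> = (\<Prod>k<N. pauli_phase (s k) (t k))"
  have r: "sxor s t \<in> strings {..<N}" "sxor s t \<noteq> (\<lambda>_. 0)"
    using st sxor_strings \<open>s \<noteq> t\<close> by (auto simp: sxor_eq_zero_iff)
  have "\<alpha> \<cdot>\<^sub>m pauli_string N (sxor s t) = pauli_string N s * pauli_string N t"
    using pauli_string_mult[OF st] by (simp add: \<alpha>_def)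
  also have "\<dots> = c \<cdot>\<^sub>m 1\<^sub>m (2^N)"
    unfolding eq by (subst mult_smult_assoc_mat[of _ "2^N" "2^N" _ "2^N"])
      (simp_all add: pauli_string_square[OF st(2)])
  finally have "\<alpha> * pauli_entry N (sxor s t) a a = c" if "a < 2^N" for a
    using that by (auto dest!: arg_cong[where f = "\<lambda>M. M $$ (a,a)"])
  then have "(\<Sum>a<2^N. \<alpha> * pauli_entry N (sxor s t) a a) = 2^N * c"
    by simp
  then have "c = 0" using pauli_trace[OF r(1)] r(2) by (simp flip: sum_distrib_left)
  then have "pauli_string N s * pauli_string N s = 0\<^sub>m (2^N) (2^N)"
    unfolding eq by (intro eq_matI) auto
  then have "1\<^sub>m (2^N) = (0\<^sub>m (2^N) (2^N) :: complex mat)"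
    by (simp add: pauli_string_square[OF st(1)])
  then have "1\<^sub>m (2^N) $$ (0,0) = (0\<^sub>m (2^N) (2^N) :: complex mat) $$ (0,0)" by simp
  then show False by simp
qed

lemma pauli_entry_cnj: "s \<in> strings A \<Longrightarrow> cnj (pauli_entry N s a b) = pauli_entry N s b a"
  by (simp add: pauli_entry_def pauli1_cnj stringsD bitv_less_2)

lemma dagger_pauli_string: "s \<in> strings A \<Longrightarrow> dagger (pauli_string N s) = pauli_string N s"
  by (rule eq_matI) (auto simp: dagger_def pauli_entry_cnj)

text \<open>Y, coded by 2, is the only antisymmetric Pauli matrix, so the sign is (-1) to the number
  of Y letters. It is needed for the reference R, on which operators act transposed.\<close>

definition transpose_sign :: "nat \<Rightarrow> (nat \<Rightarrow> nat) \<Rightarrow> complex" where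
  "transpose_sign N s = (\<Prod>k<N. if s k = 2 then -1 else 1)"

lemma transpose_sign_cases: "transpose_sign N s = 1 \<or> transpose_sign N s = -1"
  unfolding transpose_sign_def by (induction N) auto

lemma pauli_entry_transpose:
  "s \<in> strings A \<Longrightarrow> pauli_entry N s b a = transpose_sign N s * pauli_entry N s a b"
  unfolding pauli_entry_def transpose_sign_def prod.distrib[symmetric]
  by (intro prod.cong refl pauli1_transpose) (auto simp: stringsD bitv_less_2)

lemma bitv_mod: "k < n \<Longrightarrow> bitv (a mod 2^n) k = bitv a k"
  by (simp add: bitv_def bit_take_bit_iff flip: take_bit_eq_mod)

lemma bitv_div: "bitv (a div 2^n) k = bitv a (n + k)"
  by (simp add: bitv_def bit_drop_bit_eq flip: drop_bit_eq_div)

text \<open>The low n bits of an index form the first register and the higher bits the second. This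
  tensor factorization serves both for P with the record M and for P with the reference R.\<close>

lemma pauli_entry_add:
  "pauli_entry (n + K) s a b =
     pauli_entry n s (a mod 2^n) (b mod 2^n) * pauli_entry K (\<lambda>k. s (n + k)) (a div 2^n) (b div 2^n)"
  by (simp add: pauli_entry_def prod_lessThan_add bitv_mod bitv_div)

lemma pauli_entry_cong: "(\<And>k. k < n \<Longrightarrow> s k = t k) \<Longrightarrow> pauli_entry n s a b = pauli_entry n t a b"
  by (simp add: pauli_entry_def)

section \<open>Counting strings, and completeness of the Pauli basis on a subset of qubits\<close>

lemma strings_bij: "bij_betw (\<lambda>g. restrict g A) (strings A) (PiE A (\<lambda>_. {..<4}))"
proof (rule bij_betwI[where g = "\<lambda>g k. if k \<in> A then g k else 0"])
  show "(\<lambda>g. restrict g A) \<in> strings A \<rightarrow> A \<rightarrow>\<^sub>E {..<4}"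
    by (auto simp: strings_def)
  show "(\<lambda>g k. if k \<in> A then g k else 0) \<in> (A \<rightarrow>\<^sub>E {..<4}) \<rightarrow> strings A"
    by (auto simp: strings_def PiE_def Pi_def)
  show "(\<lambda>k. if k \<in> A then restrict x A k else 0) = x" if "x \<in> strings A" for x
    using that by (auto simp: strings_def)
  show "restrict (\<lambda>k. if k \<in> A then y k else 0) A = y" if "y \<in> A \<rightarrow>\<^sub>E {..<4}" for y
    using that by (auto simp: fun_eq_iff PiE_def extensional_def)
qed

lemma finite_strings [simp]: "finite A \<Longrightarrow> finite (strings A)"
  using bij_betw_finite[OF strings_bij] by (simp add: finite_PiE)

lemma card_strings: "finite A \<Longrightarrow> card (strings A) = 4 ^ card A"
  using bij_betw_same_card[OF strings_bij, of A] by (simp add: card_PiE)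

lemma sum_strings_prod:
  fixes F :: "nat \<Rightarrow> nat \<Rightarrow> 'a::comm_semiring_1"
  assumes "finite A"
  shows "(\<Sum>s\<in>strings A. \<Prod>k\<in>A. F k (s k)) = (\<Prod>k\<in>A. \<Sum>j<4. F k j)"
proof -
  have "(\<Prod>k\<in>A. \<Sum>j<4. F k j) = (\<Sum>g\<in>PiE A (\<lambda>_. {..<4}). \<Prod>k\<in>A. F k (g k))"
    using assms by (subst prod_sum_PiE) auto
  also have "\<dots> = (\<Sum>s\<in>strings A. \<Prod>k\<in>A. F k (restrict s A k))"
    by (rule sum.reindex_bij_betw[OF strings_bij, symmetric])
  finally show ?thesis by simp
qed

text \<open>These indices label the basis of the qubits in X inside the global index range, so that
  adding labels of disjoint sets gives the joint label.\<close>

definition idx_on :: "nat set \<Rightarrow> nat set" where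
  "idx_on X = {a. \<forall>k. bit a k \<longrightarrow> k \<in> X}"

lemma idx_on_lessThan: "idx_on {..<N} = {..<2^N}"
  using bit_ge_exp less_exp_bitI by (fastforce simp: idx_on_def not_le)

lemma idx_on_mono: "X \<subseteq> Y \<Longrightarrow> idx_on X \<subseteq> idx_on Y"
  by (auto simp: idx_on_def)

lemma pauli_complete:
  assumes X: "X \<subseteq> {..<N}" and "a \<in> idx_on X" "b \<in> idx_on X" "c \<in> idx_on X" "d \<in> idx_on X"
  shows "(\<Sum>u\<in>strings X. pauli_entry N u a b * pauli_entry N u c d)
     = (if a = d \<and> b = c then 2 ^ card X else 0)"
proof -
  have fin: "finite X" using X finite_subset by blast
  have z: "bitv x k = 0" if "x \<in> idx_on X" "k \<notin> X" for x k
    using that by (auto simp: idx_on_def bitv_def)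
  have *: "pauli_entry N u x y = (\<Prod>k\<in>X. pauli1 (u k) $$ (bitv x k, bitv y k))"
    if "u \<in> strings X" "x \<in> idx_on X" "y \<in> idx_on X" for u x y
    unfolding pauli_entry_def using that X
    by (intro prod.mono_neutral_right) (auto simp: z stringsD pauli1_def)
  have "(\<Sum>u\<in>strings X. pauli_entry N u a b * pauli_entry N u c d)
      = (\<Sum>u\<in>strings X. \<Prod>k\<in>X. pauli1 (u k) $$ (bitv a k, bitv b k) * pauli1 (u k) $$ (bitv c k, bitv d k))"
    using assms by (intro sum.cong refl) (simp add: * prod.distrib)
  also have "\<dots> = (\<Prod>k\<in>X. \<Sum>j<4. pauli1 j $$ (bitv a k, bitv b k) * pauli1 j $$ (bitv c k, bitv d k))"
    by (rule sum_strings_prod[OF fin])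
  also have "\<dots> = (\<Prod>k\<in>X. if bitv a k = bitv d k \<and> bitv b k = bitv c k then 2 else 0)"
    by (intro prod.cong refl pauli1_complete) (auto simp: bitv_less_2)
  also have "\<dots> = (if \<forall>k\<in>X. bit a k = bit d k \<and> bit b k = bit c k then 2 ^ card X else 0)"
    using fin by (auto simp: bitv_eq_iff)
  finally have sum: "(\<Sum>u\<in>strings X. pauli_entry N u a b * pauli_entry N u c d) = \<dots>" .
  have "(\<forall>k\<in>X. bit a k = bit d k \<and> bit b k = bit c k) \<longleftrightarrow> a = d \<and> b = c"
  proof
    assume *: "\<forall>k\<in>X. bit a k = bit d k \<and> bit b k = bit c k"
    have off: "\<not> bit x k" if "x \<in> idx_on X" "k \<notin> X" for x k
      using that unfolding idx_on_def by blast
    have "bit a k = bit d k" "bit b k = bit c k" for k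
      using * off[OF assms(2), of k] off[OF assms(3), of k] off[OF assms(4), of k] off[OF assms(5), of k]
      by (cases "k \<in> X"; blast)+
    then show "a = d \<and> b = c" by (blast intro: bit_eqI)
  qed auto
  with sum show ?thesis by simp
qed

section \<open>Entropies of reduced stabilizer states\<close>

lemma mtrace_mult_commute:
  assumes "A \<in> carrier_mat n m" "B \<in> carrier_mat m n"
  shows "mtrace (A * B) = mtrace (B * A)"
proof -
  have "mtrace (A * B) = (\<Sum>i<n. \<Sum>j<m. A $$ (i,j) * B $$ (j,i))"
    using assms by (simp add: mtrace_def scalar_prod_def lessThan_atLeast0)
  also have "\<dots> = (\<Sum>j<m. \<Sum>i<n. B $$ (j,i) * A $$ (i,j))"
    by (subst sum.swap) (simp add: mult.commute)
  also have "\<dots> = mtrace (B * A)"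
    using assms by (simp add: mtrace_def scalar_prod_def lessThan_atLeast0)
  finally show ?thesis .
qed

text \<open>The Schur decomposition gives a similar matrix with diagonal \<open>as\<close>, and the
  trace is invariant under similarity.\<close>

lemma mtrace_eq_sum_list_eigenvalues:
  assumes A: "A \<in> carrier_mat d d" and c: "char_poly A = (\<Prod>a\<leftarrow>as. [:- a, 1:])"
  shows "mtrace A = sum_list as"
proof -
  obtain B P Q where "schur_decomposition A as = (B,P,Q)"
    by (cases "schur_decomposition A as") auto
  from schur_decomposition[OF A c this]
  have w: "similar_mat_wit A B P Q" and B: "diag_mat B = as" by auto
  note D = similar_mat_witD2[OF A w]
  have "mtrace A = mtrace (P * (B * Q))"
    unfolding D(3) using D by (simp add: assoc_mult_mat[of P d d B d Q d])
  also have "\<dots> = mtrace ((B * Q) * P)"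
    using D by (intro mtrace_mult_commute[of _ d d]) auto
  also have "(B * Q) * P = B"
    using D by (simp add: assoc_mult_mat[of B d d Q d P d])
  also have "mtrace B = sum_list (diag_mat B)"
    by (simp add: mtrace_def diag_mat_def sum_list_sum_nth lessThan_atLeast0)
  finally show ?thesis by (simp add: B)
qed

lemma order_prod_linear_factors:
  "Polynomial.order l (\<Prod>a\<leftarrow>as. [:- a, 1:]) = count_list as (l :: complex)"
proof (induction as)
  case (Cons a as)
  have nz: "[:- a, 1:] * (\<Prod>a\<leftarrow>as. [:- a, 1:]) \<noteq> 0"
    by (auto simp: prod_list_zero_iff simp del: mult_pCons_left)
  show ?case
    unfolding list.map prod_list.Cons order_mult[OF nz] Cons.IH by (simp add: order_linear')
qed simp

lemma sum_list_two_values: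
  "set as \<subseteq> {0, l} \<Longrightarrow> sum_list as = of_nat (count_list as l) * (l::complex)"
  by (induction as) (auto simp: algebra_simps)

text \<open>The quadratic equation leaves only 0 and \<mu> as eigenvalues, and trace 1 makes the
  multiplicity of \<mu> equal to 1/\<mu>. Algebraic multiplicities are the right ones here, since
  \<open>vn_entropy\<close> takes root orders of the characteristic polynomial.\<close>

lemma vn_entropy_flat:
  assumes R: "R \<in> carrier_mat d d" and sq: "R * R = complex_of_real \<mu> \<cdot>\<^sub>m R"
    and tr: "mtrace R = 1" and pos: "\<mu> > 0"
  shows "vn_entropy R = - log 2 \<mu>"
proof -
  obtain as where as: "char_poly R = (\<Prod>a\<leftarrow>as. [:- a, 1:])"
    using char_poly_factorized[OF R] by blast
  have eig: "l = 0 \<or> l = \<mu>" if "eigenvalue R l" for l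
  proof -
    from that obtain v where v: "v \<in> carrier_vec d" "v \<noteq> 0\<^sub>v d" "R *\<^sub>v v = l \<cdot>\<^sub>v v"
      using R by (auto simp: eigenvalue_def eigenvector_def)
    have "(R * R) *\<^sub>v v = l \<cdot>\<^sub>v (l \<cdot>\<^sub>v v)"
      using R v by (simp add: assoc_mult_mat_vec[of _ d d _ d] mult_mat_vec[of R d d])
    moreover have "(R * R) *\<^sub>v v = \<mu> \<cdot>\<^sub>v (l \<cdot>\<^sub>v v)"
    proof -
      have "(\<mu> \<cdot>\<^sub>m R) *\<^sub>v v = \<mu> \<cdot>\<^sub>v (R *\<^sub>v v)"
        using R v(1) by (intro eq_vecI) (auto simp: scalar_prod_def sum_distrib_left mult.assoc)
      then show ?thesis by (simp add: sq v(3))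
    qed
    ultimately have "l * (l * v $ i) = \<mu> * (l * v $ i)" if "i < d" for i
      using v(1) that by (auto dest!: arg_cong[where f = "\<lambda>w. w $ i"])
    moreover obtain i where "i < d" "v $ i \<noteq> 0"
      using v(1,2) by (metis eq_vecI carrier_vecD index_zero_vec)
    ultimately show ?thesis by (metis mult.assoc mult_cancel_right)
  qed
  have root: "eigenvalue R l \<longleftrightarrow> l \<in> set as" for l
    unfolding eigenvalue_root_char_poly[OF R] as by (auto simp: poly_prod_list prod_list_zero_iff)
  define N where "N = Polynomial.order (complex_of_real \<mu>) (char_poly R)"
  have "1 = of_nat (count_list as \<mu>) * complex_of_real \<mu>"
    using mtrace_eq_sum_list_eigenvalues[OF R as] tr sum_list_two_values[of as \<mu>] eig root by auto
  then have N: "of_nat N * complex_of_real \<mu> = 1"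
    by (simp add: N_def as order_prod_linear_factors)
  then have N': "real N * \<mu> = 1"
    by (metis of_real_1 of_real_eq_iff of_real_mult of_real_of_nat_eq)
  have ev: "eigenvalue R \<mu>"
  proof (rule ccontr)
    assume "\<not> eigenvalue R \<mu>"
    then have "N = 0" by (simp add: N_def eigenvalue_root_char_poly[OF R] order_0I)
    with N' show False by simp
  qed
  let ?f = "\<lambda>l. real (Polynomial.order l (char_poly R)) * (if Re l = 0 then 0 else Re l * log 2 (Re l))"
  have "(\<Sum>l \<in> {l. eigenvalue R l}. ?f l) = (\<Sum>l \<in> {complex_of_real \<mu>}. ?f l)"
  proof (rule sum.mono_neutral_right)
    show "finite {l. eigenvalue R l}"
      using eig finite_subset[of "{l. eigenvalue R l}" "{0, complex_of_real \<mu>}"] by auto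
    show "\<forall>l\<in>{l. eigenvalue R l} - {complex_of_real \<mu>}. ?f l = 0"
      using eig by fastforce
  qed (use ev in auto)
  also have "\<dots> = (real N * \<mu>) * log 2 \<mu>"
    using pos by (simp add: N_def)
  finally show ?thesis by (simp add: vn_entropy_def N')
qed

section \<open>Splitting basis indices between X and its complement; expansion in Pauli
  strings\<close>

lemma bit_set_encode: "finite S \<Longrightarrow> bit (set_encode S) k \<longleftrightarrow> k \<in> S"
  using set_encode_inverse[of S] by (auto simp: bit_iff_odd set_decode_def)

lemma finite_idx_on: "finite X \<Longrightarrow> finite (idx_on X)"
proof -
  assume "finite X"
  then obtain N where "X \<subseteq> {..<N}" using finite_nat_iff_bounded by blast
  then show ?thesis using idx_on_mono[of X "{..<N}"] by (simp add: idx_on_lessThan finite_subset)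
qed

lemma bit_add_idx:
  assumes "a \<in> idx_on X" "c \<in> idx_on Y" "X \<inter> Y = {}"
  shows "bit (a + c) k \<longleftrightarrow> bit a k \<or> bit c k"
  using assms by (intro bit_add_disjoint) (auto simp: idx_on_def)

text \<open>Adding numbers with disjoint bits produces no carries, so masking with the bit sets of X
  and of its complement undoes the addition.\<close>

lemma idx_on_split:
  assumes "X \<subseteq> {..<N}"
  shows "bij_betw (\<lambda>(a,c). a + c) (idx_on X \<times> idx_on ({..<N} - X)) {..<2^N}"
proof -
  have fin: "finite X" "finite ({..<N} - X)" using assms finite_subset by auto
  let ?m = "\<lambda>x. (x AND set_encode X, x AND set_encode ({..<N} - X))"
  have bit: "bit (a + c) k \<longleftrightarrow> bit a k \<or> bit c k"
    if "a \<in> idx_on X" "c \<in> idx_on ({..<N} - X)" for a c k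
    using that by (intro bit_add_idx) auto
  have m: "fst (?m x) \<in> idx_on X" "snd (?m x) \<in> idx_on ({..<N} - X)" for x
    by (auto simp: idx_on_def bit_and_iff bit_set_encode fin)
  show ?thesis
  proof (rule bij_betwI[where g = ?m])
    show "(\<lambda>(a,c). a + c) \<in> idx_on X \<times> idx_on ({..<N} - X) \<rightarrow> {..<2^N}"
    proof (rule Pi_I)
      fix x assume "x \<in> idx_on X \<times> idx_on ({..<N} - X)"
      then obtain a c where x: "x = (a,c)" and ac: "a \<in> idx_on X" "c \<in> idx_on ({..<N} - X)"
        by (cases x) auto
      have "k < N" if "bit (a + c) k" for k
        using that ac assms unfolding bit[OF ac] idx_on_def by blast
      then have "a + c < 2^N" by (rule less_exp_bitI)
      then show "(case x of (a,c) \<Rightarrow> a + c) \<in> {..<2^N}" by (simp add: x)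
    qed
    show "?m \<in> {..<2^N} \<rightarrow> idx_on X \<times> idx_on ({..<N} - X)"
      using m by auto
    show "?m (case x of (a, c) \<Rightarrow> a + c) = x" if x0: "x \<in> idx_on X \<times> idx_on ({..<N} - X)" for x
    proof -
      obtain a c where x: "x = (a, c)" "a \<in> idx_on X" "c \<in> idx_on ({..<N} - X)" using x0 by blast
      have *: "bit a k \<Longrightarrow> k \<in> X" "bit c k \<Longrightarrow> k \<in> {..<N} - X" for k
        using x(2,3) unfolding idx_on_def by blast+
      have "bit (fst (?m (a + c))) k = bit a k" "bit (snd (?m (a + c))) k = bit c k" for k
        using * [of k] by (simp_all only: fst_conv snd_conv bit_and_iff bit_set_encode fin bit[OF x(2,3)]) blast+
      then have "fst (?m (a + c)) = a" "snd (?m (a + c)) = c" by (auto intro: bit_eqI)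
      then show ?thesis by (simp add: x)
    qed
    show "(case ?m x of (a, c) \<Rightarrow> a + c) = x" if "x \<in> {..<2^N}" for x
    proof -
      have xN: "bit x k \<Longrightarrow> k < N" for k using that bit_ge_exp[of x N k] by (meson lessThan_iff not_le)
      have "bit (fst (?m x) + snd (?m x)) k = bit x k" for k
        unfolding bit[OF m] using xN by (auto simp: bit_and_iff bit_set_encode fin)
      then show ?thesis by (auto intro: bit_eqI)
    qed
  qed
qed

lemma sum_idx_split:
  fixes f :: "nat \<Rightarrow> 'a::comm_monoid_add"
  assumes "X \<subseteq> {..<N}"
  shows "(\<Sum>x<2^N. f x) = (\<Sum>a\<in>idx_on X. \<Sum>c\<in>idx_on ({..<N} - X). f (a + c))"
  using sum.reindex_bij_betw[OF idx_on_split[OF assms], of f]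
  by (simp add: sum.cartesian_product case_prod_unfold)

text \<open>Off X the string consists of identities, whose factors compare c and d bit by
  bit.\<close>

lemma pauli_entry_idx_split:
  assumes X: "X \<subseteq> {..<N}" and u: "u \<in> strings X"
    and ab: "a \<in> idx_on X" "b \<in> idx_on X"
    and cd: "c \<in> idx_on ({..<N} - X)" "d \<in> idx_on ({..<N} - X)"
  shows "pauli_entry N u (a + c) (b + d) = (if c = d then pauli_entry N u a b else 0)"
proof -
  have bits: "bitv (x + y) k = (if k \<in> X then bitv x k else bitv y k)"
    if "x \<in> idx_on X" "y \<in> idx_on ({..<N} - X)" for x y k
    using bit_add_idx[of x X y "{..<N} - X" k] that by (auto simp: bitv_def idx_on_def)
  have z: "bitv x k = 0" if "x \<in> idx_on X" "k \<notin> X" for x k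
    using that by (auto simp: bitv_def idx_on_def)
  show ?thesis
  proof (cases "c = d")
    case True
    then show ?thesis
      using ab cd stringsD(2)[OF u] unfolding pauli_entry_def
      by (auto intro!: prod.cong simp: bits z pauli1_def bitv_less_2)
  next
    case False
    have c2: "k \<in> {..<N} - X" if "bit c k \<or> bit d k" for k
      using cd that unfolding idx_on_def by blast
    from False obtain k where "bit c k \<noteq> bit d k" by (metis bit_eqI)
    with c2[of k] have k: "k < N" "k \<notin> X" by auto
    with \<open>bit c k \<noteq> bit d k\<close> have "bitv (a + c) k \<noteq> bitv (b + d) k"
      by (simp add: bits[OF ab(1) cd(1)] bits[OF ab(2) cd(2)] bitv_eq_iff)
    note k = k this
    have "\<exists>k\<in>{..<N}. pauli1 (u k) $$ (bitv (a + c) k, bitv (b + d) k) = 0"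
      using k by (intro bexI[of _ k]) (simp_all add: stringsD(2)[OF u] pauli1_def bitv_less_2)
    then show ?thesis using False by (simp add: pauli_entry_def)
  qed
qed

text \<open>\<open>pauli_complete\<close> collapses the double sum to one term. R is an arbitrary
  array, so that the expansion applies both to the full projector in \<open>pauli_parseval\<close>
  and to reduced states.\<close>

lemma pauli_expansion:
  assumes X: "X \<subseteq> {..<N}" and ab: "a \<in> idx_on X" "b \<in> idx_on X"
  shows "2 ^ card X * R a b =
    (\<Sum>u\<in>strings X. pauli_entry N u a b * (\<Sum>c\<in>idx_on X. \<Sum>d\<in>idx_on X. pauli_entry N u c d * R d c))"
proof -
  have fin: "finite (idx_on X)" using X finite_idx_on finite_subset by blast
  have "(\<Sum>u\<in>strings X. pauli_entry N u a b * (\<Sum>c\<in>idx_on X. \<Sum>d\<in>idx_on X. pauli_entry N u c d * R d c))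
     = (\<Sum>u\<in>strings X. \<Sum>c\<in>idx_on X. \<Sum>d\<in>idx_on X. pauli_entry N u a b * pauli_entry N u c d * R d c)"
    by (simp add: sum_distrib_left mult.assoc)
  also have "\<dots> = (\<Sum>c\<in>idx_on X. \<Sum>d\<in>idx_on X. (\<Sum>u\<in>strings X. pauli_entry N u a b * pauli_entry N u c d) * R d c)"
    by (subst sum.swap, rule sum.cong[OF refl], subst sum.swap) (simp add: sum_distrib_right)
  also have "\<dots> = (\<Sum>c\<in>idx_on X. \<Sum>d\<in>idx_on X. (if a = d then if b = c then 2 ^ card X * R d c else 0 else 0))"
    using ab by (intro sum.cong refl) (auto simp: pauli_complete[OF X])
  also have "\<dots> = 2 ^ card X * R a b"
    using ab fin by (simp add: sum.delta)
  finally show ?thesis by simp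
qed

section \<open>Pauli expectation values, partial traces and the entropy of a stabilizer
  state\<close>

definition pauli_exp :: "nat \<Rightarrow> (nat \<Rightarrow> complex) \<Rightarrow> (nat \<Rightarrow> nat) \<Rightarrow> complex" where
  "pauli_exp N \<psi> u = (\<Sum>a<2^N. \<Sum>b<2^N. pauli_entry N u a b * (\<psi> b * cnj (\<psi> a)))"

text \<open>Expanding one of the two factors leaves \<open>2^N\<close> times the purity of the
  projector onto \<psi>, which is 1. Plain squares are squared moduli here because the values are
  real (\<open>pauli_exp_real\<close>).\<close>

lemma pauli_parseval:
  assumes "(\<Sum>a<2^N. \<psi> a * cnj (\<psi> a)) = 1"
  shows "(\<Sum>u\<in>strings {..<N}. pauli_exp N \<psi> u * pauli_exp N \<psi> u) = 2 ^ N"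
proof -
  have "(\<Sum>u\<in>strings {..<N}. pauli_exp N \<psi> u * pauli_exp N \<psi> u)
    = (\<Sum>u\<in>strings {..<N}. \<Sum>a<2^N. \<Sum>b<2^N. pauli_entry N u a b * pauli_exp N \<psi> u * (\<psi> b * cnj (\<psi> a)))"
    by (subst (2) pauli_exp_def) (simp add: sum_distrib_left mult_ac)
  also have "\<dots> = (\<Sum>a<2^N. \<Sum>b<2^N. (\<Sum>u\<in>strings {..<N}. pauli_entry N u a b * pauli_exp N \<psi> u) * (\<psi> b * cnj (\<psi> a)))"
    by (subst sum.swap, rule sum.cong[OF refl], subst sum.swap) (simp add: sum_distrib_right)
  also have "\<dots> = (\<Sum>a<2^N. \<Sum>b<2^N. 2 ^ N * (\<psi> a * cnj (\<psi> b)) * (\<psi> b * cnj (\<psi> a)))"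
    using pauli_expansion[of "{..<N}" N _ _ "\<lambda>a b. \<psi> a * cnj (\<psi> b)"]
    by (intro sum.cong refl) (simp add: idx_on_lessThan pauli_exp_def)
  also have "\<dots> = 2 ^ N * ((\<Sum>a<2^N. \<psi> a * cnj (\<psi> a)) * (\<Sum>b<2^N. \<psi> b * cnj (\<psi> b)))"
    by (simp add: sum_product) (simp add: sum_distrib_left mult_ac)
  finally show ?thesis using assms by simp
qed

lemma pauli_exp_real:
  assumes "u \<in> strings A"
  shows "cnj (pauli_exp N \<psi> u) = pauli_exp N \<psi> u"
proof -
  have "cnj (pauli_exp N \<psi> u) = (\<Sum>a<2^N. \<Sum>b<2^N. pauli_entry N u b a * (\<psi> a * cnj (\<psi> b)))"
    by (simp add: pauli_exp_def pauli_entry_cnj[OF assms] mult_ac)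
  also have "\<dots> = pauli_exp N \<psi> u"
    unfolding pauli_exp_def by (rule sum.swap)
  finally show ?thesis .
qed

text \<open>The partial trace of the projector onto \<psi>, with rows and columns labelled by
  \<open>idx_on X\<close>; \<open>reduced_outer\<close> translates to the consecutive labels of
  \<open>reduced\<close>.\<close>

definition partial_state :: "nat \<Rightarrow> nat set \<Rightarrow> (nat \<Rightarrow> complex) \<Rightarrow> nat \<Rightarrow> nat \<Rightarrow> complex" where
  "partial_state N X \<psi> a b = (\<Sum>c\<in>idx_on ({..<N} - X). \<psi> (a + c) * cnj (\<psi> (b + c)))"

text \<open>A string supported on X may act before or after the other qubits are traced out. So a
  string that fixes \<psi> up to sign fixes the reduced state up to the same sign.\<close>

lemma pauli_partial_state:
  assumes X: "X \<subseteq> {..<N}" and u: "u \<in> strings X" and ad: "a \<in> idx_on X" "d \<in> idx_on X"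
  shows "(\<Sum>b\<in>idx_on X. pauli_entry N u a b * partial_state N X \<psi> b d) =
    (\<Sum>c\<in>idx_on ({..<N} - X). (\<Sum>y<2^N. pauli_entry N u (a + c) y * \<psi> y) * cnj (\<psi> (d + c)))"
proof -
  have fin: "finite (idx_on ({..<N} - X))" by (simp add: finite_idx_on)
  have "(\<Sum>y<2^N. pauli_entry N u (a + c) y * \<psi> y) = (\<Sum>b\<in>idx_on X. pauli_entry N u a b * \<psi> (b + c))"
    if c: "c \<in> idx_on ({..<N} - X)" for c
  proof -
    have "(\<Sum>y<2^N. pauli_entry N u (a + c) y * \<psi> y) =
      (\<Sum>b\<in>idx_on X. \<Sum>c'\<in>idx_on ({..<N} - X). pauli_entry N u (a + c) (b + c') * \<psi> (b + c'))"
      by (rule sum_idx_split[OF X])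
    also have "\<dots> = (\<Sum>b\<in>idx_on X. \<Sum>c'\<in>idx_on ({..<N} - X). if c = c' then pauli_entry N u a b * \<psi> (b + c') else 0)"
      using ad c by (intro sum.cong refl) (simp add: pauli_entry_idx_split[OF X u])
    also have "\<dots> = (\<Sum>b\<in>idx_on X. pauli_entry N u a b * \<psi> (b + c))"
      using c fin by (simp add: sum.delta)
    finally show ?thesis .
  qed
  then have "(\<Sum>c\<in>idx_on ({..<N} - X). (\<Sum>y<2^N. pauli_entry N u (a + c) y * \<psi> y) * cnj (\<psi> (d + c)))
     = (\<Sum>c\<in>idx_on ({..<N} - X). \<Sum>b\<in>idx_on X. pauli_entry N u a b * \<psi> (b + c) * cnj (\<psi> (d + c)))"
    by (simp add: sum_distrib_right)
  also have "\<dots> = (\<Sum>b\<in>idx_on X. pauli_entry N u a b * partial_state N X \<psi> b d)"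
    by (subst sum.swap) (simp add: partial_state_def sum_distrib_left mult_ac)
  finally show ?thesis by simp
qed

lemma pauli_partial_state_trace:
  assumes X: "X \<subseteq> {..<N}" and u: "u \<in> strings X"
  shows "(\<Sum>a\<in>idx_on X. \<Sum>b\<in>idx_on X. pauli_entry N u a b * partial_state N X \<psi> b a) = pauli_exp N \<psi> u"
proof -
  have "(\<Sum>a\<in>idx_on X. \<Sum>b\<in>idx_on X. pauli_entry N u a b * partial_state N X \<psi> b a) =
    (\<Sum>x<2^N. (\<Sum>y<2^N. pauli_entry N u x y * \<psi> y) * cnj (\<psi> x))"
    unfolding sum_idx_split[OF X, of "\<lambda>x. (\<Sum>y<2^N. pauli_entry N u x y * \<psi> y) * cnj (\<psi> x)"]
    by (intro sum.cong refl pauli_partial_state[OF X u])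
  then show ?thesis by (simp add: pauli_exp_def sum_distrib_right mult.assoc)
qed

text \<open>Bit t of the argument moves to the t-th smallest element of X, and reading the bits at
  these positions is the inverse. The defining sum has distinct powers of two, hence is a
  \<open>set_encode\<close> with known bits.\<close>

lemma embed_idx_bij:
  assumes "finite X"
  shows "bij_betw (embed_idx X) {..<2 ^ card X} (idx_on X)"
proof -
  let ?xs = "sorted_list_of_set X"
  have len: "length ?xs = card X" and set: "set ?xs = X" and dist: "distinct ?xs"
    using assms by auto
  have inj: "inj_on ((!) ?xs) {..<card X}"
    using dist len by (simp add: inj_on_nth)
  have enc: "embed_idx X j = set_encode ((!) ?xs ` {t. t < card X \<and> bit j t})" for j
  proof -
    have "embed_idx X j = (\<Sum>t\<in>{t. t < card X \<and> bit j t}. 2 ^ (?xs ! t))"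
      unfolding embed_idx_def by (intro sum.mono_neutral_cong_right) auto
    also have "\<dots> = set_encode ((!) ?xs ` {t. t < card X \<and> bit j t})"
      unfolding set_encode_def using inj
      by (subst sum.reindex) (auto intro: inj_on_subset)
    finally show ?thesis .
  qed
  have b: "bit (embed_idx X j) k \<longleftrightarrow> (\<exists>t<card X. k = ?xs ! t \<and> bit j t)" for j k
    unfolding enc by (subst bit_set_encode) auto
  have mem: "embed_idx X j \<in> idx_on X" for j
  proof -
    have "k \<in> X" if "bit (embed_idx X j) k" for k
      using that len set unfolding b by (metis nth_mem)
    then show ?thesis unfolding idx_on_def by blast
  qed
  have nth: "bit (embed_idx X j) (?xs ! t) \<longleftrightarrow> bit j t" if "t < card X" for j t
    using that len nth_eq_iff_index_eq[OF dist] unfolding b by metis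
  have "inj_on (embed_idx X) {..<2 ^ card X}"
  proof (rule inj_onI)
    fix i j assume ij: "i \<in> {..<2 ^ card X}" "j \<in> {..<2 ^ card X}" "embed_idx X i = embed_idx X j"
    then have "bit i t = bit j t" if "t < card X" for t
      using nth[OF that, of i] nth[OF that, of j] by simp
    then show "i = j" using ij by (intro less_exp_eqI[of i "card X" j]) auto
  qed
  moreover have "x \<in> embed_idx X ` {..<2 ^ card X}" if "x \<in> idx_on X" for x
  proof -
    define j where "j = set_encode {t. t < card X \<and> bit x (?xs ! t)}"
    have j: "bit j t \<longleftrightarrow> t < card X \<and> bit x (?xs ! t)" for t
      unfolding j_def by (subst bit_set_encode) auto
    have "bit (embed_idx X j) k = bit x k" for k
    proof -
      have "bit x k \<Longrightarrow> k \<in> X" using that unfolding idx_on_def by blast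
      then have "bit x k \<Longrightarrow> k \<in> set ?xs" by (simp only: set)
      then have "bit x k \<Longrightarrow> \<exists>t<card X. k = ?xs ! t" unfolding in_set_conv_nth len by metis
      then show ?thesis by (auto simp: b j)
    qed
    then have "embed_idx X j = x" by (auto intro: bit_eqI)
    moreover have "j < 2 ^ card X" by (rule less_exp_bitI) (simp add: j)
    ultimately show ?thesis by blast
  qed
  ultimately show ?thesis using mem by (auto simp: bij_betw_def)
qed

lemma reduced_outer:
  assumes X: "X \<subseteq> {..<N}"
  shows "reduced N X (mat (2^N) (2^N) (\<lambda>(x,y). \<psi> x * cnj (\<psi> y))) =
    mat (2 ^ card X) (2 ^ card X) (\<lambda>(i,j). partial_state N X \<psi> (embed_idx X i) (embed_idx X j))"
proof -
  have fin: "finite X" using X finite_subset by blast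
  have e: "embed_idx X i \<in> idx_on X" if "i < 2 ^ card X" for i
    using bij_betw_apply[OF embed_idx_bij[OF fin]] that by simp
  have C: "{c. c < 2^N \<and> (\<forall>k\<in>X. \<not> bit c k)} = idx_on ({..<N} - X)"
    using idx_on_lessThan[of N] by (auto simp: idx_on_def)
  have "a + c < 2^N" if "a \<in> idx_on X" "c \<in> idx_on ({..<N} - X)" for a c
    using bij_betw_apply[OF idx_on_split[OF X], of "(a,c)"] that by simp
  then show ?thesis
    by (intro eq_matI) (auto simp: reduced_def C partial_state_def e intro!: sum.cong)
qed

text \<open>Once the expectation values are known to be signs on G and 0 elsewhere, the reduced
  state is \<open>2^card X\<close> in the denominator under a signed sum of the strings in
  \<open>G \<inter> strings X\<close>. Each of these acts on the state as its own sign, so the state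
  is proportional to its square and \<open>vn_entropy_flat\<close> applies.\<close>

theorem stabilizer_entropy:
  assumes X: "X \<subseteq> {..<N}" and norm: "(\<Sum>a<2^N. \<psi> a * cnj (\<psi> a)) = 1"
    and G: "G \<subseteq> strings {..<N}" "2 ^ N \<le> card G"
    and stab: "\<And>u. u \<in> G \<Longrightarrow> \<exists>\<sigma>\<in>{1,-1}. \<forall>a<2^N. (\<Sum>b<2^N. pauli_entry N u a b * \<psi> b) = \<sigma> * \<psi> a"
  shows "card (G \<inter> strings X) > 0"
    and "vn_entropy (reduced N X (mat (2^N) (2^N) (\<lambda>(x,y). \<psi> x * cnj (\<psi> y))))
      = real (card X) - log 2 (card (G \<inter> strings X))"
proof -
  let ?f = "pauli_exp N \<psi>" and ?R = "partial_state N X \<psi>"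
  have finX: "finite X" using X finite_subset by blast
  have fin: "finite (strings {..<N})" by simp
  have finG: "finite G" using G(1) fin finite_subset by blast
  have onG: "?f u * ?f u = 1 \<and> (\<forall>a<2^N. (\<Sum>b<2^N. pauli_entry N u a b * \<psi> b) = ?f u * \<psi> a)" if u: "u \<in> G" for u
  proof -
    from stab[OF u] obtain \<sigma> where \<sigma>: "\<sigma> \<in> {1,-1}"
      and eq: "\<And>a. a < 2^N \<Longrightarrow> (\<Sum>b<2^N. pauli_entry N u a b * \<psi> b) = \<sigma> * \<psi> a" by blast
    have "?f u = (\<Sum>a<2^N. (\<Sum>b<2^N. pauli_entry N u a b * \<psi> b) * cnj (\<psi> a))"
      by (simp add: pauli_exp_def sum_distrib_right mult.assoc)
    also have "\<dots> = \<sigma> * (\<Sum>a<2^N. \<psi> a * cnj (\<psi> a))"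
      by (simp add: eq sum_distrib_left mult.assoc)
    finally have "?f u = \<sigma>" by (simp add: norm)
    then show ?thesis using \<sigma> eq by auto
  qed
  have sq: "?f u * ?f u = of_real ((cmod (?f u))\<^sup>2)" if "u \<in> strings {..<N}" for u
    using complex_norm_square[of "?f u"] pauli_exp_real[OF that, of N \<psi>] by simp
  \<comment> \<open>G alone contributes at least \<open>2^N\<close> to a sum of squares that equals
    \<open>2^N\<close>, so nothing is left for the other strings.\<close>
  have off: "?f u = 0" if u: "u \<in> strings {..<N}" "u \<notin> G" for u
  proof -
    have "complex_of_real (\<Sum>u\<in>strings {..<N}. (cmod (?f u))\<^sup>2) = of_real (2 ^ N)"
      using pauli_parseval[OF norm] by (simp add: sq)
    then have "(\<Sum>u\<in>strings {..<N}. (cmod (?f u))\<^sup>2) = 2 ^ N"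
      using of_real_eq_iff by blast
    moreover have "(\<Sum>u\<in>G. (cmod (?f u))\<^sup>2) = real (card G)"
    proof -
      have "(cmod (?f u))\<^sup>2 = 1" if "u \<in> G" for u
        using onG[OF that] sq[of u] that G(1) by (metis of_real_eq_1_iff subsetD)
      then show ?thesis by simp
    qed
    moreover have "(\<Sum>u\<in>strings {..<N}. (cmod (?f u))\<^sup>2) =
       (\<Sum>u\<in>strings {..<N} - G. (cmod (?f u))\<^sup>2) + (\<Sum>u\<in>G. (cmod (?f u))\<^sup>2)"
      using G(1) fin by (rule sum.subset_diff)
    moreover have "real (card G) \<ge> 2 ^ N" using G(2) by (metis of_nat_le_iff of_nat_numeral of_nat_power)
    ultimately have "(\<Sum>u\<in>strings {..<N} - G. (cmod (?f u))\<^sup>2) \<le> 0" by linarith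
    then have "(\<Sum>u\<in>strings {..<N} - G. (cmod (?f u))\<^sup>2) = 0"
      by (meson antisym sum_nonneg zero_le_power2)
    then show ?thesis using u fin by (subst (asm) sum_nonneg_eq_0_iff) auto
  qed
  \<comment> \<open>The identity string has a nonzero expectation value and therefore lies in G,
    which makes the count positive and its logarithm meaningful.\<close>
  have "?f (\<lambda>_. 0) = 1"
    using norm by (simp add: pauli_exp_def pauli_entry_zero if_distrib if_distribR sum.delta cong: if_cong)
  then have "(\<lambda>_. 0) \<in> G" using off[of "\<lambda>_. 0"] by auto
  then show card: "card (G \<inter> strings X) > 0" using finG by (auto simp: card_gt_0_iff)

  \<comment> \<open>This will be the only nonzero eigenvalue of the reduced state.\<close>
  define \<mu> where "\<mu> = real (card (G \<inter> strings X)) / 2 ^ card X"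
  have expand: "2 ^ card X * ?R a b = (\<Sum>u\<in>G \<inter> strings X. pauli_entry N u a b * ?f u)"
    if "a \<in> idx_on X" "b \<in> idx_on X" for a b
  proof -
    have "2 ^ card X * ?R a b = (\<Sum>u\<in>strings X. pauli_entry N u a b * ?f u)"
      unfolding pauli_expansion[OF X that] by (simp add: pauli_partial_state_trace[OF X])
    also have "\<dots> = (\<Sum>u\<in>G \<inter> strings X. pauli_entry N u a b * ?f u)"
      using off strings_mono[OF X] finX by (intro sum.mono_neutral_right) auto
    finally show ?thesis .
  qed
  have act: "(\<Sum>b\<in>idx_on X. pauli_entry N u a b * ?R b d) = ?f u * ?R a d"
    if "u \<in> G \<inter> strings X" "a \<in> idx_on X" "d \<in> idx_on X" for u a d
  proof -
    have "a + c < 2^N" if "c \<in> idx_on ({..<N} - X)" for c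
      using bij_betw_apply[OF idx_on_split[OF X], of "(a,c)"] that \<open>a \<in> idx_on X\<close> by simp
    then show ?thesis
      using that onG by (simp add: pauli_partial_state[OF X] partial_state_def[of N X \<psi> a] sum_distrib_left mult_ac)
  qed
  \<comment> \<open>Only the left factor is expanded. Each string then acts on the right factor by
    the sign that already multiplies it, and the two signs cancel.\<close>
  have square: "(\<Sum>b\<in>idx_on X. ?R a b * ?R b d) = \<mu> * ?R a d"
    if ad: "a \<in> idx_on X" "d \<in> idx_on X" for a d
  proof -
    have "2 ^ card X * (\<Sum>b\<in>idx_on X. ?R a b * ?R b d)
      = (\<Sum>b\<in>idx_on X. (\<Sum>u\<in>G \<inter> strings X. pauli_entry N u a b * ?f u) * ?R b d)"
      using ad by (simp add: sum_distrib_left expand flip: mult.assoc)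
    also have "\<dots> = (\<Sum>u\<in>G \<inter> strings X. ?f u * (\<Sum>b\<in>idx_on X. pauli_entry N u a b * ?R b d))"
      unfolding sum_distrib_right sum_distrib_left by (subst sum.swap) (simp add: mult_ac)
    also have "\<dots> = (\<Sum>u\<in>G \<inter> strings X. (?f u * ?f u) * ?R a d)"
      using ad by (simp add: act mult.assoc)
    also have "\<dots> = card (G \<inter> strings X) * ?R a d"
      using onG by simp
    finally show ?thesis by (simp add: \<mu>_def field_simps)
  qed
  define M where "M = mat (2 ^ card X) (2 ^ card X) (\<lambda>(i,j). ?R (embed_idx X i) (embed_idx X j))"
  note bij = embed_idx_bij[OF finX]
  have e: "embed_idx X i \<in> idx_on X" if "i < 2 ^ card X" for i
    using bij_betw_apply[OF bij] that by simp
  have M: "M \<in> carrier_mat (2 ^ card X) (2 ^ card X)" by (simp add: M_def)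
  have "M * M = complex_of_real \<mu> \<cdot>\<^sub>m M"
  proof (rule eq_matI)
    fix i j assume "i < dim_row (complex_of_real \<mu> \<cdot>\<^sub>m M)" "j < dim_col (complex_of_real \<mu> \<cdot>\<^sub>m M)"
    then have ij: "i < 2 ^ card X" "j < 2 ^ card X" by (auto simp: M_def)
    have "(M * M) $$ (i,j) = (\<Sum>k<2 ^ card X. ?R (embed_idx X i) (embed_idx X k) * ?R (embed_idx X k) (embed_idx X j))"
      using ij by (simp add: M_def scalar_prod_def lessThan_atLeast0)
    also have "\<dots> = (\<Sum>b\<in>idx_on X. ?R (embed_idx X i) b * ?R b (embed_idx X j))"
      by (rule sum.reindex_bij_betw[OF bij])
    finally show "(M * M) $$ (i,j) = (complex_of_real \<mu> \<cdot>\<^sub>m M) $$ (i,j)"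
      using ij by (simp add: square e) (simp add: M_def)
  qed (auto simp: M_def)
  moreover have "mtrace M = 1"
  proof -
    have "mtrace M = (\<Sum>k<2 ^ card X. ?R (embed_idx X k) (embed_idx X k))"
      by (simp add: M_def mtrace_def)
    also have "\<dots> = (\<Sum>a\<in>idx_on X. ?R a a)"
      by (rule sum.reindex_bij_betw[OF bij])
    also have "\<dots> = (\<Sum>a<2^N. \<psi> a * cnj (\<psi> a))"
      unfolding partial_state_def by (rule sum_idx_split[OF X, symmetric])
    finally show ?thesis by (simp add: norm)
  qed
  ultimately have "vn_entropy M = - log 2 \<mu>"
    using card by (intro vn_entropy_flat[OF M]) (auto simp: \<mu>_def)
  then show "vn_entropy (reduced N X (mat (2^N) (2^N) (\<lambda>(x,y). \<psi> x * cnj (\<psi> y))))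
      = real (card X) - log 2 (card (G \<inter> strings X))"
    using card by (simp add: reduced_outer[OF X] M_def \<mu>_def log_divide log_nat_power)
qed

section \<open>Circuits\<close>

lemma mult_mat_index:
  assumes "A \<in> carrier_mat n k" "B \<in> carrier_mat k m" "i < n" "j < m"
  shows "(A * B) $$ (i,j) = (\<Sum>x<k. A $$ (i,x) * B $$ (x,j))"
  using assms by (simp add: scalar_prod_def lessThan_atLeast0)

lemma dagger_carrier: "A \<in> carrier_mat n m \<Longrightarrow> dagger A \<in> carrier_mat m n"
  by (simp add: dagger_def)

lemma dagger_index: "A \<in> carrier_mat n m \<Longrightarrow> i < m \<Longrightarrow> j < n \<Longrightarrow> dagger A $$ (i,j) = cnj (A $$ (j,i))"
  by (auto simp: dagger_def)

lemma dagger_mult: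
  assumes "A \<in> carrier_mat n k" "B \<in> carrier_mat k m"
  shows "dagger (A * B) = dagger B * dagger A"
  using assms
  by (intro eq_matI) (auto simp: dagger_def scalar_prod_def mult.commute intro!: sum.cong)

lemma mult3_index:
  fixes A :: "'a::comm_semiring_0 mat"
  assumes "A \<in> carrier_mat n k" "M \<in> carrier_mat k l" "B \<in> carrier_mat l m" "i < n" "j < m"
  shows "(A * M * B) $$ (i,j) = (\<Sum>x<k. \<Sum>y<l. A $$ (i,x) * M $$ (x,y) * B $$ (y,j))"
proof -
  have "(A * M * B) $$ (i,j) = (\<Sum>y<l. (\<Sum>x<k. A $$ (i,x) * M $$ (x,y)) * B $$ (y,j))"
    unfolding mult_mat_index[OF mult_carrier_mat[OF assms(1,2)] assms(3,4,5)]
    using assms by (intro sum.cong refl) (subst mult_mat_index[of _ n k _ l], auto)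
  also have "\<dots> = (\<Sum>x<k. \<Sum>y<l. A $$ (i,x) * M $$ (x,y) * B $$ (y,j))"
    unfolding sum_distrib_right by (rule sum.swap)
  finally show ?thesis .
qed

lemma smult_smult_mat: "a \<cdot>\<^sub>m (b \<cdot>\<^sub>m M) = (a * b) \<cdot>\<^sub>m (M :: 'a::semigroup_mult mat)"
  by (intro eq_matI) (auto simp: mult.assoc)

text \<open>\<open>C\<close> is carried past \<open>T\<close> first and past \<open>T'\<close>
  second, which preserves the order of the factors. Closure of \<open>stab\<close> under products
  rests on this.\<close>

lemma intertwine_mult:
  fixes C :: "'a::comm_ring_1 mat"
  assumes cs: "C \<in> carrier_mat d d" "S \<in> carrier_mat d d" "S' \<in> carrier_mat d d"
      "T \<in> carrier_mat d d" "T' \<in> carrier_mat d d"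
    and eq: "C * T = a \<cdot>\<^sub>m (S * C)" "C * T' = a' \<cdot>\<^sub>m (S' * C)"
  shows "C * (T * T') = (a * a') \<cdot>\<^sub>m (S * S' * C)"
proof -
  have "C * (T * T') = C * T * T'" using cs by (simp add: assoc_mult_mat[of C d d T d T' d])
  also have "\<dots> = a \<cdot>\<^sub>m (S * C * T')"
    unfolding eq using cs by (intro mult_smult_assoc_mat[of _ d d]) auto
  also have "S * C * T' = S * (C * T')" using cs by (simp add: assoc_mult_mat[of S d d C d T' d])
  also have "\<dots> = a' \<cdot>\<^sub>m (S * (S' * C))"
    unfolding eq using cs by (intro mult_smult_distrib[of _ d d]) auto
  also have "S * (S' * C) = S * S' * C" using cs by (simp add: assoc_mult_mat[of S d d S' d C d])
  finally show ?thesis by (simp add: smult_smult_mat)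
qed

section \<open>Circuit operators and signs depending on the outcome record\<close>

lemma embed_gate_carrier [simp]: "embed_gate n i j U \<in> carrier_mat (2^n) (2^n)"
  by (simp add: embed_gate_def)

lemma proj_Z_carrier [simp]: "proj_Z n i b \<in> carrier_mat (2^n) (2^n)"
  by (simp add: proj_Z_def)

lemma circ_op_mat_carrier [simp]: "circ_op_mat n c ms \<in> carrier_mat (2^n) (2^n)"
proof (induction c arbitrary: ms)
  case (Cons g c)
  then show ?case by (cases g) (auto intro: mult_carrier_mat[OF _ embed_gate_carrier] mult_carrier_mat[OF _ proj_Z_carrier])
qed simp

lemma C_m_carrier [simp]: "C_m n c m \<in> carrier_mat (2^n) (2^n)"
  by (simp add: C_m_def)

lemma C_m_Nil: "C_m n [] m = 1\<^sub>m (2^n)"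
  by (simp add: C_m_def)

lemma num_meas_simps [simp]:
  "num_meas [] = 0" "num_meas (Gate i j U # c) = num_meas c" "num_meas (Meas i # c) = Suc (num_meas c)"
  by (simp_all add: num_meas_def is_meas_def)

lemma C_m_Gate: "C_m n (Gate i j U # c) m = C_m n c m * embed_gate n i j U"
  by (simp add: C_m_def)

text \<open>The earliest measurement owns bit 0 of the record, so the rest of the circuit sees
  \<open>m div 2\<close>.\<close>

lemma C_m_Meas: "C_m n (Meas i # c) m = C_m n c (m div 2) * proj_Z n i (odd m)"
proof -
  have "outcomes (Suc K) m = odd m # outcomes K (m div 2)" for K
    unfolding outcomes_def by (simp add: upt_conv_Cons bit_0 bit_Suc flip: map_Suc_upt del: upt_Suc)
  then show ?thesis by (simp add: C_m_def)
qed

text \<open>Only the low bits of m are ever read. This periodicity lets relations be stated for all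
  m without a bound.\<close>

lemma C_m_mod: "C_m n c (m mod 2 ^ num_meas c) = C_m n c m"
proof -
  have "outcomes K (m mod 2 ^ K) = outcomes K m" for K
    by (auto simp: outcomes_def bit_take_bit_iff simp flip: take_bit_eq_mod)
  then show ?thesis by (simp add: C_m_def)
qed

text \<open>The character (-1)^(z.m): the eigenvalue on |m> of the Z string with support z on the
  record register.\<close>

definition outcome_sign :: "nat \<Rightarrow> (nat \<Rightarrow> bool) \<Rightarrow> nat \<Rightarrow> complex" where
  "outcome_sign K z m = (\<Prod>k<K. if z k \<and> bit m k then -1 else 1)"

lemma outcome_sign_square [simp]: "outcome_sign K z m * outcome_sign K z m = 1"
  unfolding outcome_sign_def prod.distrib[symmetric] by (intro prod.neutral) auto

lemma outcome_sign_cases: "outcome_sign K z m = 1 \<or> outcome_sign K z m = -1"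
  using outcome_sign_square[of K z m] square_eq_1_iff by blast

lemma outcome_sign_mult:
  "outcome_sign K z m * outcome_sign K z' m = outcome_sign K (\<lambda>k. z k \<noteq> z' k) m"
  unfolding outcome_sign_def prod.distrib[symmetric] by (intro prod.cong refl) auto

lemma outcome_sign_Suc:
  "outcome_sign (Suc K) z m = (if z 0 \<and> odd m then -1 else 1) * outcome_sign K (\<lambda>k. z (Suc k)) (m div 2)"
  unfolding outcome_sign_def prod.lessThan_Suc_shift by (simp add: bit_0 bit_Suc)

lemma outcome_sign_mod: "outcome_sign K z (m mod 2 ^ K) = outcome_sign K z m"
  unfolding outcome_sign_def by (auto simp: bit_take_bit_iff simp flip: take_bit_eq_mod intro!: prod.cong)

lemma outcome_sign_const_False: "outcome_sign K (\<lambda>_. False) m = 1"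
  by (simp add: outcome_sign_def)

text \<open>Sign and z are chosen before m, because a single signed Z string on M has to produce the
  signs of all records. They are hidden by quantifiers so that the set consists of pairs of strings
  and can be counted. The range of m is unbounded, which by \<open>C_m_mod\<close> and
  \<open>outcome_sign_mod\<close> adds no condition.\<close>

definition stab :: "nat \<Rightarrow> circ_op list \<Rightarrow> ((nat \<Rightarrow> nat) \<times> (nat \<Rightarrow> nat)) set" where
  "stab n c = {(s,t). s \<in> strings {..<n} \<and> t \<in> strings {..<n} \<and>
     (\<exists>\<sigma>\<in>{1,-1}. \<exists>z. \<forall>m. C_m n c m * pauli_string n t =
        (\<sigma> * outcome_sign (num_meas c) z m) \<cdot>\<^sub>m (pauli_string n s * C_m n c m))}"

section \<open>Two-qubit gates: unitarity and action on Pauli strings\<close>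

definition gate_idx :: "nat \<Rightarrow> nat \<Rightarrow> nat \<Rightarrow> nat" where
  "gate_idx i j a = 2 * bitv a i + bitv a j"

definition agree_off :: "nat \<Rightarrow> nat \<Rightarrow> nat \<Rightarrow> nat \<Rightarrow> bool" where
  "agree_off i j a b \<longleftrightarrow> (\<forall>k. k \<noteq> i \<and> k \<noteq> j \<longrightarrow> bit a k = bit b k)"

lemma agree_off_refl [simp]: "agree_off i j a a"
  by (simp add: agree_off_def)

lemma agree_off_sym: "agree_off i j a b \<longleftrightarrow> agree_off i j b a"
  by (auto simp: agree_off_def)

lemma gate_idx_less: "gate_idx i j a < 4"
  by (simp add: gate_idx_def bitv_def)

lemma gate_idx_eq_iff: "gate_idx i j a = gate_idx i j b \<longleftrightarrow> bit a i = bit b i \<and> bit a j = bit b j"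
  by (auto simp: gate_idx_def bitv_def)

lemma agree_gate_idx_eq: "agree_off i j a b \<Longrightarrow> gate_idx i j a = gate_idx i j b \<Longrightarrow> a = b"
  by (rule bit_eqI) (auto simp: agree_off_def gate_idx_eq_iff)

lemma gate_idx_bij:
  assumes ij: "i < n" "j < n" "i \<noteq> j" and a: "a < 2^n"
  shows "bij_betw (gate_idx i j) {x. x < 2^n \<and> agree_off i j a x} {..<4}"
proof -
  have "inj_on (gate_idx i j) {x. x < 2^n \<and> agree_off i j a x}"
  proof (rule inj_onI)
    fix x y assume "x \<in> {x. x < 2^n \<and> agree_off i j a x}" "y \<in> {x. x < 2^n \<and> agree_off i j a x}"
      and eq: "gate_idx i j x = gate_idx i j y"
    then have "agree_off i j x y" by (simp add: agree_off_def)
    then show "x = y" using eq by (rule agree_gate_idx_eq)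
  qed
  moreover have "y \<in> gate_idx i j ` {x. x < 2^n \<and> agree_off i j a x}" if "y < 4" for y
  proof -
    define S where "S = {k. k < n \<and> (if k = i then y \<ge> 2 else if k = j then odd y else bit a k)}"
    have b: "bit (set_encode S) k \<longleftrightarrow>
        k < n \<and> (if k = i then y \<ge> 2 else if k = j then odd y else bit a k)" for k
      by (subst bit_set_encode) (simp_all add: S_def)
    have "set_encode S < 2^n" by (rule less_exp_bitI) (simp add: b)
    moreover have "agree_off i j a (set_encode S)"
    proof -
      have "bit a k \<Longrightarrow> k < n" for k using bit_ge_exp[OF a, of k] by (meson not_le)
      then show ?thesis by (auto simp: agree_off_def b)
    qed
    moreover have "gate_idx i j (set_encode S) = y"
      using less_4_cases[OF that] ij by (elim disjE) (simp_all add: gate_idx_def bitv_def b)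
    ultimately show ?thesis by blast
  qed
  ultimately show ?thesis using gate_idx_less by (auto simp: bij_betw_def)
qed

text \<open>In a row of an embedded gate the nonzero columns agree with a off i and j, and
  \<open>gate_idx\<close> matches them with the four basis states of the gate.\<close>

lemma sum_agree_off:
  fixes F :: "nat \<Rightarrow> 'a::comm_monoid_add"
  assumes "i < n" "j < n" "i \<noteq> j" "a < 2^n"
  shows "(\<Sum>x<2^n. if agree_off i j a x then F (gate_idx i j x) else 0) = (\<Sum>y<4. F y)"
proof -
  have "(\<Sum>x<2^n. if agree_off i j a x then F (gate_idx i j x) else 0)
      = (\<Sum>x\<in>{x. x < 2^n \<and> agree_off i j a x}. F (gate_idx i j x))"
    by (intro sum.mono_neutral_cong_right) auto
  also have "\<dots> = (\<Sum>y<4. F y)"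
    by (rule sum.reindex_bij_betw[OF gate_idx_bij[OF assms]])
  finally show ?thesis .
qed

lemma embed_gate_index:
  "a < 2^n \<Longrightarrow> b < 2^n \<Longrightarrow> embed_gate n i j U $$ (a,b) =
     (if agree_off i j a b then U $$ (gate_idx i j a, gate_idx i j b) else 0)"
  by (auto simp: embed_gate_def agree_off_def gate_idx_def)

lemma embed_gate_unitary:
  assumes ij: "i < n" "j < n" "i \<noteq> j" and U: "U \<in> carrier_mat 4 4" "dagger U * U = 1\<^sub>m 4"
  shows "dagger (embed_gate n i j U) * embed_gate n i j U = 1\<^sub>m (2^n)" (is "dagger ?E * ?E = _")
proof (rule eq_matI)
  fix a b assume "a < dim_row (1\<^sub>m (2^n) :: complex mat)" "b < dim_col (1\<^sub>m (2^n) :: complex mat)"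
  then have ab: "a < 2^n" "b < 2^n" by auto
  have "(dagger ?E * ?E) $$ (a,b) = (\<Sum>x<2^n. cnj (?E $$ (x,a)) * ?E $$ (x,b))"
    using ab by (simp add: mult_mat_index[of _ "2^n" "2^n" _ "2^n"] dagger_carrier dagger_index[of _ "2^n" "2^n"])
  also have "\<dots> = (\<Sum>x<2^n. if agree_off i j a x then
      (if agree_off i j a b then cnj (U $$ (gate_idx i j x, gate_idx i j a)) * U $$ (gate_idx i j x, gate_idx i j b) else 0) else 0)"
  proof (rule sum.cong[OF refl])
    fix x :: nat assume "x \<in> {..<2^n}"
    moreover have "agree_off i j x a \<longleftrightarrow> agree_off i j a x" by (rule agree_off_sym)
    moreover have "agree_off i j a x \<Longrightarrow> agree_off i j x b \<longleftrightarrow> agree_off i j a b"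
      by (auto simp: agree_off_def)
    ultimately show "cnj (?E $$ (x,a)) * ?E $$ (x,b) = (if agree_off i j a x then
      (if agree_off i j a b then cnj (U $$ (gate_idx i j x, gate_idx i j a)) * U $$ (gate_idx i j x, gate_idx i j b) else 0) else 0)"
      using ab by (simp add: embed_gate_index)
  qed
  also have "\<dots> = (\<Sum>y<4. if agree_off i j a b then cnj (U $$ (y, gate_idx i j a)) * U $$ (y, gate_idx i j b) else 0)"
    by (rule sum_agree_off[OF ij ab(1)])
  also have "\<dots> = (if agree_off i j a b then (dagger U * U) $$ (gate_idx i j a, gate_idx i j b) else 0)"
    using U(1) by (simp add: gate_idx_less mult_mat_index[of _ 4 4 _ 4] dagger_carrier dagger_index[of _ 4 4])
  also have "\<dots> = 1\<^sub>m (2^n) $$ (a,b)"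
  proof (cases "a = b \<or> \<not> agree_off i j a b")
    case False
    then have "gate_idx i j a \<noteq> gate_idx i j b" using agree_gate_idx_eq by blast
    with False ab show ?thesis by (simp add: U(2) gate_idx_less)
  qed (use ab in \<open>auto simp: U(2) gate_idx_less\<close>)
  finally show "(dagger ?E * ?E) $$ (a,b) = 1\<^sub>m (2^n) $$ (a,b)" .
qed (auto simp: dagger_def embed_gate_def)

definition pauli_rest :: "nat \<Rightarrow> nat \<Rightarrow> nat \<Rightarrow> (nat \<Rightarrow> nat) \<Rightarrow> nat \<Rightarrow> nat \<Rightarrow> complex" where
  "pauli_rest n i j s a b = (\<Prod>k\<in>{..<n} - {i,j}. pauli1 (s k) $$ (bitv a k, bitv b k))"

text \<open>The order is reversed: i is the first tensor factor and thus the high bit of the gate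
  index, which is qubit 1 in the bit convention of \<open>pauli_string\<close>.\<close>

definition gate_string :: "nat \<Rightarrow> nat \<Rightarrow> (nat \<Rightarrow> nat) \<Rightarrow> nat \<Rightarrow> nat" where
  "gate_string i j s k = (if k = 0 then s j else if k = 1 then s i else 0)"

lemma pauli_rest_agree:
  "agree_off i j a a' \<Longrightarrow> agree_off i j b b' \<Longrightarrow> pauli_rest n i j s a b = pauli_rest n i j s a' b'"
  by (auto simp: pauli_rest_def agree_off_def bitv_def intro!: prod.cong)

lemma pauli_entry_gate_split:
  assumes "i < n" "j < n" "i \<noteq> j"
  shows "pauli_entry n s a b =
    pauli_rest n i j s a b * pauli_entry 2 (gate_string i j s) (gate_idx i j a) (gate_idx i j b)"
proof -
  have bits: "bitv (gate_idx i j x) 0 = bitv x j" "bitv (gate_idx i j x) (Suc 0) = bitv x i" for x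
    by (auto simp: gate_idx_def bitv_def bit_0 bit_Suc)
  have "{..<n} = insert i (insert j ({..<n} - {i,j}))" using assms by auto
  then have "pauli_entry n s a b = (\<Prod>k\<in>insert i (insert j ({..<n} - {i,j})). pauli1 (s k) $$ (bitv a k, bitv b k))"
    unfolding pauli_entry_def by (rule arg_cong)
  also have "\<dots> = pauli1 (s i) $$ (bitv a i, bitv b i) * (pauli1 (s j) $$ (bitv a j, bitv b j) * pauli_rest n i j s a b)"
    using assms by (simp add: pauli_rest_def)
  finally show ?thesis
    by (simp add: pauli_entry_def numeral_2_eq_2 bits gate_string_def)
qed

text \<open>The gate leaves the other qubits alone, so their factor is constant along the sum and
  comes out, and a 4 by 4 matrix product remains.\<close>

lemma embed_gate_mult_pauli:
  assumes ij: "i < n" "j < n" "i \<noteq> j" and U: "U \<in> carrier_mat 4 4" and ab: "a < 2^n" "b < 2^n"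
  shows "(embed_gate n i j U * pauli_string n s) $$ (a,b) =
      pauli_rest n i j s a b * (U * pauli_string 2 (gate_string i j s)) $$ (gate_idx i j a, gate_idx i j b)"
    and "(pauli_string n s * embed_gate n i j U) $$ (a,b) =
      pauli_rest n i j s a b * (pauli_string 2 (gate_string i j s) * U) $$ (gate_idx i j a, gate_idx i j b)"
proof -
  let ?q = "gate_idx i j" and ?P = "pauli_entry 2 (gate_string i j s)" and ?r = "pauli_rest n i j s a b"
  note P4 = pauli_string_carrier[of 2 "gate_string i j s", simplified]
  have P: "pauli_string 2 (gate_string i j s) $$ (?q x, ?q y) = ?P (?q x) (?q y)" for x y
    using gate_idx_less by simp
  have ent: "pauli_string 2 (gate_string i j s) $$ (x, y) = ?P x y" if "x < 4" "y < 4" for x y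
    using that by simp
  have "(embed_gate n i j U * pauli_string n s) $$ (a,b) =
    (\<Sum>x<2^n. if agree_off i j a x then ?r * (U $$ (?q a, ?q x) * ?P (?q x) (?q b)) else 0)"
    unfolding mult_mat_index[OF embed_gate_carrier pauli_string_carrier ab] using ab
    by (intro sum.cong refl)
      (simp add: embed_gate_index pauli_entry_gate_split[OF ij] pauli_rest_agree[of i j a _ b b])
  also have "\<dots> = (\<Sum>y<4. ?r * (U $$ (?q a, y) * ?P y (?q b)))"
    by (rule sum_agree_off[OF ij ab(1)])
  also have "\<dots> = ?r * (U * pauli_string 2 (gate_string i j s)) $$ (?q a, ?q b)"
    using gate_idx_less ent by (simp add: mult_mat_index[OF U P4] sum_distrib_left)
  finally show "(embed_gate n i j U * pauli_string n s) $$ (a,b) =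
      ?r * (U * pauli_string 2 (gate_string i j s)) $$ (?q a, ?q b)" .
  have "(pauli_string n s * embed_gate n i j U) $$ (a,b) =
    (\<Sum>x<2^n. if agree_off i j b x then ?r * (?P (?q a) (?q x) * U $$ (?q x, ?q b)) else 0)"
    unfolding mult_mat_index[OF pauli_string_carrier embed_gate_carrier ab] using ab
    by (intro sum.cong refl)
      (simp add: embed_gate_index agree_off_sym[of i j _ b] pauli_entry_gate_split[OF ij] pauli_rest_agree[of i j a a b])
  also have "\<dots> = (\<Sum>y<4. ?r * (?P (?q a) y * U $$ (y, ?q b)))"
    by (rule sum_agree_off[OF ij ab(2)])
  also have "\<dots> = ?r * (pauli_string 2 (gate_string i j s) * U) $$ (?q a, ?q b)"
    using gate_idx_less ent by (simp add: mult_mat_index[OF P4 U] sum_distrib_left)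
  finally show "(pauli_string n s * embed_gate n i j U) $$ (a,b) =
      ?r * (pauli_string 2 (gate_string i j s) * U) $$ (?q a, ?q b)" .
qed

lemma clifford2_unitary: "clifford2 U \<Longrightarrow> U \<in> carrier_mat 4 4 \<and> dagger U * U = 1\<^sub>m 4"
  by (auto simp: clifford2_def is_unitary_def)

text \<open>The Clifford property of the 4 by 4 matrix is first rewritten without the adjoint, as an
  exchange of U and the string; in this form it lifts entry by entry through
  \<open>embed_gate_mult_pauli\<close>.\<close>

lemma embed_gate_clifford:
  assumes ij: "i < n" "j < n" "i \<noteq> j" and U: "clifford2 U" and s: "s \<in> strings {..<n}"
  shows "\<exists>t\<in>strings {..<n}. \<exists>\<sigma>\<in>{1,-1}.
    embed_gate n i j U * pauli_string n s = \<sigma> \<cdot>\<^sub>m (pauli_string n t * embed_gate n i j U)"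
proof -
  note Uc = clifford2_unitary[OF U, THEN conjunct1] and UU = clifford2_unitary[OF U, THEN conjunct2]
  note P4 = pauli_string_carrier[of 2, simplified]
  let ?g = "gate_string i j s"
  have g4: "\<forall>k. ?g k < 4" using s by (auto simp: gate_string_def stringsD)
  have "\<exists>T\<in>signed_paulis_on 2 {0,1}. U * pauli_string 2 ?g * dagger U = T"
    by (rule U[unfolded clifford2_def, THEN conjunct2, THEN conjunct2, THEN spec, THEN mp, OF g4])
  then have "U * pauli_string 2 ?g * dagger U \<in> signed_paulis_on 2 {0,1}" by simp
  then obtain \<sigma> w where \<sigma>: "\<sigma> = 1 \<or> \<sigma> = -1" and w: "\<forall>k. w k < 4" "\<forall>k. k \<notin> {0,1} \<longrightarrow> w k = 0"
    and eq: "U * pauli_string 2 ?g * dagger U = \<sigma> \<cdot>\<^sub>m pauli_string 2 w"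
    unfolding signed_paulis_on_def mem_Collect_eq by metis
  have "U * pauli_string 2 ?g = U * pauli_string 2 ?g * (dagger U * U)"
    using Uc P4 by (simp add: UU)
  also have "\<dots> = U * pauli_string 2 ?g * dagger U * U"
    using Uc P4 dagger_carrier[OF Uc] by (intro assoc_mult_mat[symmetric, of _ 4 4 _ 4 _ 4]) auto
  also have "\<dots> = \<sigma> \<cdot>\<^sub>m (pauli_string 2 w * U)"
    unfolding eq using Uc P4 by (intro mult_smult_assoc_mat[of _ 4 4]) auto
  finally have comm: "U * pauli_string 2 ?g = \<sigma> \<cdot>\<^sub>m (pauli_string 2 w * U)" .
  \<comment> \<open>The two new letters are put back in the order that \<open>gate_string\<close>
    reads.\<close>
  define t where "t = s(i := w 1, j := w 0)"
  have t: "t \<in> strings {..<n}"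
    using s w ij by (auto simp: strings_def t_def)
  have "gate_string i j t = w"
    using w ij by (auto simp: gate_string_def t_def fun_eq_iff)
  moreover have "pauli_rest n i j t = pauli_rest n i j s"
    by (auto simp: pauli_rest_def t_def fun_eq_iff intro!: prod.cong)
  ultimately have "embed_gate n i j U * pauli_string n s = \<sigma> \<cdot>\<^sub>m (pauli_string n t * embed_gate n i j U)"
    using gate_idx_less Uc P4
    by (intro eq_matI) (simp_all add: embed_gate_mult_pauli[OF ij Uc] comm carrier_matD[OF embed_gate_carrier]
        carrier_matD[OF P4] carrier_matD[OF Uc] del: index_mult_mat(1))
  then show ?thesis using t \<sigma> by blast
qed

section \<open>Measurement projectors and completeness of the operators \<open>C_m\<close>\<close>

lemma proj_Z_index:
  "a < 2^n \<Longrightarrow> b < 2^n \<Longrightarrow> proj_Z n i v $$ (a,b) = (if a = b \<and> bit a i = v then 1 else 0)"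
  by (simp add: proj_Z_def)

lemma mult_proj_Z_index:
  assumes "A \<in> carrier_mat d (2^n)" "a < d" "b < 2^n"
  shows "(A * proj_Z n i v) $$ (a,b) = (if bit b i = v then A $$ (a,b) else 0)"
proof -
  have "(A * proj_Z n i v) $$ (a,b) = (\<Sum>x<2^n. if x = b then if bit b i = v then A $$ (a,b) else 0 else 0)"
    unfolding mult_mat_index[OF assms(1) proj_Z_carrier assms(2,3)]
    using assms by (intro sum.cong) (auto simp: proj_Z_index)
  then show ?thesis using assms by (simp add: sum.delta)
qed

lemma proj_Z_mult_index:
  assumes "A \<in> carrier_mat (2^n) d" "a < 2^n" "b < d"
  shows "(proj_Z n i v * A) $$ (a,b) = (if bit a i = v then A $$ (a,b) else 0)"
proof -
  have "(proj_Z n i v * A) $$ (a,b) = (\<Sum>x<2^n. if x = a then if bit a i = v then A $$ (a,b) else 0 else 0)"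
    unfolding mult_mat_index[OF proj_Z_carrier assms]
    using assms by (intro sum.cong) (auto simp: proj_Z_index)
  then show ?thesis using assms by (simp add: sum.delta)
qed

lemma dagger_proj_Z: "dagger (proj_Z n i v) = proj_Z n i v"
  by (rule eq_matI) (auto simp: dagger_def proj_Z_def)

lemma pauli_entry_diagonal:
  assumes "k < n" "s k = 0 \<or> s k = 3" "bit a k \<noteq> bit b k"
  shows "pauli_entry n s a b = 0"
proof -
  have "\<exists>k\<in>{..<n}. pauli1 (s k) $$ (bitv a k, bitv b k) = 0"
    using assms by (intro bexI[of _ k]) (auto simp: pauli1_def bitv_def)
  then show ?thesis by (simp add: pauli_entry_def)
qed

text \<open>A string with letter I or Z at i has no entry between basis states with different bits
  at i, so it preserves both outcome subspaces.\<close>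

lemma proj_Z_commute:
  assumes "i < n" "s i = 0 \<or> s i = 3"
  shows "proj_Z n i v * pauli_string n s = pauli_string n s * proj_Z n i v"
  using pauli_entry_diagonal[of i n s] assms
  by (intro eq_matI) (auto simp: mult_proj_Z_index[of _ "2^n"] proj_Z_mult_index[of _ _ "2^n"]
      carrier_matD[OF proj_Z_carrier] simp del: index_mult_mat(1))

definition z_string :: "nat \<Rightarrow> nat \<Rightarrow> nat" where
  "z_string i k = (if k = i then 3 else 0)"

lemma z_string_strings: "i < n \<Longrightarrow> z_string i \<in> strings {..<n}"
  by (auto simp: strings_def z_string_def)

lemma pauli_entry_z_string:
  assumes "i < n" "a < 2^n" "b < 2^n"
  shows "pauli_entry n (z_string i) a b = (if a = b then if bit a i then -1 else 1 else 0)"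
proof (cases "a = b")
  case True
  have "pauli_entry n (z_string i) a b = (\<Prod>k<n. if k = i then if bit a i then -1 else 1 else 1)"
    unfolding pauli_entry_def by (intro prod.cong) (auto simp: True z_string_def pauli1_def bitv_def)
  then show ?thesis using assms True by (simp add: prod.delta)
next
  case False
  then obtain k where "k < n" "bit a k \<noteq> bit b k" using less_exp_eqI assms by blast
  then show ?thesis using False pauli_entry_diagonal[of k n "z_string i" a b] by (auto simp: z_string_def)
qed

lemma proj_Z_z_string:
  assumes "i < n"
  shows "proj_Z n i v * pauli_string n (z_string i) = (if v then -1 else 1) \<cdot>\<^sub>m proj_Z n i v"
  using assms
  by (intro eq_matI) (auto simp: proj_Z_mult_index[of _ _ "2^n"] pauli_entry_z_string proj_Z_index
      carrier_matD[OF proj_Z_carrier] simp del: index_mult_mat(1))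

lemma sum_lessThan_mult:
  fixes f :: "nat \<Rightarrow> 'a::comm_monoid_add"
  shows "(\<Sum>x<M*d. f x) = (\<Sum>m<M. \<Sum>p<d. f (m * d + p))"
  by (induction M) (auto simp: sum_lessThan_add add.commute[of d])

text \<open>The earliest operation E is the outermost layer of the product
  \<open>dagger C_m * C_m\<close>, so the induction hypothesis collapses the inner layer. What
  remains is \<open>dagger E * E\<close> for a gate, and the sum of two complementary projectors for
  a measurement.\<close>

lemma sum_C_m_complete:
  assumes "\<forall>g\<in>set c. wf_op n g" "a < 2^n" "b < 2^n"
  shows "(\<Sum>m<2^num_meas c. (dagger (C_m n c m) * C_m n c m) $$ (a,b)) = (if a = b then 1 else 0)"
  using assms
proof (induction c arbitrary: a b)
  case Nil
  have "dagger (1\<^sub>m (2^n)) = (1\<^sub>m (2^n) :: complex mat)" by (rule eq_matI) (auto simp: dagger_def)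
  with Nil show ?case by (simp add: C_m_Nil)
next
  case (Cons g c)
  let ?M = "\<lambda>m. dagger (C_m n c m) * C_m n c m"
  have M: "?M m \<in> carrier_mat (2^n) (2^n)" for m
    by (intro mult_carrier_mat[of _ "2^n" "2^n"] dagger_carrier C_m_carrier)
  have IH: "(\<Sum>m<2^num_meas c. ?M m $$ (x,y)) = (if x = y then 1 else 0)" if "x < 2^n" "y < 2^n" for x y
    using Cons that by auto
  have gram: "dagger (C * E) * (C * E) = dagger E * (dagger C * C) * E"
    if "C \<in> carrier_mat (2^n) (2^n)" "E \<in> carrier_mat (2^n) (2^n)" for C E :: "complex mat"
    using that dagger_carrier[OF that(1)] dagger_carrier[OF that(2)]
    by (simp add: dagger_mult[OF that] assoc_mult_mat[of _ "2^n" "2^n" _ "2^n" _ "2^n"]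
        mult_carrier_mat[of _ "2^n" "2^n" _ "2^n"])
  show ?case
  proof (cases g)
    case (Gate i j U)
    let ?E = "embed_gate n i j U"
    have wf: "i < n" "j < n" "i \<noteq> j" "clifford2 U" using Cons.prems Gate by (auto simp: wf_op_def)
    have E: "dagger ?E \<in> carrier_mat (2^n) (2^n)" by (rule dagger_carrier) simp
    have "(\<Sum>m<2^num_meas c. (dagger (C_m n c m * ?E) * (C_m n c m * ?E)) $$ (a,b)) =
      (\<Sum>m<2^num_meas c. \<Sum>x<2^n. \<Sum>y<2^n. dagger ?E $$ (a,x) * ?M m $$ (x,y) * ?E $$ (y,b))"
      using Cons.prems by (simp only: gram[OF C_m_carrier embed_gate_carrier]) (simp only: mult3_index[OF E M embed_gate_carrier])
    also have "\<dots> = (\<Sum>x<2^n. \<Sum>y<2^n. dagger ?E $$ (a,x) * (\<Sum>m<2^num_meas c. ?M m $$ (x,y)) * ?E $$ (y,b))"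
      by (subst sum.swap, rule sum.cong[OF refl], subst sum.swap)
        (simp only: sum_distrib_left sum_distrib_right)
    also have "\<dots> = (\<Sum>x<2^n. \<Sum>y<2^n. if x = y then dagger ?E $$ (a,x) * ?E $$ (y,b) else 0)"
      by (intro sum.cong refl) (auto simp: IH simp del: index_mult_mat(1))
    also have "\<dots> = (dagger ?E * ?E) $$ (a,b)"
      using Cons.prems by (simp add: mult_mat_index[OF E embed_gate_carrier] sum.delta del: index_mult_mat(1))
    also have "\<dots> = (if a = b then 1 else 0)"
      using Cons.prems wf clifford2_unitary by (simp add: embed_gate_unitary)
    finally show ?thesis by (simp add: Gate C_m_Gate)
  next
    case (Meas i)
    have P: "(dagger (C_m n c m * proj_Z n i v) * (C_m n c m * proj_Z n i v)) $$ (a,b) =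
        (if bit a i = v \<and> bit b i = v then ?M m $$ (a,b) else 0)" for m v
      unfolding gram[OF C_m_carrier proj_Z_carrier] dagger_proj_Z
      using Cons.prems M[of m]
      by (simp add: mult_proj_Z_index[of _ "2^n"] proj_Z_mult_index[OF M] mult_carrier_mat[OF proj_Z_carrier M]
          del: index_mult_mat(1))
    \<comment> \<open>The record is \<open>2 * m + p\<close> with p the first outcome. Summing over
      p keeps the entries with equal bits at i; for the others a and b differ and the claimed value
      is 0 as well.\<close>
    have "(\<Sum>m<2^num_meas (g # c). (dagger (C_m n (g # c) m) * C_m n (g # c) m) $$ (a,b))
       = (\<Sum>m<2^num_meas c. \<Sum>p<(2::nat). (dagger (C_m n c m * proj_Z n i (odd p)) * (C_m n c m * proj_Z n i (odd p))) $$ (a,b))"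
      by (simp add: Meas C_m_Meas mult.commute[of 2] sum_lessThan_mult del: index_mult_mat(1))
    also have "\<dots> = (\<Sum>m<2^num_meas c. if bit a i = bit b i then ?M m $$ (a,b) else 0)"
      by (intro sum.cong refl) (simp add: P numeral_2_eq_2 del: index_mult_mat(1))
    also have "\<dots> = (if a = b then 1 else 0)"
      using Cons.prems by (cases "bit a i = bit b i") (auto simp: IH simp del: index_mult_mat(1))
    finally show ?thesis .
  qed
qed

section \<open>Pauli strings pushed through a circuit\<close>

lemma stab_strings:
  assumes "(s,t) \<in> stab n c"
  shows "s \<in> strings {..<n}" "t \<in> strings {..<n}"
  using assms by (auto simp: stab_def)

lemma stab_push:
  assumes "(s,t) \<in> stab n c"
  shows "\<exists>\<sigma>\<in>{1,-1}. \<exists>z. \<forall>m. C_m n c m * pauli_string n t =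
        (\<sigma> * outcome_sign (num_meas c) z m) \<cdot>\<^sub>m (pauli_string n s * C_m n c m)"
  using assms by (simp add: stab_def)

text \<open>The products \<open>dagger C_m * C_m\<close> sum to the identity. A nonzero
  \<open>C_m\<close> is what allows scalars to be compared in identities between its
  multiples.\<close>

lemma C_m_not_all_zero:
  assumes "\<forall>g\<in>set c. wf_op n g"
  shows "\<exists>m. C_m n c m \<noteq> 0\<^sub>m (2^n) (2^n)"
proof (rule ccontr)
  assume "\<not> ?thesis"
  then have z: "C_m n c m = 0\<^sub>m (2^n) (2^n)" for m by blast
  have "(\<Sum>m<2^num_meas c. (dagger (C_m n c m) * C_m n c m) $$ (0,0)) = 0"
    unfolding z
    by (intro sum.neutral ballI, subst mult_mat_index[of _ "2^n" "2^n" _ "2^n"])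
      (auto intro: dagger_carrier)
  then show False using sum_C_m_complete[OF assms, of 0 0] by simp
qed

text \<open>The sign in front of the character comes for free: \<open>P\<^sub>t\<close> and \<open>P\<^sub>s\<close> square to the identity.\<close>

lemma stabI:
  assumes wf: "\<forall>g\<in>set c. wf_op n g" and st: "s \<in> strings {..<n}" "t \<in> strings {..<n}"
    and eq: "\<And>m. C_m n c m * pauli_string n t =
        (\<gamma> * outcome_sign (num_meas c) z m) \<cdot>\<^sub>m (pauli_string n s * C_m n c m)"
  shows "(s,t) \<in> stab n c"
proof -
  obtain m where m: "C_m n c m \<noteq> 0\<^sub>m (2^n) (2^n)" using C_m_not_all_zero[OF wf] by blast
  define x where "x = outcome_sign (num_meas c) z m"
  have "C_m n c m * (pauli_string n t * pauli_string n t) =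
      (\<gamma> * x * (\<gamma> * x)) \<cdot>\<^sub>m (pauli_string n s * pauli_string n s * C_m n c m)"
    unfolding x_def by (rule intertwine_mult[of _ "2^n"]) (simp_all add: eq)
  then have C: "C_m n c m = (\<gamma> * \<gamma>) \<cdot>\<^sub>m C_m n c m"
    by (simp add: pauli_string_square[OF st(1)] pauli_string_square[OF st(2)] left_mult_one_mat[OF C_m_carrier]
        right_mult_one_mat[OF C_m_carrier] x_def mult_ac)
  obtain a b where ab: "a < 2^n" "b < 2^n" "C_m n c m $$ (a,b) \<noteq> 0"
  proof -
    have "\<exists>a<2^n. \<exists>b<2^n. C_m n c m $$ (a,b) \<noteq> 0"
    proof (rule ccontr)
      assume "\<not> ?thesis"
      then have "C_m n c m = 0\<^sub>m (2^n) (2^n)"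
        by (intro eq_matI) (auto simp: carrier_matD[OF C_m_carrier])
      with m show False by blast
    qed
    then show ?thesis using that by blast
  qed
  have "C_m n c m $$ (a,b) = (\<gamma> * \<gamma>) * C_m n c m $$ (a,b)"
    using arg_cong[OF C, of "\<lambda>M. M $$ (a,b)"] ab carrier_matD[OF C_m_carrier] by simp
  then have "\<gamma> * \<gamma> = 1" using ab by simp
  then have "\<gamma> \<in> {1,-1}" using square_eq_1_iff by blast
  then show ?thesis unfolding stab_def using st eq by blast
qed

text \<open>Two relations are multiplied. The Pauli products contribute phases that may be imaginary
  one by one; \<open>stabI\<close> shows that the collected scalar is a sign. The characters combine
  by XOR of their z.\<close>

lemma stab_sxor:
  assumes wf: "\<forall>g\<in>set c. wf_op n g" and "(s,t) \<in> stab n c" "(s',t') \<in> stab n c"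
  shows "(sxor s s', sxor t t') \<in> stab n c"
proof -
  note 1 = stab_strings[OF assms(2)] and 2 = stab_strings[OF assms(3)]
  from stab_push[OF assms(2)] obtain \<sigma> z where e1: "\<And>m. C_m n c m * pauli_string n t =
        (\<sigma> * outcome_sign (num_meas c) z m) \<cdot>\<^sub>m (pauli_string n s * C_m n c m)" by blast
  from stab_push[OF assms(3)] obtain \<sigma>' z' where e2: "\<And>m. C_m n c m * pauli_string n t' =
        (\<sigma>' * outcome_sign (num_meas c) z' m) \<cdot>\<^sub>m (pauli_string n s' * C_m n c m)" by blast
  define \<alpha> where "\<alpha> = (\<Prod>k<n. pauli_phase (t k) (t' k))"
  define \<beta> where "\<beta> = (\<Prod>k<n. pauli_phase (s k) (s' k))"
  have \<alpha>: "\<alpha> \<noteq> 0" unfolding \<alpha>_def by (rule pauli_phase_nonzero)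
  show ?thesis
  proof (rule stabI[OF wf, where z = "\<lambda>k. z k \<noteq> z' k" and \<gamma> = "\<beta> * \<sigma> * \<sigma>' / \<alpha>"])
    fix m
    let ?C = "C_m n c m" and ?P = "pauli_string n"
    let ?x = "outcome_sign (num_meas c) z m" and ?x' = "outcome_sign (num_meas c) z' m"
    have tt: "?P t * ?P t' = \<alpha> \<cdot>\<^sub>m ?P (sxor t t')" unfolding \<alpha>_def by (rule pauli_string_mult[OF 1(2) 2(2)])
    have ss: "?P s * ?P s' = \<beta> \<cdot>\<^sub>m ?P (sxor s s')" unfolding \<beta>_def by (rule pauli_string_mult[OF 1(1) 2(1)])
    have "?C * (?P t * ?P t') = (\<sigma> * ?x * (\<sigma>' * ?x')) \<cdot>\<^sub>m (?P s * ?P s' * ?C)"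
      by (rule intertwine_mult[of _ "2^n"]) (simp_all add: e1 e2)
    then have "\<alpha> \<cdot>\<^sub>m (?C * ?P (sxor t t')) = (\<sigma> * ?x * (\<sigma>' * ?x') * \<beta>) \<cdot>\<^sub>m (?P (sxor s s') * ?C)"
      unfolding tt ss
      by (simp add: mult_smult_distrib[of _ "2^n" "2^n" _ "2^n"] mult_smult_assoc_mat[of _ "2^n" "2^n" _ "2^n"] smult_smult_mat)
    then have "(1/\<alpha>) \<cdot>\<^sub>m (\<alpha> \<cdot>\<^sub>m (?C * ?P (sxor t t'))) =
        (1/\<alpha>) \<cdot>\<^sub>m ((\<sigma> * ?x * (\<sigma>' * ?x') * \<beta>) \<cdot>\<^sub>m (?P (sxor s s') * ?C))" by simp
    moreover have "1 \<cdot>\<^sub>m M = M" for M :: "complex mat" by (intro eq_matI) auto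
    ultimately show "?C * ?P (sxor t t') =
        (\<beta> * \<sigma> * \<sigma>' / \<alpha> * outcome_sign (num_meas c) (\<lambda>k. z k \<noteq> z' k) m) \<cdot>\<^sub>m (?P (sxor s s') * ?C)"
      unfolding outcome_sign_mult[symmetric] using \<alpha> by (simp add: smult_smult_mat mult_ac)
  qed (use 1 2 sxor_strings in auto)
qed

lemma stab_subset: "stab n c \<subseteq> strings {..<n} \<times> strings {..<n}"
  by (auto simp: stab_def)

lemma finite_stab: "finite (stab n c)"
  using stab_subset by (rule finite_subset) simp

lemma stab_Nil: "s \<in> strings {..<n} \<Longrightarrow> (s,s) \<in> stab n []"
  by (rule stabI[where \<gamma> = 1 and z = "\<lambda>_. False"])
    (auto simp: C_m_Nil outcome_sign_const_False left_mult_one_mat[of _ "2^n" "2^n"] right_mult_one_mat[of _ "2^n" "2^n"] intro!: eq_matI)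

text \<open>The gate acts first, so t is turned into u by the gate and u into s by the remaining
  circuit. Any scalar \<tau> will do, because \<open>stabI\<close> recovers the sign.\<close>

lemma stab_Gate:
  assumes wf: "\<forall>g\<in>set (Gate i j U # c). wf_op n g" and "(s,u) \<in> stab n c" and t: "t \<in> strings {..<n}"
    and push: "embed_gate n i j U * pauli_string n t = \<tau> \<cdot>\<^sub>m (pauli_string n u * embed_gate n i j U)"
  shows "(s,t) \<in> stab n (Gate i j U # c)"
proof -
  note s = stab_strings[OF assms(2)]
  from stab_push[OF assms(2)] obtain \<sigma> z where e: "\<And>m. C_m n c m * pauli_string n u =
        (\<sigma> * outcome_sign (num_meas c) z m) \<cdot>\<^sub>m (pauli_string n s * C_m n c m)" by blast
  show ?thesis
  proof (rule stabI[OF wf s(1) t, where \<gamma> = "\<tau> * \<sigma>" and z = z])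
    fix m
    let ?C = "C_m n c m" and ?E = "embed_gate n i j U" and ?P = "pauli_string n"
    let ?x = "outcome_sign (num_meas c) z m"
    have "?C * ?E * ?P t = ?C * (?E * ?P t)"
      by (rule assoc_mult_mat[of _ "2^n" "2^n" _ "2^n" _ "2^n"]) auto
    also have "\<dots> = \<tau> \<cdot>\<^sub>m (?C * (?P u * ?E))"
      unfolding push by (rule mult_smult_distrib[OF C_m_carrier mult_carrier_mat[OF pauli_string_carrier embed_gate_carrier]])
    also have "?C * (?P u * ?E) = ?C * ?P u * ?E"
      by (rule assoc_mult_mat[of _ "2^n" "2^n" _ "2^n" _ "2^n", symmetric]) auto
    also have "\<dots> = (\<sigma> * ?x) \<cdot>\<^sub>m (?P s * ?C * ?E)"
      unfolding e by (rule mult_smult_assoc_mat[OF mult_carrier_mat[OF pauli_string_carrier C_m_carrier] embed_gate_carrier])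
    also have "?P s * ?C * ?E = ?P s * (?C * ?E)"
      by (rule assoc_mult_mat[of _ "2^n" "2^n" _ "2^n" _ "2^n"]) auto
    finally show "C_m n (Gate i j U # c) m * ?P t =
       (\<tau> * \<sigma> * outcome_sign (num_meas (Gate i j U # c)) z m) \<cdot>\<^sub>m (?P s * C_m n (Gate i j U # c) m)"
      by (simp add: C_m_Gate smult_smult_mat mult.assoc)
  qed
qed

text \<open>Such a string passes through the projector unchanged. The new outcome does not enter its
  character, so \<open>case_nat\<close> inserts \<open>False\<close> at bit 0 and shifts z.\<close>

lemma stab_Meas_commute:
  assumes wf: "\<forall>g\<in>set (Meas i # c). wf_op n g" and "(s,t) \<in> stab n c" and ti: "t i = 0 \<or> t i = 3"
  shows "(s,t) \<in> stab n (Meas i # c)"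
proof -
  have i: "i < n" using wf by (simp add: wf_op_def)
  note s = stab_strings[OF assms(2)]
  from stab_push[OF assms(2)] obtain \<sigma> z where e: "\<And>m. C_m n c m * pauli_string n t =
        (\<sigma> * outcome_sign (num_meas c) z m) \<cdot>\<^sub>m (pauli_string n s * C_m n c m)" by blast
  show ?thesis
  proof (rule stabI[OF wf s(1,2), where \<gamma> = \<sigma> and z = "case_nat False z"])
    fix m
    let ?C = "C_m n c (m div 2)" and ?E = "proj_Z n i (odd m)" and ?P = "pauli_string n"
    let ?x = "outcome_sign (num_meas c) z (m div 2)"
    have "?C * ?E * ?P t = ?C * (?E * ?P t)"
      by (rule assoc_mult_mat[of _ "2^n" "2^n" _ "2^n" _ "2^n"]) auto
    also have "\<dots> = ?C * (?P t * ?E)"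
      by (simp add: proj_Z_commute[of i n t, OF i ti])
    also have "\<dots> = ?C * ?P t * ?E"
      by (rule assoc_mult_mat[of _ "2^n" "2^n" _ "2^n" _ "2^n", symmetric]) auto
    also have "\<dots> = (\<sigma> * ?x) \<cdot>\<^sub>m (?P s * ?C * ?E)"
      unfolding e by (rule mult_smult_assoc_mat[OF mult_carrier_mat[OF pauli_string_carrier C_m_carrier] proj_Z_carrier])
    also have "?P s * ?C * ?E = ?P s * (?C * ?E)"
      by (rule assoc_mult_mat[of _ "2^n" "2^n" _ "2^n" _ "2^n"]) auto
    finally show "C_m n (Meas i # c) m * ?P t =
       (\<sigma> * outcome_sign (num_meas (Meas i # c)) (case_nat False z) m) \<cdot>\<^sub>m (?P s * C_m n (Meas i # c) m)"
      by (simp add: C_m_Meas outcome_sign_Suc)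
  qed
qed

text \<open>The projector absorbs Z at i and leaves the sign of its outcome, so the character is the
  one of bit 0 alone. This is the element that a measurement adds.\<close>

lemma stab_Meas_z_string:
  assumes wf: "\<forall>g\<in>set (Meas i # c). wf_op n g"
  shows "((\<lambda>_. 0), z_string i) \<in> stab n (Meas i # c)"
proof -
  have i: "i < n" using wf by (simp add: wf_op_def)
  show ?thesis
  proof (rule stabI[OF wf zero_strings z_string_strings[OF i], where \<gamma> = 1 and z = "case_nat True (\<lambda>_. False)"])
    fix m
    let ?C = "C_m n c (m div 2)" and ?E = "proj_Z n i (odd m)"
    have CE: "?C * ?E \<in> carrier_mat (2^n) (2^n)"
      by (rule mult_carrier_mat[OF C_m_carrier proj_Z_carrier])
    have "?C * ?E * pauli_string n (z_string i) = ?C * (?E * pauli_string n (z_string i))"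
      by (rule assoc_mult_mat[of _ "2^n" "2^n" _ "2^n" _ "2^n"]) auto
    also have "\<dots> = (if odd m then -1 else 1) \<cdot>\<^sub>m (?C * ?E)"
      unfolding proj_Z_z_string[OF i] by (rule mult_smult_distrib[of _ "2^n" "2^n" _ "2^n"]) auto
    finally show "C_m n (Meas i # c) m * pauli_string n (z_string i) =
       (1 * outcome_sign (num_meas (Meas i # c)) (case_nat True (\<lambda>_. False)) m) \<cdot>\<^sub>m
         (pauli_string n (\<lambda>_. 0) * C_m n (Meas i # c) m)"
      using left_mult_one_mat[OF CE]
      by (simp add: C_m_Meas outcome_sign_Suc outcome_sign_const_False pauli_string_zero)
  qed
qed

text \<open>\<open>P\<^sub>t\<close> and \<open>Z\<^sub>i\<close> anticommute, so they cannot both be traded through a nonzero map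
  when \<open>Z\<^sub>i\<close> is traded for the identity.\<close>

lemma z_string_notin_stab:
  assumes wf: "\<forall>g\<in>set c. wf_op n g" and st: "(s,t) \<in> stab n c" and i: "i < n" and ti: "t i = 1 \<or> t i = 2"
  shows "((\<lambda>_. 0), z_string i) \<notin> stab n c"
proof
  assume "((\<lambda>_. 0), z_string i) \<in> stab n c"
  from stab_push[OF this] obtain \<sigma>' z' where e2: "\<And>m. C_m n c m * pauli_string n (z_string i) =
        (\<sigma>' * outcome_sign (num_meas c) z' m) \<cdot>\<^sub>m (pauli_string n (\<lambda>_. 0) * C_m n c m)" by blast
  note t = stab_strings(2)[OF st]
  from stab_push[OF st] obtain \<sigma> z where e1: "\<And>m. C_m n c m * pauli_string n t =
        (\<sigma> * outcome_sign (num_meas c) z m) \<cdot>\<^sub>m (pauli_string n s * C_m n c m)" by blast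
  let ?P = "pauli_string n" and ?z = "z_string i"
  define \<alpha> where "\<alpha> = (\<Prod>k<n. pauli_phase (t k) (?z k))"
  have \<alpha>: "\<alpha> \<noteq> 0" unfolding \<alpha>_def by (rule pauli_phase_nonzero)
  \<comment> \<open>The two strings can fail to commute only at qubit i, where X or Y meets Z and
    the phases are opposite.\<close>
  have "(\<Prod>k<n. pauli_phase (?z k) (t k)) = (\<Prod>k<n. (if k = i then -1 else 1) * pauli_phase (t k) (?z k))"
    using ti by (intro prod.cong refl) (auto simp: z_string_def pauli_phase_def)
  then have \<alpha>': "(\<Prod>k<n. pauli_phase (?z k) (t k)) = - \<alpha>"
    using i by (simp add: prod.distrib prod.delta \<alpha>_def)
  have tz: "?P t * ?P ?z = \<alpha> \<cdot>\<^sub>m ?P (sxor t ?z)"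
    unfolding \<alpha>_def by (rule pauli_string_mult[OF t z_string_strings[OF i]])
  have zt: "?P ?z * ?P t = (- \<alpha>) \<cdot>\<^sub>m ?P (sxor t ?z)"
    unfolding pauli_string_mult[OF z_string_strings[OF i] t] \<alpha>' sxor_commute[of ?z] ..
  have u: "sxor t ?z \<in> strings {..<n}" by (rule sxor_strings[OF t z_string_strings[OF i]])
  have "C_m n c m = 0\<^sub>m (2^n) (2^n)" for m
  proof -
    let ?C = "C_m n c m"
    let ?a = "\<sigma> * outcome_sign (num_meas c) z m" and ?b = "\<sigma>' * outcome_sign (num_meas c) z' m"
    have "?C * (?P t * ?P ?z) = (?a * ?b) \<cdot>\<^sub>m (?P s * ?P (\<lambda>_. 0) * ?C)"
      by (rule intertwine_mult[of _ "2^n"]) (simp_all add: e1 e2)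
    moreover have "?C * (?P ?z * ?P t) = (?b * ?a) \<cdot>\<^sub>m (?P (\<lambda>_. 0) * ?P s * ?C)"
      by (rule intertwine_mult[of _ "2^n"]) (simp_all add: e1 e2)
    ultimately have "?C * (?P t * ?P ?z) = ?C * (?P ?z * ?P t)"
      by (simp add: pauli_string_zero left_mult_one_mat[OF pauli_string_carrier]
          right_mult_one_mat[OF pauli_string_carrier] mult.commute)
    then have eq: "\<alpha> \<cdot>\<^sub>m (?C * ?P (sxor t ?z)) = (- \<alpha>) \<cdot>\<^sub>m (?C * ?P (sxor t ?z))"
      unfolding tz zt by (simp add: mult_smult_distrib[of _ "2^n" "2^n" _ "2^n"])
    have Z: "?C * ?P (sxor t ?z) = 0\<^sub>m (2^n) (2^n)"
    proof (rule eq_matI)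
      fix a b assume ab: "a < dim_row (0\<^sub>m (2^n) (2^n) :: complex mat)" "b < dim_col (0\<^sub>m (2^n) (2^n) :: complex mat)"
      then have "\<alpha> * (?C * ?P (sxor t ?z)) $$ (a,b) = - \<alpha> * (?C * ?P (sxor t ?z)) $$ (a,b)"
        using arg_cong[OF eq, of "\<lambda>M. M $$ (a,b)"] carrier_matD[OF C_m_carrier] by (simp del: index_mult_mat(1))
      then show "(?C * ?P (sxor t ?z)) $$ (a,b) = 0\<^sub>m (2^n) (2^n) $$ (a,b)"
        using \<alpha> ab by (simp add: equation_minus_iff del: index_mult_mat(1))
    qed (auto simp: carrier_matD[OF C_m_carrier])
    have "?C = ?C * (?P (sxor t ?z) * ?P (sxor t ?z))"
      by (simp add: pauli_string_square[OF u] right_mult_one_mat[OF C_m_carrier])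
    also have "\<dots> = ?C * ?P (sxor t ?z) * ?P (sxor t ?z)"
      by (rule assoc_mult_mat[of _ "2^n" "2^n" _ "2^n" _ "2^n", symmetric]) auto
    also have "\<dots> = 0\<^sub>m (2^n) (2^n)" unfolding Z by (rule left_mult_zero_mat) simp
    finally show ?thesis .
  qed
  then show False using C_m_not_all_zero[OF wf] by blast
qed

text \<open>The size cannot drop along the circuit: each operation is accompanied by a comparison
  map between the pairs before and after it. A lower bound is what \<open>stabilizer_entropy\<close>
  asks for; Parseval caps the size there.\<close>

theorem card_stab_ge:
  assumes "\<forall>g\<in>set c. wf_op n g"
  shows "4 ^ n \<le> card (stab n c)"
  using assms
proof (induction c)
  case Nil
  have "card ((\<lambda>s. (s,s)) ` strings {..<n}) = 4 ^ n"
    by (subst card_image) (auto simp: inj_on_def card_strings)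
  moreover have "(\<lambda>s. (s,s)) ` strings {..<n} \<subseteq> stab n []" using stab_Nil by auto
  ultimately show ?case using card_mono[OF finite_stab] by metis
next
  case (Cons g c)
  then have IH: "4 ^ n \<le> card (stab n c)" and wfc: "\<forall>g\<in>set c. wf_op n g" by auto
  show ?case
  proof (cases g)
    case (Gate i j U)
    let ?E = "embed_gate n i j U" and ?P = "pauli_string n"
    have ij: "i < n" "j < n" "i \<noteq> j" and U: "clifford2 U" using Cons.prems Gate by (auto simp: wf_op_def)
    have "\<forall>t\<in>strings {..<n}. \<exists>u. u \<in> strings {..<n} \<and> (\<exists>\<sigma>\<in>{1,-1}. ?E * ?P t = \<sigma> \<cdot>\<^sub>m (?P u * ?E))"
      using embed_gate_clifford[OF ij U] by blast
    then obtain \<tau> where \<tau>: "\<And>t. t \<in> strings {..<n} \<Longrightarrow> \<tau> t \<in> strings {..<n}"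
      and push: "\<And>t. t \<in> strings {..<n} \<Longrightarrow> \<exists>\<sigma>\<in>{1,-1}. ?E * ?P t = \<sigma> \<cdot>\<^sub>m (?P (\<tau> t) * ?E)"
      by metis
    have EE: "dagger ?E * ?E = 1\<^sub>m (2^n)"
      using embed_gate_unitary[OF ij] clifford2_unitary[OF U] by blast
    have Ed: "dagger ?E \<in> carrier_mat (2^n) (2^n)" by (rule dagger_carrier) simp
    \<comment> \<open>The gate is invertible, so its image determines a string up to sign and hence
      entirely. On a finite set this makes \<tau> onto, so every pair of the shorter circuit is
      reached.\<close>
    have "inj_on \<tau> (strings {..<n})"
    proof (rule inj_onI)
      fix t t' assume t: "t \<in> strings {..<n}" "t' \<in> strings {..<n}" and eq: "\<tau> t = \<tau> t'"
      obtain \<sigma> where \<sigma>: "\<sigma> \<in> {1,-1}" "?E * ?P t = \<sigma> \<cdot>\<^sub>m (?P (\<tau> t) * ?E)" using push[OF t(1)] by blast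
      obtain \<sigma>' where \<sigma>': "\<sigma>' \<in> {1,-1}" "?E * ?P t' = \<sigma>' \<cdot>\<^sub>m (?P (\<tau> t) * ?E)" using push[OF t(2)] eq by auto
      have "?E * ?P t = (\<sigma> * \<sigma>') \<cdot>\<^sub>m (?E * ?P t')"
        using \<sigma>'(1) unfolding \<sigma>(2) \<sigma>'(2) smult_smult_mat by auto
      then have "dagger ?E * (?E * ?P t) = (\<sigma> * \<sigma>') \<cdot>\<^sub>m (dagger ?E * (?E * ?P t'))"
        using Ed by (simp add: mult_smult_distrib[of _ "2^n" "2^n" _ "2^n"] mult_carrier_mat[of _ "2^n" "2^n"])
      moreover have "dagger ?E * (?E * ?P x) = ?P x" for x
        using Ed by (simp add: assoc_mult_mat[of _ "2^n" "2^n" _ "2^n" _ "2^n", symmetric] EE left_mult_one_mat[OF pauli_string_carrier])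
      ultimately have "?P t = (\<sigma> * \<sigma>') \<cdot>\<^sub>m ?P t'" by simp
      then show "t = t'" by (rule pauli_string_eq_smult_imp_eq[OF t])
    qed
    then have surj: "\<tau> ` strings {..<n} = strings {..<n}"
      using \<tau> by (intro endo_inj_surj) auto
    have "stab n c \<subseteq> map_prod id \<tau> ` stab n (g # c)"
    proof clarify
      fix s u assume su: "(s,u) \<in> stab n c"
      then have "u \<in> \<tau> ` strings {..<n}" using stab_subset surj by blast
      then obtain t where t: "t \<in> strings {..<n}" "u = \<tau> t" by blast
      then obtain \<sigma> where "?E * ?P t = \<sigma> \<cdot>\<^sub>m (?P u * ?E)" using push by blast
      then have "(s,t) \<in> stab n (g # c)"
        using stab_Gate[of i j U c n s u t] su t Cons.prems Gate by blast
      then show "(s,u) \<in> map_prod id \<tau> ` stab n (g # c)"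
        using t(2) by (force simp: map_prod_def)
    qed
    then have "card (stab n c) \<le> card (map_prod id \<tau> ` stab n (g # c))"
      by (intro card_mono finite_imageI finite_stab)
    also have "\<dots> \<le> card (stab n (g # c))" by (rule card_image_le[OF finite_stab])
    finally show ?thesis using IH by simp
  next
    case (Meas i)
    have i: "i < n" using Cons.prems Meas by (auto simp: wf_op_def)
    note wf = Cons.prems[unfolded Meas]
    \<comment> \<open>Letters X and Y at i are those that anticommute with the measured Z.\<close>
    define ac where "ac = (\<lambda>x. case x of (s :: nat \<Rightarrow> nat, t :: nat \<Rightarrow> nat) \<Rightarrow> t i = 1 \<or> t i = 2)"
    \<comment> \<open>One anticommuting element serves for all. If none exists the choice is
      arbitrary, and the first branch of \<open>F\<close> never occurs on
      \<open>stab n c\<close>.\<close>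
    define h where "h = (SOME x. x \<in> stab n c \<and> ac x)"
    have h: "h \<in> stab n c" "ac h" if "x \<in> stab n c" "ac x" for x
      using someI[of "\<lambda>x. x \<in> stab n c \<and> ac x" x] that by (auto simp: h_def)
    define add where "add = (\<lambda>x y. (sxor (fst x) (fst y), sxor (snd x) (snd y)) :: (nat \<Rightarrow> nat) \<times> (nat \<Rightarrow> nat))"
    define \<zeta> where "\<zeta> = ((\<lambda>_. 0) :: nat \<Rightarrow> nat, z_string i)"
    have add_mem: "add x y \<in> stab n c'" if "\<forall>g\<in>set c'. wf_op n g" "x \<in> stab n c'" "y \<in> stab n c'" for x y c'
      using stab_sxor[of c' n "fst x" "snd x" "fst y" "snd y"] that by (simp add: add_def)
    have add_cancel: "add (add x y) y = x" for x y by (simp add: add_def)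
    have add_cancel2: "add x (add x y) = y" for x y by (simp add: add_def)
    have t4: "\<not> ac x \<longleftrightarrow> snd x i = 0 \<or> snd x i = 3" if x: "x \<in> stab n c" for x
    proof -
      have "snd x \<in> strings {..<n}" using x stab_subset by force
      then have "snd x i < 4" by (rule stringsD)
      then show ?thesis using less_4_cases by (auto simp: ac_def split: prod.splits)
    qed
    have comm: "x \<in> stab n (Meas i # c)" if "x \<in> stab n c" "\<not> ac x" for x
      using stab_Meas_commute[OF wf, of "fst x" "snd x"] that t4[of x] by simp
    have ac_add: "\<not> ac (add x y)" if "ac x" "ac y" for x y
    proof -
      have "snd x i = 1 \<or> snd x i = 2" "snd y i = 1 \<or> snd y i = 2"
        using that by (auto simp: ac_def split: prod.splits)
      then have "snd (add x y) i \<noteq> 1 \<and> snd (add x y) i \<noteq> 2"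
        by (elim disjE) (simp_all add: add_def sxor_def)
      then show ?thesis by (auto simp: ac_def split: prod.splits)
    qed
    \<comment> \<open>Multiplying by h restores commutation with the measured Z, so the element
      survives; the extra factor \<zeta> separates it from the elements that were kept.\<close>
    define F where "F = (\<lambda>x. if ac x then add (add x h) \<zeta> else x)"
    have noz: "\<zeta> \<notin> stab n c" if "x \<in> stab n c" "ac x" for x
      using z_string_notin_stab[OF wfc _ i, of "fst x" "snd x"] that by (auto simp: ac_def \<zeta>_def split: prod.splits)
    have "F ` stab n c \<subseteq> stab n (Meas i # c)"
    proof (rule image_subsetI)
      fix x assume x: "x \<in> stab n c"
      show "F x \<in> stab n (Meas i # c)"
      proof (cases "ac x")
        case True
        have "add x h \<in> stab n (Meas i # c)"
          using comm ac_add add_mem[OF wfc x h(1)[OF x True]] h(2)[OF x True] True by blast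
        then have "add (add x h) \<zeta> \<in> stab n (Meas i # c)"
          using add_mem[OF wf] stab_Meas_z_string[OF wf] by (simp add: \<zeta>_def)
        then show ?thesis using True by (simp add: F_def)
      next
        case False
        then show ?thesis using comm x by (simp add: F_def)
      qed
    qed
    moreover have "inj_on F (stab n c)"
    proof -
      \<comment> \<open>If a replaced element met a kept one, \<zeta> would be a product of elements
        of \<open>stab n c\<close>, against \<open>z_string_notin_stab\<close>.\<close>
      have mixed: False if "x \<in> stab n c" "y \<in> stab n c" "ac x" "\<not> ac y" "F x = F y" for x y
      proof -
        have "y = add (add x h) \<zeta>" using that by (simp add: F_def)
        then have "\<zeta> = add (add x h) y" by (simp add: add_cancel2)
        also have "\<dots> \<in> stab n c" using that h(1) by (intro add_mem wfc) auto
        finally show False using noz that by blast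
      qed
      show ?thesis
      proof (rule inj_onI)
        fix x y assume xy: "x \<in> stab n c" "y \<in> stab n c" "F x = F y"
        show "x = y"
        proof (cases "ac x"; cases "ac y")
          assume "ac x" "ac y"
          then have "add (add x h) \<zeta> = add (add y h) \<zeta>" using xy by (simp add: F_def)
          then show ?thesis by (metis add_cancel)
        next
          assume "\<not> ac x" "\<not> ac y"
          then show ?thesis using xy by (simp add: F_def)
        qed (use mixed[of x y] mixed[of y x] xy in auto)
      qed
    qed
    ultimately have "card (stab n c) \<le> card (stab n (Meas i # c))"
      by (intro card_inj_on_le[OF _ _ finite_stab])
    then show ?thesis using IH Meas by simp
  qed
qed

section \<open>The channel in the Heisenberg picture\<close>

text \<open>For each column the squared norm of the difference expands into four Gram entries, 1 - 1
  - 1 + 1 = 0.\<close>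

lemma eq_mat_if_gram_eq_one:
  assumes A: "A \<in> carrier_mat r d" and B: "B \<in> carrier_mat r d"
    and g: "dagger A * A = 1\<^sub>m d" "dagger A * B = 1\<^sub>m d" "dagger B * A = 1\<^sub>m d" "dagger B * B = 1\<^sub>m d"
  shows "A = B"
proof (rule eq_matI)
  fix a b assume "a < dim_row B" "b < dim_col B"
  then have ab: "a < r" "b < d" using B by auto
  have gram: "(\<Sum>x<r. cnj (X $$ (x,b)) * Y $$ (x,b)) = 1"
    if "X \<in> carrier_mat r d" "Y \<in> carrier_mat r d" "dagger X * Y = 1\<^sub>m d" for X Y
  proof -
    have "(\<Sum>x<r. cnj (X $$ (x,b)) * Y $$ (x,b)) = (dagger X * Y) $$ (b,b)"
      unfolding mult_mat_index[OF dagger_carrier[OF that(1)] that(2) ab(2) ab(2)]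
      using that ab by (intro sum.cong refl) (simp add: dagger_index[OF that(1)])
    then show ?thesis using that(3) ab by simp
  qed
  have "complex_of_real (\<Sum>x<r. (cmod (A $$ (x,b) - B $$ (x,b)))\<^sup>2) =
      (\<Sum>x<r. cnj (A $$ (x,b)) * A $$ (x,b)) - (\<Sum>x<r. cnj (A $$ (x,b)) * B $$ (x,b))
      - (\<Sum>x<r. cnj (B $$ (x,b)) * A $$ (x,b)) + (\<Sum>x<r. cnj (B $$ (x,b)) * B $$ (x,b))"
    unfolding of_real_sum complex_norm_square sum_subtractf[symmetric] sum.distrib[symmetric]
    by (intro sum.cong refl) (simp add: algebra_simps)
  also have "\<dots> = 0" by (simp add: gram A B g)
  finally have "(\<Sum>x<r. (cmod (A $$ (x,b) - B $$ (x,b)))\<^sup>2) = 0"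
    by (simp only: of_real_eq_0_iff)
  then have "(cmod (A $$ (a,b) - B $$ (a,b)))\<^sup>2 = 0"
    using ab by (subst (asm) sum_nonneg_eq_0_iff) auto
  then show "A $$ (a,b) = B $$ (a,b)" by simp
qed (use A B in auto)

text \<open>With X and T self-adjoint involutions, \<open>V * T\<close> and \<open>X * V\<close> are
  both isometries. The compression identity evaluates their mixed products to T squared, which is
  also the identity, so the two matrices coincide. A statement about the compressed operator thereby
  becomes one about X itself.\<close>

lemma isometry_intertwines:
  assumes V: "V \<in> carrier_mat r d" "dagger V * V = 1\<^sub>m d"
    and X: "X \<in> carrier_mat r r" "dagger X = X" "X * X = 1\<^sub>m r"
    and T: "T \<in> carrier_mat d d" "dagger T = T" "T * T = 1\<^sub>m d"
    and eq: "T = dagger V * X * V"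
  shows "V * T = X * V"
proof (rule eq_mat_if_gram_eq_one[of _ r d])
  have Vd: "dagger V \<in> carrier_mat d r" using V(1) by (rule dagger_carrier)
  have VT: "V * T \<in> carrier_mat r d" and XV: "X * V \<in> carrier_mat r d" using V X T by auto
  have dVT: "dagger (V * T) = T * dagger V" and dXV: "dagger (X * V) = dagger V * X"
    using dagger_mult[OF V(1) T(1)] dagger_mult[OF X(1) V(1)] T(2) X(2) by simp_all
  have a: "dagger V * (V * T) = T"
    using assoc_mult_mat[OF Vd V(1) T(1)] T(1) V(2) by simp
  have b: "dagger V * (X * V) = T"
    using assoc_mult_mat[OF Vd X(1) V(1)] eq by simp
  have c: "X * (X * V) = V"
    using assoc_mult_mat[OF X(1) X(1) V(1)] V(1) X(3) by simp
  have d: "dagger V * X * (V * T) = T * T"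
    using assoc_mult_mat[OF mult_carrier_mat[OF Vd X(1)] V(1) T(1)] eq by simp
  show "dagger (V * T) * (V * T) = 1\<^sub>m d"
    unfolding dVT using assoc_mult_mat[OF T(1) Vd VT] a T(3) by simp
  show "dagger (V * T) * (X * V) = 1\<^sub>m d"
    unfolding dVT using assoc_mult_mat[OF T(1) Vd XV] b T(3) by simp
  show "dagger (X * V) * (V * T) = 1\<^sub>m d"
    unfolding dXV d T(3) ..
  show "dagger (X * V) * (X * V) = 1\<^sub>m d"
    unfolding dXV using assoc_mult_mat[OF Vd X(1) XV] c V(2) by simp
qed (use V X T in auto)

section \<open>The isometry V of the channel, dephasing of the record, and the Heisenberg
  map\<close>

definition iso_mat :: "nat \<Rightarrow> circ_op list \<Rightarrow> complex mat" where
  "iso_mat n c = mat (2^(n + num_meas c)) (2^n) (\<lambda>(a,b). C_m n c (a div 2^n) $$ (a mod 2^n, b))"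

lemma iso_mat_carrier [simp]: "iso_mat n c \<in> carrier_mat (2^(n + num_meas c)) (2^n)"
  by (simp add: iso_mat_def)

lemma block_idx_less: "m < 2^K \<Longrightarrow> p < 2^n \<Longrightarrow> m * 2^n + p < (2::nat)^(n+K)"
proof -
  assume "m < 2^K" "p < 2^n"
  then have "m * 2^n + p < (m + 1) * 2^n" by simp
  also have "\<dots> \<le> 2^K * 2^n" using \<open>m < 2^K\<close> by (intro mult_right_mono) auto
  finally show ?thesis by (simp add: power_add mult.commute)
qed

lemma div_exp_less: "a < (2::nat)^(n+K) \<Longrightarrow> a div 2^n < 2^K"
  by (simp add: power_add less_mult_imp_div_less mult.commute)

lemma sum_blocks:
  fixes f :: "nat \<Rightarrow> 'a::comm_monoid_add"
  shows "(\<Sum>a<2^(n+K). f a) = (\<Sum>m<2^K. \<Sum>p<2^n. f (m * 2^n + p))"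
  using sum_lessThan_mult[of f "2^K" "2^n"] by (simp add: power_add mult.commute)

lemma iso_mat_index:
  "m < 2^num_meas c \<Longrightarrow> p < 2^n \<Longrightarrow> b < 2^n \<Longrightarrow> iso_mat n c $$ (m * 2^n + p, b) = C_m n c m $$ (p,b)"
  by (simp add: iso_mat_def block_idx_less)

lemma iso_mat_isometry:
  assumes "\<forall>g\<in>set c. wf_op n g"
  shows "dagger (iso_mat n c) * iso_mat n c = 1\<^sub>m (2^n)"
proof (rule eq_matI)
  fix x y assume "x < dim_row (1\<^sub>m (2^n) :: complex mat)" "y < dim_col (1\<^sub>m (2^n) :: complex mat)"
  then have xy: "x < 2^n" "y < 2^n" by auto
  have "(dagger (iso_mat n c) * iso_mat n c) $$ (x,y) =
      (\<Sum>a<2^(n + num_meas c). cnj (iso_mat n c $$ (a,x)) * iso_mat n c $$ (a,y))"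
    unfolding mult_mat_index[OF dagger_carrier[OF iso_mat_carrier] iso_mat_carrier xy]
    using xy by (intro sum.cong refl) (simp add: dagger_index[OF iso_mat_carrier])
  also have "\<dots> = (\<Sum>m<2^num_meas c. \<Sum>p<2^n. cnj (C_m n c m $$ (p,x)) * C_m n c m $$ (p,y))"
    unfolding sum_blocks using xy by (intro sum.cong refl) (simp add: iso_mat_index)
  also have "\<dots> = (\<Sum>m<2^num_meas c. (dagger (C_m n c m) * C_m n c m) $$ (x,y))"
    unfolding mult_mat_index[OF dagger_carrier[OF C_m_carrier] C_m_carrier xy]
    using xy by (intro sum.cong refl) (simp add: dagger_index[OF C_m_carrier])
  also have "\<dots> = 1\<^sub>m (2^n) $$ (x,y)"
    using sum_C_m_complete[OF assms xy] xy by simp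
  finally show "(dagger (iso_mat n c) * iso_mat n c) $$ (x,y) = 1\<^sub>m (2^n) $$ (x,y)" .
qed (auto simp: dagger_def iso_mat_def)

text \<open>Dephasing of the record register: coherences between different records are deleted. The
  channel is conjugation by V followed by this map.\<close>

definition block_diag :: "nat \<Rightarrow> complex mat \<Rightarrow> complex mat" where
  "block_diag n X = mat (dim_row X) (dim_col X) (\<lambda>(a,b). if a div 2^n = b div 2^n then X $$ (a,b) else 0)"

lemma block_diag_carrier: "X \<in> carrier_mat r k \<Longrightarrow> block_diag n X \<in> carrier_mat r k"
  by (auto simp: block_diag_def)

lemma block_diag_index:
  "X \<in> carrier_mat r k \<Longrightarrow> a < r \<Longrightarrow> b < k \<Longrightarrow>
    block_diag n X $$ (a,b) = (if a div 2^n = b div 2^n then X $$ (a,b) else 0)"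
  by (auto simp: block_diag_def)

lemma channel_C_eq_block_diag:
  assumes \<rho>: "\<rho> \<in> carrier_mat (2^n) (2^n)"
  shows "channel_C n c \<rho> = block_diag n (iso_mat n c * \<rho> * dagger (iso_mat n c))"
proof -
  let ?V = "iso_mat n c" and ?N = "2^(n + num_meas c) :: nat"
  have Vd: "dagger ?V \<in> carrier_mat (2^n) ?N" by (rule dagger_carrier) simp
  have W: "?V * \<rho> * dagger ?V \<in> carrier_mat ?N ?N"
    using \<rho> Vd by (intro mult_carrier_mat[of _ _ "2^n"]) auto
  show ?thesis
  proof (rule eq_matI)
    fix a b assume "a < dim_row (block_diag n (?V * \<rho> * dagger ?V))" "b < dim_col (block_diag n (?V * \<rho> * dagger ?V))"
    then have ab: "a < ?N" "b < ?N" using carrier_matD[OF block_diag_carrier[OF W]] by auto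
    let ?C = "C_m n c (a div 2^n)"
    have m: "a mod 2^n < 2^n" "b mod 2^n < 2^n" by simp_all
    have dV: "dagger ?V $$ (y,b) = cnj (C_m n c (b div 2^n) $$ (b mod 2^n, y))" if "y < 2^n" for y
      using that ab by (subst dagger_index[OF iso_mat_carrier]) (simp_all add: iso_mat_def)
    have "(?V * \<rho> * dagger ?V) $$ (a,b) = (?C * \<rho> * dagger ?C) $$ (a mod 2^n, b mod 2^n)"
      if "a div 2^n = b div 2^n"
      unfolding mult3_index[OF iso_mat_carrier \<rho> Vd ab] mult3_index[OF C_m_carrier \<rho> dagger_carrier[OF C_m_carrier] m]
      using ab that by (intro sum.cong refl)
        (simp add: dV dagger_index[OF C_m_carrier], simp add: iso_mat_def)
    then show "channel_C n c \<rho> $$ (a,b) = block_diag n (?V * \<rho> * dagger ?V) $$ (a,b)"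
      using ab by (simp add: channel_C_def Let_def block_diag_index[OF W] del: index_mult_mat(1))
  qed (use carrier_matD[OF block_diag_carrier[OF W]] in \<open>auto simp: channel_C_def Let_def\<close>)
qed

lemma mtrace_mult:
  assumes "X \<in> carrier_mat r k" "Y \<in> carrier_mat k r"
  shows "mtrace (X * Y) = (\<Sum>a<r. \<Sum>b<k. X $$ (a,b) * Y $$ (b,a))"
  using assms unfolding mtrace_def
  by (intro sum.cong) (auto simp: mult_mat_index[OF assms] simp del: index_mult_mat(1))

text \<open>Dephasing is its own adjoint for the trace pairing, so it can be moved from the state to
  the observable.\<close>

lemma mtrace_block_diag:
  assumes "X \<in> carrier_mat r r" "Y \<in> carrier_mat r r"
  shows "mtrace (X * block_diag n Y) = mtrace (block_diag n X * Y)"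
  unfolding mtrace_mult[OF assms(1) block_diag_carrier[OF assms(2)]]
    mtrace_mult[OF block_diag_carrier[OF assms(1)] assms(2)]
  using assms by (intro sum.cong refl) (auto simp: block_diag_index)

text \<open>After the dephasing has moved to X, cyclicity of the trace yields the formula. The
  definite description in \<open>heis_adjoint\<close> also requires uniqueness, which matrix units
  provide.\<close>

lemma heis_adjoint_channel_C:
  assumes X: "X \<in> carrier_mat (2^(n + num_meas c)) (2^(n + num_meas c))"
  shows "heis_adjoint n (n + num_meas c) (channel_C n c) X = dagger (iso_mat n c) * block_diag n X * iso_mat n c"
proof -
  let ?V = "iso_mat n c" and ?N = "2^(n + num_meas c) :: nat" and ?d = "2^n :: nat"
  let ?Y = "dagger ?V * block_diag n X * ?V"
  have V: "?V \<in> carrier_mat ?N ?d" by simp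
  have Vd: "dagger ?V \<in> carrier_mat ?d ?N" by (rule dagger_carrier) simp
  note BX = block_diag_carrier[OF X, of n]
  have Y: "?Y \<in> carrier_mat ?d ?d" using V Vd BX by (intro mult_carrier_mat[of _ _ ?N]) auto
  have tr: "mtrace (?Y * \<rho>) = mtrace (X * channel_C n c \<rho>)" if \<rho>: "\<rho> \<in> carrier_mat ?d ?d" for \<rho>
  proof -
    have W: "?V * \<rho> * dagger ?V \<in> carrier_mat ?N ?N" using V Vd \<rho> by (intro mult_carrier_mat[of _ _ ?d]) auto
    have BV: "block_diag n X * ?V \<in> carrier_mat ?N ?d" using BX V by (rule mult_carrier_mat)
    have V\<rho>: "?V * \<rho> \<in> carrier_mat ?N ?d" using V \<rho> by (rule mult_carrier_mat)
    have "mtrace (X * channel_C n c \<rho>) = mtrace (block_diag n X * (?V * \<rho> * dagger ?V))"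
      unfolding channel_C_eq_block_diag[OF \<rho>] by (rule mtrace_block_diag[OF X W])
    also have "block_diag n X * (?V * \<rho> * dagger ?V) = block_diag n X * (?V * \<rho>) * dagger ?V"
      by (rule assoc_mult_mat[OF BX V\<rho> Vd, symmetric])
    also have "mtrace \<dots> = mtrace (dagger ?V * (block_diag n X * (?V * \<rho>)))"
      by (rule mtrace_mult_commute[OF mult_carrier_mat[OF BX V\<rho>] Vd])
    also have "dagger ?V * (block_diag n X * (?V * \<rho>)) = dagger ?V * block_diag n X * (?V * \<rho>)"
      by (rule assoc_mult_mat[OF Vd BX V\<rho>, symmetric])
    also have "\<dots> = ?Y * \<rho>"
      by (rule assoc_mult_mat[OF mult_carrier_mat[OF Vd BX] V \<rho>, symmetric])
    finally show ?thesis by simp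
  qed
  show ?thesis
    unfolding heis_adjoint_def
  proof (rule the_equality)
    show "?Y \<in> carrier_mat ?d ?d \<and>
        (\<forall>\<rho>\<in>carrier_mat ?d ?d. mtrace (?Y * \<rho>) = mtrace (X * channel_C n c \<rho>))"
      using Y tr by blast
  next
    fix Z assume Z: "Z \<in> carrier_mat ?d ?d \<and>
        (\<forall>\<rho>\<in>carrier_mat ?d ?d. mtrace (Z * \<rho>) = mtrace (X * channel_C n c \<rho>))"
    show "Z = ?Y"
    proof (rule eq_matI)
      fix i j assume "i < dim_row ?Y" "j < dim_col ?Y"
      then have ij: "i < ?d" "j < ?d" using carrier_matD[OF Y] by auto
      \<comment> \<open>The matrix unit sits at the transposed position (j,i), so that tracing
        against it reads off the entry (i,j).\<close>
      define \<rho> :: "complex mat" where "\<rho> = mat ?d ?d (\<lambda>(a,b). if a = j \<and> b = i then 1 else 0)"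
      have \<rho>: "\<rho> \<in> carrier_mat ?d ?d" by (simp add: \<rho>_def)
      have unit: "mtrace (W * \<rho>) = W $$ (i,j)" if W: "W \<in> carrier_mat ?d ?d" for W
      proof -
        have "mtrace (W * \<rho>) = (\<Sum>a<?d. \<Sum>b<?d. if a = i then if b = j then W $$ (i,j) else 0 else 0)"
          unfolding mtrace_mult[OF W \<rho>] by (intro sum.cong refl) (auto simp: \<rho>_def)
        also have "\<dots> = (\<Sum>a<?d. if a = i then W $$ (i,j) else 0)"
          using ij by (intro sum.cong refl) (simp add: sum.delta)
        finally show ?thesis using ij by (simp add: sum.delta)
      qed
      show "Z $$ (i,j) = ?Y $$ (i,j)"
        using unit[of Z] unit[OF Y] Z \<rho> tr[OF \<rho>] by metis
    qed (use Z carrier_matD[OF Y] in auto)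
  qed
qed

section \<open>Pauli operators on the record register and the sets counted by
  \<open>H_count\<close>\<close>

lemma pauli_entry_diag:
  assumes "\<forall>k<K. u k = 0 \<or> u k = 3" "a < 2^K" "b < 2^K"
  shows "pauli_entry K u a b = (if a = b then outcome_sign K (\<lambda>k. u k = 3) a else 0)"
proof (cases "a = b")
  case True
  have "pauli_entry K u a b = outcome_sign K (\<lambda>k. u k = 3) a"
    unfolding pauli_entry_def outcome_sign_def True using assms(1)
    by (intro prod.cong refl) (auto simp: pauli1_def bitv_def)
  then show ?thesis using True by simp
next
  case False
  then obtain k where "k < K" "bit a k \<noteq> bit b k" using less_exp_eqI assms by blast
  then show ?thesis using False pauli_entry_diagonal[of k K u a b] assms(1) by auto
qed

lemma pauli_entry_offdiag:
  assumes "k < K" "u k = 1 \<or> u k = 2"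
  shows "pauli_entry K u a a = 0"
proof -
  have "\<exists>k\<in>{..<K}. pauli1 (u k) $$ (bitv a k, bitv a k) = 0"
    using assms by (intro bexI[of _ k]) (auto simp: pauli1_def bitv_def)
  then show ?thesis by (simp add: pauli_entry_def)
qed

text \<open>I and Z letters on the record are diagonal and survive dephasing. An X or Y letter flips
  a record bit and leaves nothing (\<open>block_diag_pauli_eq_0\<close>), so an operator containing
  one has pullback 0.\<close>

lemma block_diag_pauli:
  assumes "\<forall>k<K. u (n + k) = 0 \<or> u (n + k) = 3"
  shows "block_diag n (\<sigma> \<cdot>\<^sub>m pauli_string (n+K) u) = \<sigma> \<cdot>\<^sub>m pauli_string (n+K) u"
  by (intro eq_matI)
    (auto simp: block_diag_def pauli_entry_add pauli_entry_diag[of K "\<lambda>k. u (n+k)"] assms div_exp_less)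

lemma block_diag_pauli_eq_0:
  assumes "k < K" "u (n + k) = 1 \<or> u (n + k) = 2"
  shows "block_diag n (\<sigma> \<cdot>\<^sub>m pauli_string (n+K) u) = 0\<^sub>m (2^(n+K)) (2^(n+K))"
  by (intro eq_matI)
    (auto simp: block_diag_def pauli_entry_add pauli_entry_offdiag[of k K "\<lambda>k. u (n+k)", OF assms])

lemma pauli_string_cong: "(\<And>k. k < n \<Longrightarrow> s k = t k) \<Longrightarrow> pauli_string n s = pauli_string n t"
  by (intro eq_matI) (auto intro: pauli_entry_cong)

text \<open>On block m the Z letters of the record act by their eigenvalue, which is the origin of
  the characters in \<open>stab\<close>.\<close>

lemma pauli_mult_iso_mat_index:
  assumes u: "\<forall>k<num_meas c. u (n + k) = 0 \<or> u (n + k) = 3"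
    and idx: "m < 2^num_meas c" "p < 2^n" "b < 2^n"
  shows "(pauli_string (n + num_meas c) u * iso_mat n c) $$ (m * 2^n + p, b) =
    outcome_sign (num_meas c) (\<lambda>k. u (n + k) = 3) m * (pauli_string n u * C_m n c m) $$ (p, b)"
proof -
  let ?K = "num_meas c" and ?x = "outcome_sign (num_meas c) (\<lambda>k. u (n + k) = 3) m"
  have "(pauli_string (n + ?K) u * iso_mat n c) $$ (m * 2^n + p, b) =
    (\<Sum>m'<2^?K. \<Sum>p'<2^n. pauli_entry n u p p' * pauli_entry ?K (\<lambda>k. u (n+k)) m m' * C_m n c m' $$ (p',b))"
    unfolding mult_mat_index[OF pauli_string_carrier iso_mat_carrier block_idx_less[OF idx(1,2)] idx(3)] sum_blocks
    using idx by (intro sum.cong refl) (simp add: block_idx_less iso_mat_index pauli_entry_add)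
  also have "\<dots> = (\<Sum>m'<2^?K. if m = m' then ?x * (\<Sum>p'<2^n. pauli_entry n u p p' * C_m n c m $$ (p',b)) else 0)"
    using idx by (intro sum.cong refl)
      (auto simp: pauli_entry_diag[of ?K "\<lambda>k. u (n+k)"] u sum_distrib_left mult_ac)
  also have "\<dots> = ?x * (\<Sum>p'<2^n. pauli_entry n u p p' * C_m n c m $$ (p',b))"
    using idx by (simp add: sum.delta)
  also have "\<dots> = ?x * (pauli_string n u * C_m n c m) $$ (p, b)"
    unfolding mult_mat_index[OF pauli_string_carrier C_m_carrier idx(2,3)] using idx by simp
  finally show ?thesis .
qed

lemma iso_mat_mult_index:
  assumes "T \<in> carrier_mat (2^n) (2^n)" "m < 2^num_meas c" "p < 2^n" "b < 2^n"
  shows "(iso_mat n c * T) $$ (m * 2^n + p, b) = (C_m n c m * T) $$ (p, b)"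
  unfolding mult_mat_index[OF iso_mat_carrier assms(1) block_idx_less[OF assms(2,3)] assms(4)]
    mult_mat_index[OF C_m_carrier assms(1,3,4)]
  using assms by (intro sum.cong refl) (simp add: iso_mat_index)

lemma heis_adjoint_image_iff_stab:
  assumes wf: "\<forall>g\<in>set c. wf_op n g" and t: "t \<in> strings {..<n}" and B: "B \<subseteq> {..<n}"
  shows "(\<exists>X\<in>signed_paulis_on (n + num_meas c) (B \<union> {n..<n + num_meas c}).
      pauli_string n t = heis_adjoint n (n + num_meas c) (channel_C n c) X)
    \<longleftrightarrow> (\<exists>s\<in>strings B. (s,t) \<in> stab n c)" (is "?L \<longleftrightarrow> ?R")
proof
  let ?K = "num_meas c" and ?V = "iso_mat n c"
  let ?N = "n + ?K"
  note V = iso_mat_carrier[of n c]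
  have Vd: "dagger ?V \<in> carrier_mat (2^n) (2^?N)" by (rule dagger_carrier[OF V])
  {
    assume ?L
    then obtain \<sigma> u where \<sigma>: "\<sigma> = 1 \<or> \<sigma> = -1" and u: "\<forall>k. u k < 4" "\<forall>k. k \<notin> B \<union> {n..<?N} \<longrightarrow> u k = 0"
      and eq: "pauli_string n t = heis_adjoint n ?N (channel_C n c) (\<sigma> \<cdot>\<^sub>m pauli_string ?N u)"
      unfolding signed_paulis_on_def by blast
    let ?X = "\<sigma> \<cdot>\<^sub>m pauli_string ?N u"
    have X: "?X \<in> carrier_mat (2^?N) (2^?N)" by simp
    have us: "u \<in> strings {..<?N}" using u B by (auto simp: strings_def)
    have eqV: "pauli_string n t = dagger ?V * block_diag n ?X * ?V"
      unfolding eq by (rule heis_adjoint_channel_C[OF X])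
    \<comment> \<open>An X or Y on the record would give pullback 0, whereas the pullback is a Pauli
      string and squares to the identity.\<close>
    have diag: "\<forall>k<?K. u (n + k) = 0 \<or> u (n + k) = 3"
    proof (rule ccontr)
      assume "\<not> ?thesis"
      then obtain k where k: "k < ?K" "u (n + k) \<noteq> 0" "u (n + k) \<noteq> 3" by blast
      have "u (n + k) = 1 \<or> u (n + k) = 2"
        using less_4_cases[OF u(1)[rule_format, of "n + k"]] k(2,3) by simp
      then have "block_diag n ?X = 0\<^sub>m (2^?N) (2^?N)" by (rule block_diag_pauli_eq_0[OF k(1)])
      then have "pauli_string n t = 0\<^sub>m (2^n) (2^n)"
        unfolding eqV using left_mult_zero_mat[OF V] right_mult_zero_mat[OF Vd] by simp
      then have "1\<^sub>m (2^n) = (0\<^sub>m (2^n) (2^n) :: complex mat)"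
        using pauli_string_square[OF t, of n] by simp
      then have "(1\<^sub>m (2^n) :: complex mat) $$ (0,0) = 0\<^sub>m (2^n) (2^n) $$ (0,0)" by simp
      then show False by simp
    qed
    have "dagger ?X = ?X"
      using \<sigma> dagger_pauli_string[OF us, of ?N] by (intro eq_matI) (auto simp: dagger_def pauli_entry_cnj[OF us])
    moreover have "?X * ?X = 1\<^sub>m (2^?N)"
      using \<sigma> pauli_string_square[OF us, of ?N]
      by (auto simp: mult_smult_distrib[of _ "2^?N" "2^?N" _ "2^?N"] mult_smult_assoc_mat[of _ "2^?N" "2^?N" _ "2^?N"]
          smult_smult_mat intro!: eq_matI)
    moreover have "pauli_string n t = dagger ?V * ?X * ?V"
      using eqV by (simp add: block_diag_pauli[OF diag])
    ultimately have VT: "?V * pauli_string n t = ?X * ?V"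
      by (rule isometry_intertwines[OF V iso_mat_isometry[OF wf] X _ _ pauli_string_carrier
            dagger_pauli_string[OF t] pauli_string_square[OF t]])
    \<comment> \<open>The part of u on P becomes the partner string; its part on M becomes the
      character.\<close>
    define s where "s = (\<lambda>k. if k < n then u k else 0)"
    have s: "s \<in> strings B" using u by (auto simp: s_def strings_def)
    have su: "pauli_string n u = pauli_string n s" by (rule pauli_string_cong) (simp add: s_def)
    have "C_m n c m * pauli_string n t =
        (\<sigma> * outcome_sign ?K (\<lambda>k. u (n + k) = 3) m) \<cdot>\<^sub>m (pauli_string n s * C_m n c m)" for m
    proof (rule eq_matI)
      fix p b assume "p < dim_row ((\<sigma> * outcome_sign ?K (\<lambda>k. u (n + k) = 3) m) \<cdot>\<^sub>m (pauli_string n s * C_m n c m))"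
        "b < dim_col ((\<sigma> * outcome_sign ?K (\<lambda>k. u (n + k) = 3) m) \<cdot>\<^sub>m (pauli_string n s * C_m n c m))"
      then have pb: "p < 2^n" "b < 2^n" using carrier_matD[OF C_m_carrier[of n c m]] by auto
      \<comment> \<open>The isometry has only \<open>2^?K\<close> blocks while \<open>stab\<close>
        speaks of every m; both sides are periodic in m.\<close>
      let ?m = "m mod 2^?K"
      have m: "?m < 2^?K" by simp
      have "(C_m n c ?m * pauli_string n t) $$ (p,b) = (?X * ?V) $$ (?m * 2^n + p, b)"
        unfolding VT[symmetric] using pb by (intro iso_mat_mult_index[symmetric]) auto
      also have "?X * ?V = \<sigma> \<cdot>\<^sub>m (pauli_string ?N u * ?V)"
        by (rule mult_smult_assoc_mat[OF pauli_string_carrier V])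
      also have "\<dots> $$ (?m * 2^n + p, b) = \<sigma> * (pauli_string ?N u * ?V) $$ (?m * 2^n + p, b)"
        using block_idx_less[OF m pb(1)] pb(2) carrier_matD[OF V] by (simp del: index_mult_mat(1))
      also have "\<dots> = \<sigma> * outcome_sign ?K (\<lambda>k. u (n + k) = 3) ?m * (pauli_string n s * C_m n c ?m) $$ (p,b)"
        unfolding pauli_mult_iso_mat_index[OF diag m pb] su by simp
      finally show "(C_m n c m * pauli_string n t) $$ (p,b) =
          ((\<sigma> * outcome_sign ?K (\<lambda>k. u (n + k) = 3) m) \<cdot>\<^sub>m (pauli_string n s * C_m n c m)) $$ (p,b)"
        using pb carrier_matD[OF C_m_carrier[of n c m]]
        by (simp add: C_m_mod outcome_sign_mod del: index_mult_mat(1))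
    qed (use carrier_matD[OF C_m_carrier] in auto)
    then have "(s,t) \<in> stab n c"
      using s strings_mono[OF B] t by (intro stabI[OF wf]) auto
    then show ?R using s by blast
  }
  {
    assume ?R
    then obtain s where s: "s \<in> strings B" and st: "(s,t) \<in> stab n c" by blast
    from stab_push[OF st] obtain \<sigma> z where \<sigma>: "\<sigma> \<in> {1,-1}" and push: "\<And>m. C_m n c m * pauli_string n t =
        (\<sigma> * outcome_sign ?K z m) \<cdot>\<^sub>m (pauli_string n s * C_m n c m)" by blast
    \<comment> \<open>Conversely, a character z is realized by Z letters on the record qubits where
      z holds.\<close>
    define u where "u = (\<lambda>k. if k < n then s k else if k < ?N \<and> z (k - n) then 3 else 0)"
    have u: "\<forall>k. u k < 4" "\<forall>k. k \<notin> B \<union> {n..<?N} \<longrightarrow> u k = 0"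
      using s by (auto simp: u_def strings_def)
    have diag: "\<forall>k<?K. u (n + k) = 0 \<or> u (n + k) = 3" by (simp add: u_def)
    have sign: "outcome_sign ?K (\<lambda>k. u (n + k) = 3) m = outcome_sign ?K z m" for m
      unfolding outcome_sign_def by (intro prod.cong refl) (simp add: u_def)
    have su: "pauli_string n u = pauli_string n s" by (rule pauli_string_cong) (simp add: u_def)
    let ?X = "\<sigma> \<cdot>\<^sub>m pauli_string ?N u"
    have X: "?X \<in> carrier_mat (2^?N) (2^?N)" by simp
    have VT: "?V * pauli_string n t = ?X * ?V"
    proof (rule eq_matI)
      fix a b assume "a < dim_row (?X * ?V)" "b < dim_col (?X * ?V)"
      then have ab: "a < 2^?N" "b < 2^n" using carrier_matD[OF V] by auto
      let ?m = "a div 2^n" and ?p = "a mod 2^n"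
      have m: "?m < 2^?K" "?p < 2^n" using div_exp_less[OF ab(1)] by auto
      have a: "?m * 2^n + ?p = a" by (rule div_mult_mod_eq)
      have "(?V * pauli_string n t) $$ (?m * 2^n + ?p, b) = (C_m n c ?m * pauli_string n t) $$ (?p,b)"
        using m ab by (intro iso_mat_mult_index) auto
      also have "\<dots> = \<sigma> * (outcome_sign ?K z ?m * (pauli_string n s * C_m n c ?m) $$ (?p,b))"
        unfolding push using m ab carrier_matD[OF C_m_carrier] by (simp del: index_mult_mat(1))
      also have "\<dots> = \<sigma> * (pauli_string ?N u * ?V) $$ (?m * 2^n + ?p, b)"
        unfolding pauli_mult_iso_mat_index[OF diag m ab(2)] sign su ..
      also have "\<dots> = (\<sigma> \<cdot>\<^sub>m (pauli_string ?N u * ?V)) $$ (?m * 2^n + ?p, b)"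
        unfolding a using ab carrier_matD[OF V] by (simp del: index_mult_mat(1))
      also have "\<sigma> \<cdot>\<^sub>m (pauli_string ?N u * ?V) = ?X * ?V"
        by (rule mult_smult_assoc_mat[OF pauli_string_carrier V, symmetric])
      finally show "(?V * pauli_string n t) $$ (a,b) = (?X * ?V) $$ (a,b)" unfolding a .
    qed (use carrier_matD[OF V] in auto)
    have "heis_adjoint n ?N (channel_C n c) ?X = dagger ?V * ?X * ?V"
      by (simp add: heis_adjoint_channel_C[OF X] block_diag_pauli[OF diag])
    also have "\<dots> = dagger ?V * (?V * pauli_string n t)"
      unfolding VT by (rule assoc_mult_mat[OF Vd X V])
    also have "\<dots> = pauli_string n t"
      using assoc_mult_mat[OF Vd V pauli_string_carrier[of n t]] iso_mat_isometry[OF wf]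
      by (simp add: left_mult_one_mat[OF pauli_string_carrier])
    finally have "pauli_string n t = heis_adjoint n ?N (channel_C n c) ?X" by simp
    moreover have "?X \<in> signed_paulis_on ?N (B \<union> {n..<?N})"
      using u \<sigma> unfolding signed_paulis_on_def by blast
    ultimately show ?L by blast
  }
qed

text \<open>Distinct strings are distinct operators, so operators on A may be counted by their
  codes. Taking B empty gives the count for the record alone.\<close>

lemma H_count_eq_card_stab:
  assumes wf: "\<forall>g\<in>set c. wf_op n g" and A: "A \<subseteq> {..<n}" and B: "B \<subseteq> {..<n}"
  shows "H_count n (n + num_meas c) (channel_C n c) A (B \<union> {n..<n + num_meas c}) =
    card {t \<in> strings A. \<exists>s\<in>strings B. (s,t) \<in> stab n c}"
proof -
  have "{Op \<in> paulis_on n A. \<exists>Ot\<in>signed_paulis_on (n + num_meas c) (B \<union> {n..<n + num_meas c}).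
      Op = heis_adjoint n (n + num_meas c) (channel_C n c) Ot} =
    pauli_string n ` {t \<in> strings A. \<exists>Ot\<in>signed_paulis_on (n + num_meas c) (B \<union> {n..<n + num_meas c}).
      pauli_string n t = heis_adjoint n (n + num_meas c) (channel_C n c) Ot}"
    unfolding paulis_on_def strings_def by blast
  also have "{t \<in> strings A. \<exists>Ot\<in>signed_paulis_on (n + num_meas c) (B \<union> {n..<n + num_meas c}).
      pauli_string n t = heis_adjoint n (n + num_meas c) (channel_C n c) Ot} =
    {t \<in> strings A. \<exists>s\<in>strings B. (s,t) \<in> stab n c}"
    using heis_adjoint_image_iff_stab[OF wf _ B] strings_mono[OF A] by blast
  finally have *: "{Op \<in> paulis_on n A. \<exists>Ot\<in>signed_paulis_on (n + num_meas c) (B \<union> {n..<n + num_meas c}).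
      Op = heis_adjoint n (n + num_meas c) (channel_C n c) Ot} =
    pauli_string n ` {t \<in> strings A. \<exists>s\<in>strings B. (s,t) \<in> stab n c}" .
  have "inj_on (pauli_string n) (strings A)"
  proof (rule inj_onI)
    fix s t assume "s \<in> strings A" "t \<in> strings A" "pauli_string n s = pauli_string n t"
    moreover have "1 \<cdot>\<^sub>m pauli_string n t = pauli_string n t" by (intro eq_matI) auto
    ultimately show "s = t"
      using pauli_string_eq_smult_imp_eq[of s n t 1] strings_mono[OF A] by auto
  qed
  then show ?thesis
    unfolding H_count_def * by (intro card_image) (auto intro: inj_on_subset)
qed

text \<open>The fibre over \<open>t\<close> is a coset of the group of stabilizers supported on \<open>B\<close>.\<close>

lemma card_stab_fibres:
  assumes wf: "\<forall>g\<in>set c. wf_op n g"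
  shows "card {(s,t) \<in> stab n c. s \<in> strings B \<and> t \<in> strings A} =
    card {t \<in> strings A. \<exists>s\<in>strings B. (s,t) \<in> stab n c} * card {s \<in> strings B. (s, \<lambda>_. 0) \<in> stab n c}"
proof -
  define T where "T = {t \<in> strings A. \<exists>s\<in>strings B. (s,t) \<in> stab n c}"
  define S where "S = {s \<in> strings B. (s, \<lambda>_. 0) \<in> stab n c}"
  \<comment> \<open>A representative of each coset; XOR with it carries the fibre over t to the
    fibre over the identity and back.\<close>
  define r where "r = (\<lambda>t. SOME s. s \<in> strings B \<and> (s,t) \<in> stab n c)"
  have r: "r t \<in> strings B \<and> (r t, t) \<in> stab n c" if "t \<in> T" for t
    unfolding r_def using that by (intro someI_ex[of "\<lambda>s. s \<in> strings B \<and> (s,t) \<in> stab n c"]) (auto simp: T_def)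
  have "bij_betw (\<lambda>(t,s). (sxor s (r t), t)) (T \<times> S) {(s,t) \<in> stab n c. s \<in> strings B \<and> t \<in> strings A}"
  proof (rule bij_betwI[where g = "\<lambda>(s,t). (t, sxor s (r t))"])
    show "(\<lambda>(t,s). (sxor s (r t), t)) \<in> T \<times> S \<rightarrow> {(s,t) \<in> stab n c. s \<in> strings B \<and> t \<in> strings A}"
    proof (rule Pi_I)
      fix x assume "x \<in> T \<times> S"
      then obtain t s where x: "x = (t,s)" "t \<in> T" "s \<in> S" by blast
      have "(sxor s (r t), sxor (\<lambda>_. 0) t) \<in> stab n c"
        using x r by (intro stab_sxor[OF wf]) (auto simp: S_def)
      then show "(case x of (t,s) \<Rightarrow> (sxor s (r t), t)) \<in> {(s,t) \<in> stab n c. s \<in> strings B \<and> t \<in> strings A}"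
        using x r sxor_strings by (auto simp: S_def T_def)
    qed
    show "(\<lambda>(s,t). (t, sxor s (r t))) \<in> {(s,t) \<in> stab n c. s \<in> strings B \<and> t \<in> strings A} \<rightarrow> T \<times> S"
    proof (rule Pi_I)
      fix x assume "x \<in> {(s,t) \<in> stab n c. s \<in> strings B \<and> t \<in> strings A}"
      then obtain s t where x: "x = (s,t)" "(s,t) \<in> stab n c" "s \<in> strings B" "t \<in> strings A" by blast
      then have t: "t \<in> T" by (auto simp: T_def)
      have "(sxor s (r t), sxor t t) \<in> stab n c"
        using x r[OF t] by (intro stab_sxor[OF wf]) auto
      then show "(case x of (s,t) \<Rightarrow> (t, sxor s (r t))) \<in> T \<times> S"
        using x t r[OF t] sxor_strings by (auto simp: S_def)
    qed
  qed auto
  then show ?thesis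
    using bij_betw_same_card by (fastforce simp: card_cartesian_product T_def S_def)
qed

section \<open>Stabilizers of the Choi state\<close>

text \<open>The layout of \<open>phi_vec\<close>: the output string s sits on P, the input string t
  on the reference R.\<close>

definition join_strings :: "nat \<Rightarrow> (nat \<Rightarrow> nat) \<times> (nat \<Rightarrow> nat) \<Rightarrow> nat \<Rightarrow> nat" where
  "join_strings n x k = (if k < n then fst x k else snd x (k - n))"

lemma inj_on_join_strings: "inj_on (join_strings n) (strings {..<n} \<times> strings {..<n})"
proof (rule inj_onI, clarify)
  fix s t s' t' assume mem: "s \<in> strings {..<n}" "t \<in> strings {..<n}" "s' \<in> strings {..<n}" "t' \<in> strings {..<n}"
    and eq: "join_strings n (s,t) = join_strings n (s',t')"
  have "s k = s' k" for k
  proof (cases "k < n")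
    case True
    then show ?thesis using fun_cong[OF eq, of k] by (simp add: join_strings_def)
  next
    case False
    then show ?thesis using mem by (simp add: stringsD(2))
  qed
  moreover have "t k = t' k" for k
    using fun_cong[OF eq, of "k + n"] by (simp add: join_strings_def)
  ultimately show "s = s' \<and> t = t'" by auto
qed

lemma join_strings_on_iff:
  assumes "s \<in> strings {..<n}" "t \<in> strings {..<n}" "A \<subseteq> {..<n}" "B \<subseteq> {..<n}"
  shows "join_strings n (s,t) \<in> strings ((\<lambda>k. k + n) ` A \<union> B) \<longleftrightarrow> s \<in> strings B \<and> t \<in> strings A"
proof
  assume j: "join_strings n (s,t) \<in> strings ((\<lambda>k. k + n) ` A \<union> B)"
  have "s k = 0" if "k \<notin> B" for k
  proof (cases "k < n")
    case True
    with that have "k \<notin> (\<lambda>k. k + n) ` A \<union> B" by auto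
    from stringsD(2)[OF j this] True show ?thesis by (simp add: join_strings_def)
  next
    case False
    then show ?thesis using stringsD(2)[OF assms(1)] by simp
  qed
  moreover have "t k = 0" if "k \<notin> A" for k
  proof -
    have "k + n \<notin> (\<lambda>k. k + n) ` A \<union> B" using that assms(4) by auto
    from stringsD(2)[OF j this] show ?thesis by (simp add: join_strings_def)
  qed
  ultimately show "s \<in> strings B \<and> t \<in> strings A"
    using assms(1,2) by (auto simp: strings_def)
next
  assume st: "s \<in> strings B \<and> t \<in> strings A"
  have "join_strings n (s,t) k = 0" if "k \<notin> (\<lambda>k. k + n) ` A \<union> B" for k
  proof (cases "k < n")
    case True
    then show ?thesis using that st stringsD(2)[of s B k] by (auto simp: join_strings_def)
  next
    case False
    then have "k - n \<notin> A" using that by (metis UnI1 image_eqI le_add_diff_inverse2 not_less)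
    then show ?thesis using False st stringsD(2)[of t A] by (auto simp: join_strings_def)
  qed
  moreover have "join_strings n (s,t) k < 4" for k
    using st by (auto simp: join_strings_def stringsD)
  ultimately show "join_strings n (s,t) \<in> strings ((\<lambda>k. k + n) ` A \<union> B)"
    unfolding strings_def by blast
qed

lemma card_join_stab:
  assumes "A \<subseteq> {..<n}" "B \<subseteq> {..<n}"
  shows "card (join_strings n ` stab n c \<inter> strings ((\<lambda>k. k + n) ` A \<union> B)) =
    card {(s,t) \<in> stab n c. s \<in> strings B \<and> t \<in> strings A}"
proof -
  have "join_strings n x \<in> strings ((\<lambda>k. k + n) ` A \<union> B) \<longleftrightarrow> fst x \<in> strings B \<and> snd x \<in> strings A"
    if "x \<in> stab n c" for x
    using join_strings_on_iff[OF stab_strings[of "fst x" "snd x" n c] assms] that by simp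
  then have "join_strings n ` stab n c \<inter> strings ((\<lambda>k. k + n) ` A \<union> B) =
      join_strings n ` {x \<in> stab n c. fst x \<in> strings B \<and> snd x \<in> strings A}"
    by blast
  also have "{x \<in> stab n c. fst x \<in> strings B \<and> snd x \<in> strings A} =
      {(s,t) \<in> stab n c. s \<in> strings B \<and> t \<in> strings A}"
    by auto
  finally have "join_strings n ` stab n c \<inter> strings ((\<lambda>k. k + n) ` A \<union> B) =
      join_strings n ` {(s,t) \<in> stab n c. s \<in> strings B \<and> t \<in> strings A}" .
  moreover have "inj_on (join_strings n) {(s,t) \<in> stab n c. s \<in> strings B \<and> t \<in> strings A}"
    by (rule inj_on_subset[OF inj_on_join_strings]) (use stab_subset in auto)
  ultimately show ?thesis by (simp only: card_image)
qed

text \<open>Transposing \<open>P\<^sub>t\<close> costs only a sign, so \<open>P\<^sub>s C P\<^sub>t = \<plusminus>C\<close> says that the joint Pauli string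
  fixes the Choi vector of \<open>C\<close> up to a sign.\<close>

lemma join_stab_fixes_choi:
  assumes st: "(s,t) \<in> stab n c"
  shows "\<exists>\<sigma>\<in>{1,-1}. \<forall>x<2^(n+n). (\<Sum>y<2^(n+n). pauli_entry (n+n) (join_strings n (s,t)) x y *
      (C_m n c m $$ (y mod 2^n, y div 2^n) / w)) = \<sigma> * (C_m n c m $$ (x mod 2^n, x div 2^n) / w)"
proof -
  let ?C = "C_m n c m" and ?P = "pauli_string n"
  from stab_push[OF st] obtain \<sigma> z where \<sigma>: "\<sigma> \<in> {1,-1}" and push: "?C * ?P t =
        (\<sigma> * outcome_sign (num_meas c) z m) \<cdot>\<^sub>m (?P s * ?C)" by blast
  note str = stab_strings[OF st]
  define \<gamma> where "\<gamma> = \<sigma> * outcome_sign (num_meas c) z m"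
  have \<gamma>: "\<gamma> \<in> {1,-1}" using \<sigma> outcome_sign_cases[of "num_meas c" z m] by (auto simp: \<gamma>_def)
  define \<tau> where "\<tau> = transpose_sign n t"
  have \<tau>: "\<tau> \<in> {1,-1}" using transpose_sign_cases[of n t] by (auto simp: \<tau>_def)
  have PC: "?P s * ?C \<in> carrier_mat (2^n) (2^n)" by (rule mult_carrier_mat[OF pauli_string_carrier C_m_carrier])
  have "?P s * (?C * ?P t) = \<gamma> \<cdot>\<^sub>m (?P s * (?P s * ?C))"
    unfolding push \<gamma>_def by (rule mult_smult_distrib[OF pauli_string_carrier PC])
  also have "?P s * (?P s * ?C) = ?C"
    using assoc_mult_mat[OF pauli_string_carrier pauli_string_carrier C_m_carrier[of n c m], of s s]
      pauli_string_square[OF str(1), of n] left_mult_one_mat[OF C_m_carrier[of n c m]] by simp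
  finally have PCP: "?P s * ?C * ?P t = \<gamma> \<cdot>\<^sub>m ?C"
    using assoc_mult_mat[OF pauli_string_carrier C_m_carrier pauli_string_carrier, of n s c m t] by simp
  have "(\<Sum>y<2^(n+n). pauli_entry (n+n) (join_strings n (s,t)) x y * (?C $$ (y mod 2^n, y div 2^n) / w))
      = \<tau> * \<gamma> * (?C $$ (x mod 2^n, x div 2^n) / w)" if x: "x < 2^(n+n)" for x
  proof -
    let ?p = "x mod 2^n" and ?q = "x div 2^n"
    have pq: "?p < 2^n" "?q < 2^n" using div_exp_less[OF x] by auto
    have js: "pauli_entry n (join_strings n (s,t)) = pauli_entry n s"
      by (intro ext pauli_entry_cong) (simp add: join_strings_def)
    have jt: "(\<lambda>k. join_strings n (s,t) (n + k)) = t" by (simp add: join_strings_def)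
    have "(\<Sum>y<2^(n+n). pauli_entry (n+n) (join_strings n (s,t)) x y * (?C $$ (y mod 2^n, y div 2^n) / w))
      = (\<Sum>r<2^n. \<Sum>p<2^n. pauli_entry n s ?p p * pauli_entry n t ?q r * (?C $$ (p,r) / w))"
      unfolding sum_blocks by (intro sum.cong refl) (simp add: pauli_entry_add js jt)
    \<comment> \<open>On R the string acts with row index \<open>?q\<close>; transposing it moves
      that index to the right of \<open>?C\<close>, where a matrix product can form.\<close>
    also have "\<dots> = (\<Sum>r<2^n. \<Sum>p<2^n. \<tau> * (?P s $$ (?p,p) * ?C $$ (p,r) * ?P t $$ (r,?q)) / w)"
      using pq by (intro sum.cong refl)
        (simp add: \<tau>_def pauli_entry_transpose[OF str(2), of n ?q] mult_ac)
    also have "\<dots> = \<tau> * (\<Sum>p<2^n. \<Sum>r<2^n. ?P s $$ (?p,p) * ?C $$ (p,r) * ?P t $$ (r,?q)) / w"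
      by (subst sum.swap) (simp only: sum_distrib_left sum_divide_distrib)
    also have "\<dots> = \<tau> * (?P s * ?C * ?P t) $$ (?p,?q) / w"
      unfolding mult3_index[OF pauli_string_carrier C_m_carrier pauli_string_carrier pq] ..
    also have "\<dots> = \<tau> * \<gamma> * (?C $$ (?p,?q) / w)"
      unfolding PCP using pq carrier_matD[OF C_m_carrier] by simp
    finally show ?thesis .
  qed
  moreover have "\<tau> * \<gamma> \<in> {1,-1}" using \<tau> \<gamma> by auto
  ultimately show ?thesis by blast
qed

theorem theorem2:
  fixes n :: nat and c :: "circ_op list" and A B :: "nat set" and m :: nat
  assumes "\<forall>g \<in> set c. wf_op n g"
    and "A \<subseteq> {0..<n}" and "B \<subseteq> {0..<n}"
    and "m < 2 ^ num_meas c"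
    and "p_m n c m \<noteq> 0"
  shows "mutual_info (2*n) (phi_state n c m) ((\<lambda>k. k + n) ` A) B =
     log 2 (real (H_count n (n + num_meas c) (channel_C n c) A (B \<union> {n..<n + num_meas c})))
   - log 2 (real (H_count n (n + num_meas c) (channel_C n c) A {n..<n + num_meas c}))"
proof -
  note wf = assms(1)
  have A: "A \<subseteq> {..<n}" and B: "B \<subseteq> {..<n}" using assms(2,3) by auto
  let ?C = "C_m n c m" and ?AR = "(\<lambda>k. k + n) ` A" and ?N = "n + n"
  have dims: "dim_row ?C = 2^n" "dim_col ?C = 2^n" using carrier_matD[OF C_m_carrier] by auto
  \<comment> \<open>The normalization in \<open>phi_vec\<close>. Its square is \<open>2^n\<close>
    times the outcome probability, so it is nonzero by assumption.\<close>
  define w where "w = sqrt (\<Sum>p<2^n. \<Sum>r<2^n. (cmod (?C $$ (p,r)))^2)"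
  have w2: "w * w = (\<Sum>p<2^n. \<Sum>r<2^n. (cmod (?C $$ (p,r)))^2)"
    unfolding w_def by (intro real_sqrt_mult_self[THEN trans] abs_of_nonneg sum_nonneg) auto
  have "w \<noteq> 0"
  proof
    assume "w = 0"
    then have "(\<Sum>p<2^n. \<Sum>r<2^n. (cmod (?C $$ (p,r)))^2) = 0" using w2 by simp
    moreover have "mtrace (?C * dagger ?C) = complex_of_real (\<Sum>p<2^n. \<Sum>r<2^n. (cmod (?C $$ (p,r)))^2)"
      unfolding mtrace_mult[OF C_m_carrier dagger_carrier[OF C_m_carrier]] of_real_sum complex_norm_square
      by (intro sum.cong refl) (simp add: dagger_index[OF C_m_carrier])
    ultimately show False using assms(5) by (simp add: p_m_def)
  qed
  define \<psi> where "\<psi> = (\<lambda>x. ?C $$ (x mod 2^n, x div 2^n) / complex_of_real w)"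
  have phi: "phi_state n c m = mat (2^?N) (2^?N) (\<lambda>(x,y). \<psi> x * cnj (\<psi> y))"
    unfolding phi_state_def phi_vec_def Let_def w_def[symmetric] mult_2
    by (intro eq_matI) (auto simp: \<psi>_def)
  have norm: "(\<Sum>a<2^?N. \<psi> a * cnj (\<psi> a)) = 1"
  proof -
    have "(\<Sum>a<2^?N. \<psi> a * cnj (\<psi> a)) = (\<Sum>r<2^n. \<Sum>p<2^n. complex_of_real ((cmod (?C $$ (p,r)))^2) / (of_real (w * w)))"
      unfolding sum_blocks by (intro sum.cong refl) (simp add: \<psi>_def complex_norm_square del: of_real_power)
    also have "\<dots> = complex_of_real (\<Sum>p<2^n. \<Sum>r<2^n. (cmod (?C $$ (p,r)))^2) / of_real (w * w)"
      by (subst sum.swap) (simp only: of_real_sum sum_divide_distrib)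
    also have "\<dots> = 1" unfolding w2[symmetric] using \<open>w \<noteq> 0\<close> by simp
    finally show ?thesis .
  qed
  define G where "G = join_strings n ` stab n c"
  have Gsub: "G \<subseteq> strings {..<?N}"
  proof -
    have N: "{..<?N} = (\<lambda>k. k + n) ` {..<n} \<union> {..<n}"
    proof (intro equalityI subsetI)
      fix x assume "x \<in> {..<?N}"
      then have "x < n \<or> x = (x - n) + n \<and> x - n < n" by auto
      then show "x \<in> (\<lambda>k. k + n) ` {..<n} \<union> {..<n}" by blast
    qed auto
    have "join_strings n x \<in> strings {..<?N}" if "x \<in> stab n c" for x
      unfolding N using join_strings_on_iff[OF stab_strings[of "fst x" "snd x" n c], of "{..<n}" "{..<n}"]
        stab_strings[of "fst x" "snd x" n c] that by simp
    then show ?thesis unfolding G_def by blast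
  qed
  \<comment> \<open>The Choi state lives on 2n qubits, so the \<open>4^n\<close> pairs of
    \<open>card_stab_ge\<close> are as many stabilizers as \<open>stabilizer_entropy\<close>
    demands.\<close>
  have "(2::nat) ^ ?N = 4 ^ n" by (simp add: power_add flip: power_mult_distrib)
  then have Gcard: "2 ^ ?N \<le> card G"
    using card_stab_ge[OF wf] card_image[OF inj_on_subset[OF inj_on_join_strings stab_subset]] by (simp add: G_def)
  have Gfix: "\<exists>\<sigma>\<in>{1,-1}. \<forall>a<2^?N. (\<Sum>b<2^?N. pauli_entry ?N u a b * \<psi> b) = \<sigma> * \<psi> a" if "u \<in> G" for u
  proof -
    from that obtain s t where "(s,t) \<in> stab n c" and u: "u = join_strings n (s,t)" unfolding G_def by auto
    from join_stab_fixes_choi[OF this(1)] show ?thesis unfolding u \<psi>_def by blast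
  qed
  define g where "g = (\<lambda>X. card (G \<inter> strings X))"
  have g_pos: "g X > 0" if "X \<subseteq> {..<?N}" for X
    unfolding g_def by (rule stabilizer_entropy(1)[OF that norm Gsub Gcard Gfix])
  have ent: "vn_entropy (reduced ?N X (phi_state n c m)) = real (card X) - log 2 (g X)" if "X \<subseteq> {..<?N}" for X
    unfolding phi g_def by (rule stabilizer_entropy(2)[OF that norm Gsub Gcard Gfix])
  have sub: "?AR \<subseteq> {..<?N}" "B \<subseteq> {..<?N}" "?AR \<union> B \<subseteq> {..<?N}" using A B by auto
  have pos: "g ?AR > 0" "g B > 0" "g (?AR \<union> B) > 0"
    using g_pos sub by auto
  have fin: "finite A" "finite B" using A B finite_subset by auto
  \<comment> \<open>The two regions are disjoint, so the terms \<open>card X\<close> of the three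
    entropies cancel and only stabilizer counts remain.\<close>
  have "card (?AR \<union> B) = card ?AR + card B"
    using fin A B by (intro card_Un_disjoint) auto
  then have "mutual_info (2*n) (phi_state n c m) ?AR B = log 2 (g (?AR \<union> B)) - log 2 (g ?AR) - log 2 (g B)"
    unfolding mutual_info_def mult_2 ent[OF sub(1)] ent[OF sub(2)] ent[OF sub(3)] by simp
  define T where "T = (\<lambda>B. card {t \<in> strings A. \<exists>s\<in>strings B. (s,t) \<in> stab n c})"
  have zero: "strings {} = {\<lambda>_. 0}" by (auto simp: strings_def)
  have gAB: "g (?AR \<union> B) = T B * card {s \<in> strings B. (s, \<lambda>_. 0) \<in> stab n c}"
    unfolding g_def G_def T_def card_join_stab[OF A B] by (rule card_stab_fibres[OF wf])
  have gB: "g B = card {s \<in> strings B. (s, \<lambda>_. 0) \<in> stab n c}"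
  proof -
    have "g B = card {(s,t) \<in> stab n c. s \<in> strings B \<and> t \<in> strings {}}"
      using card_join_stab[of "{}" n B c] B by (simp add: g_def G_def)
    also have "{(s,t) \<in> stab n c. s \<in> strings B \<and> t \<in> strings {}} =
        (\<lambda>s. (s, \<lambda>_. 0)) ` {s \<in> strings B. (s, \<lambda>_. 0) \<in> stab n c}"
      by (auto simp: zero)
    also have "card \<dots> = card {s \<in> strings B. (s, \<lambda>_. 0) \<in> stab n c}"
      by (rule card_image) (auto simp: inj_on_def)
    finally show ?thesis .
  qed
  \<comment> \<open>A partner supported on the empty set is the identity string, so a pair is
    determined by t.\<close>
  have gA: "g ?AR = T {}"
  proof -
    have "g ?AR = card {(s,t) \<in> stab n c. s \<in> strings {} \<and> t \<in> strings A}"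
      using card_join_stab[of A n "{}" c] A by (simp add: g_def G_def)
    also have "{(s,t) \<in> stab n c. s \<in> strings {} \<and> t \<in> strings A} =
        (\<lambda>t. (\<lambda>_. 0, t)) ` {t \<in> strings A. \<exists>s\<in>strings {}. (s,t) \<in> stab n c}"
      by (auto simp: zero)
    also have "card \<dots> = T {}"
      unfolding T_def by (rule card_image) (auto simp: inj_on_def)
    finally show ?thesis .
  qed
  \<comment> \<open>The fibre size in \<open>gAB\<close> is \<open>g B\<close>, which cancels
    against the entropy of B and leaves the ratio of \<open>T B\<close> to
    \<open>T {}\<close>.\<close>
  have "log 2 (g (?AR \<union> B)) = log 2 (T B) + log 2 (g B)"
    using pos(3) unfolding gAB gB[symmetric] by (simp add: log_mult)
  moreover have "H_count n (n + num_meas c) (channel_C n c) A (B \<union> {n..<n + num_meas c}) = T B"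
    unfolding T_def by (rule H_count_eq_card_stab[OF wf A B])
  moreover have "H_count n (n + num_meas c) (channel_C n c) A {n..<n + num_meas c} = T {}"
    using H_count_eq_card_stab[OF wf A, of "{}"] by (simp add: T_def)
  ultimately show ?thesis
    using \<open>mutual_info _ _ _ _ = _\<close> gA by simp
qed

end
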